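(* If $G=\mathsf{inc}(P)$ for a natural unit interval order $P$ then $$\overline X_G(q)=\sum_{T\in\mathscr{G}_P}q^{\mathrm{inv}_G(T)}\,\overline s_{\lambda(T)}.$$
   Context: $\mathbb{P}=\{1,2,3,\dots\}$ and $\mathsf{Set}(\mathbb{P})$ is the set of finite nonempty subsets of $\mathbb{P}$. For $S,T\in\mathsf{Set}(\mathbb{P})$ write $S\prec T$ if $\max S<\min T$ and $S\preceq T$ if $\max S\le\min T$. A natural unit interval order is a poset $P$ on a finite subset of $\mathbb{P}$ such that if $x<_Pz$ then $x<z$ and every $y$ incomparable in $P$ to both $x$ and $z$ has $x<y<z$. The incomparability graph $\mathsf{inc}(P)$ has the elements of $P$ as vertices and the pairs $\{x,y\}$ of incomparable elements as edges; it is an ordered graph via the usual order on integers. For an ordered graph $G$ (finite simple graph with a total order $<$ on vertices), define $\overline X_G(q)=\sum_\kappa q^{\mathrm{asc}_G(\kappa)}\prod_{v\in V(G)}\prod_{j\in\kappa(v)}x_j$ over all maps $\kappa:V(G)\to\mathsf{Set}(\mathbb{P})$ with $\kappa(u)\cap\kappa(v)=\varnothing$ for all $\{u,v\}\in E(G)$, where $\mathrm{asc}_G(\kappa)$ is the number of tuples $(u,v,i,j)$ with $\{u,v\}\in E(G)$, $u<v$, $i\in\kappa(u)$, $j\in\kappa(v)$ and $i<j$. For a partition $\lambda$ let $\mathsf{D}_\lambda=\{(i,j)\in\mathbb{P}\times\mathbb{P}:1\le j\le\lambda_i\}$; write $\mu\subseteq\lambda$ if $\mathsf{D}_\mu\subseteq\mathsf{D}_\lambda$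 and set $\mathsf{D}_{\lambda/\mu}=\mathsf{D}_\lambda\setminus\mathsf{D}_\mu$. A semistandard set-valued tableau of shape $\lambda$ is an assignment of sets $T_{ij}\in\mathsf{Set}(\mathbb{P})$ to the cells $(i,j)\in\mathsf{D}_\lambda$ with $T_{ij}\preceq T_{i,j+1}$ and $T_{ij}\prec T_{i+1,j}$ whenever these are defined. With $x^T=\prod_{(i,j)}\prod_{k\in T_{ij}}x_k$ and $|T|=\sum_{(i,j)}|T_{ij}|$, the symmetric Grothendieck function is $\overline s_\lambda=\sum_T(-1)^{|T|-|\lambda|}x^T$, over all semistandard set-valued tableaux $T$ of shape $\lambda$. A Grothendieck $P$-tableau of shape $\lambda$ is a pair $T=(U,V)$ such that: (a) $U$ is a filling of $\mathsf{D}_\mu$ by elements of $P$ for some partition $\mu\subseteq\lambda$ such that each element of $P$ is in at least one cell, and for each $(i,j)\in\mathsf{D}_\mu$ one has $U_{ij}<_PU_{i,j+1}$ if $(i,j+1)\in\mathsf{D}_\mu$ and $U_{ij}\not>_PU_{i+1,j}$ if $(i+1,j)\in\mathsf{D}_\mu$; (b) $V$ is a semistandard tableau of shape $\lambda/\mu$ (a filling of $\mathsf{D}_{\lambda/\mu}$ by positive integers, weakly increasing along rows as column indices increase and strictly increasing down columns as row indices increase) whose entries in each row $i$ are all less than $i$. $\mathscr{G}_P$ is the set of all Grothendieck $P$-tableaux (of all shapes), and $\lambda(T)$ is the shape of $T$. For $T=(U,V)\in\mathscr{G}_P$ with $U$ of shape $\mu$, $\mathrm{inv}_G(T)$ is the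 number of pairs of cells $(i,j),(k,l)\in\mathsf{D}_\mu$ with $i<k$ such that $U_{ij}$ and $U_{kl}$ are incomparable in $P$ and $U_{ij}>U_{kl}$ as integers. The sum may be infinite; it is interpreted as a formal sum of power series, in which each $\overline s_\lambda$ has coefficient a polynomial in $q$. *)

theory Defs
  imports "HOL-Library.Multiset" "HOL-Library.FuncSet" "HOL-Computational_Algebra.Polynomial"
begin

definition SetP :: "nat set set" where
  "SetP = {S. finite S \<and> S \<noteq> {} \<and> 0 \<notin> S}"

definition set_less :: "nat set \<Rightarrow> nat set \<Rightarrow> bool"  (infix "\<prec>" 50) where
  "S \<prec> T \<longleftrightarrow> Max S < Min T"

definition set_less_eq :: "nat set \<Rightarrow> nat set \<Rightarrow> bool"  (infix "\<preceq>" 50) where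
  "S \<preceq> T \<longleftrightarrow> Max S \<le> Min T"


subsection \<open>Formal power series in infinitely many variables\<close>

text \<open>
  A power series in \<open>x\<^sub>1, x\<^sub>2, \<dots>\<close> is its coefficient function. The multiset \<open>m\<close> stands for the
  monomial in which \<open>x\<^sub>i\<close> has exponent \<open>count m i\<close>. The coefficients are polynomials in \<open>q\<close>, and
  \<open>q\<^sup>n\<close> is \<open>monom 1 n\<close>.
\<close>

type_synonym power_series = "nat multiset \<Rightarrow> int poly"

definition single_term :: "int poly \<Rightarrow> nat multiset \<Rightarrow> power_series" where
  "single_term c m = (\<lambda>m'. if m' = m then c else 0)"

definition scale :: "int poly \<Rightarrow> power_series \<Rightarrow> power_series" where
  "scale c f = (\<lambda>m. c * f m)"

text \<open>
  A possibly infinite family of power series can be added if each monomial occurs in only finitely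
  many members; the sum is then taken coefficientwise.
\<close>

definition formally_summable :: "('i \<Rightarrow> power_series) \<Rightarrow> 'i set \<Rightarrow> bool" where
  "formally_summable f A \<longleftrightarrow> (\<forall>m. finite {a \<in> A. f a m \<noteq> 0})"

definition formal_sum :: "('i \<Rightarrow> power_series) \<Rightarrow> 'i set \<Rightarrow> power_series" where
  "formal_sum f A = (\<lambda>m. \<Sum>a \<in> {a \<in> A. f a m \<noteq> 0}. f a m)"


subsection \<open>Ordered graphs\<close>

text \<open>A graph is a pair of a vertex set and a set of two-element edges.\<close>

type_synonym 'a graph = "'a set \<times> 'a set set"

definition proper_set_colorings :: "'a graph \<Rightarrow> ('a \<Rightarrow> nat set) set" where
  "proper_set_colorings G =
     {\<kappa> \<in> fst G \<rightarrow>\<^sub>E SetP. \<forall>u v. {u, v} \<in> snd G \<longrightarrow> \<kappa> u \<inter> \<kappa> v = {}}"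

definition asc :: "'a::linorder graph \<Rightarrow> ('a \<Rightarrow> nat set) \<Rightarrow> nat" where
  "asc G \<kappa> = card {(u, v, i, j). {u, v} \<in> snd G \<and> u < v \<and> i \<in> \<kappa> u \<and> j \<in> \<kappa> v \<and> i < j}"

definition X_bar :: "'a::linorder graph \<Rightarrow> power_series" where
  "X_bar G =
     formal_sum (\<lambda>\<kappa>. single_term (monom 1 (asc G \<kappa>)) (\<Sum>v\<in>fst G. mset_set (\<kappa> v)))
       (proper_set_colorings G)"


subsection \<open>Natural unit interval orders\<close>

text \<open>
  Posets are given by their reflexive order relation \<open>r\<close> on the set \<open>P\<close>; in particular, no element
  is incomparable to itself.
\<close>

definition strictly_below :: "'a rel \<Rightarrow> 'a \<Rightarrow> 'a \<Rightarrow> bool" where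
  "strictly_below r x y \<longleftrightarrow> (x, y) \<in> r \<and> x \<noteq> y"

definition incomparable :: "'a set \<Rightarrow> 'a rel \<Rightarrow> 'a \<Rightarrow> 'a \<Rightarrow> bool" where
  "incomparable P r x y \<longleftrightarrow> x \<in> P \<and> y \<in> P \<and> (x, y) \<notin> r \<and> (y, x) \<notin> r"

definition natural_unit_interval_order :: "nat set \<Rightarrow> nat rel \<Rightarrow> bool" where
  "natural_unit_interval_order P r \<longleftrightarrow>
     finite P \<and> 0 \<notin> P \<and> partial_order_on P r \<and>
     (\<forall>x z. strictly_below r x z \<longrightarrow>
        x < z \<and> (\<forall>y. incomparable P r x y \<and> incomparable P r y z \<longrightarrow> x < y \<and> y < z))"

definition inc :: "'a set \<Rightarrow> 'a rel \<Rightarrow> 'a graph" where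
  "inc P r = (P, {{x, y} | x y. incomparable P r x y})"


subsection \<open>Partitions and fillings\<close>

text \<open>A partition is the list of its nonzero parts, so \<open>\<lambda>\<^sub>i\<close> is \<open>lam ! (i - 1)\<close>.\<close>

definition is_partition :: "nat list \<Rightarrow> bool" where
  "is_partition lam \<longleftrightarrow> sorted_wrt (\<ge>) lam \<and> 0 \<notin> set lam"

definition diagram :: "nat list \<Rightarrow> (nat \<times> nat) set" where
  "diagram lam = {(i, j). 1 \<le> i \<and> i \<le> length lam \<and> 1 \<le> j \<and> j \<le> lam ! (i - 1)}"

text \<open>A filling is a partial map whose domain is the set of filled cells.\<close>

type_synonym 'b filling = "nat \<times> nat \<rightharpoonup> 'b"

definition fillings :: "(nat \<times> nat) set \<Rightarrow> 'b set \<Rightarrow> 'b filling set" where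
  "fillings D A = {F. dom F = D \<and> ran F \<subseteq> A}"

abbreviation entry :: "'b filling \<Rightarrow> nat \<Rightarrow> nat \<Rightarrow> 'b" where
  "entry F i j \<equiv> the (F (i, j))"


subsection \<open>Symmetric Grothendieck functions\<close>

definition set_valued_tableaux :: "nat list \<Rightarrow> nat set filling set" where
  "set_valued_tableaux lam =
     {T \<in> fillings (diagram lam) SetP.
        (\<forall>i j. (i, j) \<in> diagram lam \<and> (i, j + 1) \<in> diagram lam \<longrightarrow>
           entry T i j \<preceq> entry T i (j + 1)) \<and>
        (\<forall>i j. (i, j) \<in> diagram lam \<and> (i + 1, j) \<in> diagram lam \<longrightarrow>
           entry T i j \<prec> entry T (i + 1) j)}"

definition tableau_weight :: "nat set filling \<Rightarrow> nat multiset" where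
  "tableau_weight T = (\<Sum>(i, j)\<in>dom T. mset_set (entry T i j))"

definition tableau_size :: "nat set filling \<Rightarrow> nat" where
  "tableau_size T = (\<Sum>(i, j)\<in>dom T. card (entry T i j))"

text \<open>The subtraction in the exponent does not truncate, since every entry is nonempty.\<close>

definition s_bar :: "nat list \<Rightarrow> power_series" where
  "s_bar lam =
     formal_sum (\<lambda>T. single_term ((- 1) ^ (tableau_size T - sum_list lam)) (tableau_weight T))
       (set_valued_tableaux lam)"


subsection \<open>Grothendieck tableaux of a poset\<close>

definition P_tableaux :: "'a set \<Rightarrow> 'a rel \<Rightarrow> nat list \<Rightarrow> 'a filling set" where
  "P_tableaux P r mu =
     {U \<in> fillings (diagram mu) P.
        P \<subseteq> ran U \<and>
        (\<forall>i j. (i, j) \<in> diagram mu \<and> (i, j + 1) \<in> diagram mu \<longrightarrow>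
           strictly_below r (entry U i j) (entry U i (j + 1))) \<and>
        (\<forall>i j. (i, j) \<in> diagram mu \<and> (i + 1, j) \<in> diagram mu \<longrightarrow>
           \<not> strictly_below r (entry U (i + 1) j) (entry U i j))}"

definition skew_tableaux :: "nat list \<Rightarrow> nat list \<Rightarrow> nat filling set" where
  "skew_tableaux lam mu =
     {V \<in> fillings (diagram lam - diagram mu) {1..}.
        (\<forall>i j j'. (i, j) \<in> dom V \<and> (i, j') \<in> dom V \<and> j < j' \<longrightarrow> entry V i j \<le> entry V i j') \<and>
        (\<forall>i i' j. (i, j) \<in> dom V \<and> (i', j) \<in> dom V \<and> i < i' \<longrightarrow> entry V i j < entry V i' j)}"

definition grothendieck_tableaux_of_shape ::
  "'a set \<Rightarrow> 'a rel \<Rightarrow> nat list \<Rightarrow> ('a filling \<times> nat filling) set" where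
  "grothendieck_tableaux_of_shape P r lam =
     {(U, V). \<exists>mu. is_partition mu \<and> diagram mu \<subseteq> diagram lam \<and>
        U \<in> P_tableaux P r mu \<and> V \<in> skew_tableaux lam mu \<and>
        (\<forall>i j. (i, j) \<in> dom V \<longrightarrow> entry V i j < i)}"

definition grothendieck_tableaux :: "'a set \<Rightarrow> 'a rel \<Rightarrow> ('a filling \<times> nat filling) set" where
  "grothendieck_tableaux P r =
     (\<Union>lam\<in>{lam. is_partition lam}. grothendieck_tableaux_of_shape P r lam)"

definition shape :: "'a filling \<times> nat filling \<Rightarrow> nat list" where
  "shape T = (THE lam. is_partition lam \<and> diagram lam = dom (fst T) \<union> dom (snd T))"

definition inv_G :: "'a::linorder set \<Rightarrow> 'a rel \<Rightarrow> 'a filling \<times> nat filling \<Rightarrow> nat" where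
  "inv_G P r T =
     card {((i, j), (k, l)). (i, j) \<in> dom (fst T) \<and> (k, l) \<in> dom (fst T) \<and> i < k \<and>
        incomparable P r (entry (fst T) i j) (entry (fst T) k l) \<and>
        entry (fst T) i j > entry (fst T) k l}"


subsection \<open>The definitions are meaningful\<close>

lemma inc_simple_graph:
  assumes "partial_order_on P r" "e \<in> snd (inc P r)"
  shows "e \<subseteq> P \<and> card e = 2"
proof -
  obtain x y where e: "e = {x, y}" and xy: "incomparable P r x y"
    using assms(2) by (auto simp: inc_def)
  moreover have "x \<noteq> y"
    using xy partial_order_onD(1)[OF assms(1)] by (auto simp: incomparable_def refl_on_def)
  ultimately show ?thesis by (auto simp: incomparable_def)
qed

lemma diagram_inject:
  assumes "is_partition lam" "is_partition mu" "diagram lam = diagram mu"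
  shows "lam = mu"
proof -
  have len: "length a \<le> length b" if "is_partition a" "diagram a \<subseteq> diagram b" for a b
  proof (rule ccontr)
    assume "\<not> length a \<le> length b"
    then have "length b < length a" by simp
    moreover from this have "a ! length b > 0"
      using that(1) nth_mem[of "length b" a] by (metis is_partition_def gr0I)
    ultimately have "(length b + 1, 1) \<in> diagram a" by (simp add: diagram_def)
    with that(2) have "(length b + 1, 1) \<in> diagram b" by blast
    then show False by (simp add: diagram_def)
  qed
  have le: "a ! k \<le> b ! k" if "is_partition a" "diagram a \<subseteq> diagram b" "k < length a" for a b k
  proof -
    have "a ! k > 0"
      using that nth_mem[of k a] by (metis is_partition_def gr0I)
    then have "(k + 1, a ! k) \<in> diagram a" using that by (simp add: diagram_def)
    with that(2) have "(k + 1, a ! k) \<in> diagram b" by blast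
    then show ?thesis by (simp add: diagram_def)
  qed
  have "length lam = length mu" using len[of lam mu] len[of mu lam] assms by auto
  then show ?thesis
    using le[of lam mu] le[of mu lam] assms by (intro nth_equalityI) (auto intro: antisym)
qed

lemma shape_eq:
  assumes "is_partition lam" "T \<in> grothendieck_tableaux_of_shape P r lam"
  shows "shape T = lam"
proof -
  obtain mu where "diagram mu \<subseteq> diagram lam" "dom (fst T) = diagram mu"
      "dom (snd T) = diagram lam - diagram mu"
    using assms(2)
    unfolding grothendieck_tableaux_of_shape_def P_tableaux_def skew_tableaux_def fillings_def
    by fastforce
  then have "dom (fst T) \<union> dom (snd T) = diagram lam" by blast
  then show ?thesis
    unfolding shape_def using assms(1) diagram_inject by (intro the_equality) auto
qed

lemma finite_diagram: "finite (diagram lam)"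
proof (rule finite_subset)
  show "diagram lam \<subseteq> (SIGMA i:{1..length lam}. {1..lam ! (i - 1)})"
    by (auto simp: diagram_def)
qed auto

lemma formally_summable_X_bar:
  assumes "finite (fst G)"
  shows "formally_summable
    (\<lambda>\<kappa>. single_term (monom 1 (asc G \<kappa>)) (\<Sum>v\<in>fst G. mset_set (\<kappa> v)))
    (proper_set_colorings G)"
  unfolding formally_summable_def
proof
  fix m
  have "{\<kappa> \<in> proper_set_colorings G.
      single_term (monom 1 (asc G \<kappa>)) (\<Sum>v\<in>fst G. mset_set (\<kappa> v)) m \<noteq> 0}
    \<subseteq> fst G \<rightarrow>\<^sub>E Pow (set_mset m)" (is "?L \<subseteq> _")
  proof
    fix \<kappa> assume "\<kappa> \<in> ?L"
    then have \<kappa>: "\<kappa> \<in> fst G \<rightarrow>\<^sub>E SetP" and m: "m = (\<Sum>v\<in>fst G. mset_set (\<kappa> v))"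
      by (auto simp: proper_set_colorings_def single_term_def split: if_splits)
    have "\<kappa> v \<subseteq> set_mset m" if "v \<in> fst G" for v
    proof -
      have "finite (\<kappa> v)" using \<kappa> that by (auto simp: SetP_def PiE_iff)
      then have "\<kappa> v = set_mset (mset_set (\<kappa> v))" by simp
      also have "\<dots> \<subseteq> set_mset m"
        unfolding m using assms that by (auto simp: set_mset_sum)
      finally show ?thesis .
    qed
    then show "\<kappa> \<in> fst G \<rightarrow>\<^sub>E Pow (set_mset m)" using \<kappa> by (auto simp: PiE_iff)
  qed
  then show "finite ?L" by (rule finite_subset) (simp add: finite_PiE assms)
qed

lemma formally_summable_s_bar:
  "formally_summable
    (\<lambda>T. single_term ((- 1) ^ (tableau_size T - sum_list lam)) (tableau_weight T))
    (set_valued_tableaux lam)"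
  unfolding formally_summable_def
proof
  fix m
  have "{T \<in> set_valued_tableaux lam.
      single_term ((- 1) ^ (tableau_size T - sum_list lam)) (tableau_weight T) m \<noteq> 0}
    \<subseteq> {T. dom T = diagram lam \<and> ran T \<subseteq> Pow (set_mset m)}" (is "?L \<subseteq> _")
  proof
    fix T assume "T \<in> ?L"
    then have T: "dom T = diagram lam" "ran T \<subseteq> SetP" and m: "m = tableau_weight T"
      by (auto simp: set_valued_tableaux_def fillings_def single_term_def split: if_splits)
    have "S \<subseteq> set_mset m" if "S \<in> ran T" for S
    proof -
      obtain i j where ij: "T (i, j) = Some S" using \<open>S \<in> ran T\<close> by (auto simp: ran_def)
      have "finite S" using T(2) that by (auto simp: SetP_def)
      then have "S = set_mset (mset_set (entry T i j))" using ij by simp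
      also have "\<dots> \<subseteq> (\<Union>c\<in>dom T. set_mset (mset_set (the (T c))))" using ij by blast
      also have "\<dots> = set_mset m"
        unfolding m tableau_weight_def using finite_diagram[of lam] T(1)
        by (auto simp: set_mset_sum case_prod_unfold)
      finally show ?thesis .
    qed
    then show "T \<in> {T. dom T = diagram lam \<and> ran T \<subseteq> Pow (set_mset m)}" using T by auto
  qed
  then show "finite ?L"
    by (rule finite_subset) (simp add: finite_set_of_finite_maps finite_diagram)
qed

end

theory Submission
  imports Defs "HOL-Combinatorics.Permutations"
begin

text \<open>
  The coefficient of a single monomial only involves finitely many variables, so fix \<open>n\<close> and work with
  \<open>x\<^sub>1, \<dots>, x\<^sub>n\<close>. The proof consists of two expansions that meet in the Schur polynomials.

  \<^bold>\<open>From Schur to Grothendieck polynomials.\<close> Removing the letter \<open>n\<close> from a set-valued tableau of shape \<open>\<lambda>\<close>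
  leaves one of a shape \<open>\<nu>\<close> that interlaces with \<open>\<lambda>\<close>. Every cell of \<open>\<lambda>\<close> outside \<open>\<nu>\<close> contributes \<open>x\<^sub>n\<close>, and
  every row with \<open>\<nu>\<^sub>i > \<lambda>\<^sub>i\<^sub>+\<^sub>1\<close> contributes a factor \<open>1 - x\<^sub>n\<close>, because its last cell in \<open>\<nu>\<close> may contain
  \<open>n\<close> as well. Granting this factor to the first \<open>k\<close> rows only defines a family \<open>groth k\<close> that leads from
  Schur polynomials (\<open>k = 0\<close>) to Grothendieck polynomials (\<open>k = n\<close>). A single step from \<open>k\<close> to \<open>k + 1\<close>
  is an expansion over the horizontal strips below row \<open>k + 1\<close> (\<open>groth_strips\<close>). It follows by induction
  on \<open>n\<close>: once the shapes two levels apart are fixed, the rows of the shape between them vary independently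
  in intervals, and the two sides agree after a reflection of these intervals and one telescoping sum
  (\<open>strip_interlacing_exchange\<close>). A sequence of such strips, the \<open>k\<close>-th one filled with the letter \<open>k\<close>,
  is exactly a filling \<open>V\<close> whose entries in row \<open>i\<close> are less than \<open>i\<close> (\<open>sum_elegant\<close>).

  \<^bold>\<open>From colorings to Schur polynomials.\<close> A set coloring is the same as an array whose rows, the color
  classes, are chains of \<open>P\<close> with union \<open>P\<close>. Let \<open>c(\<gamma>)\<close> be the generating function, by inversions, of the
  arrays with row lengths \<open>\<gamma>\<close>. The unit interval condition forces incomparable elements of two chains to be
  neighbours in their union (\<open>no_crossing\<close>), so that the incomparability graph on two chains consists of
  paths. Exchanging the colors on all paths with an odd number of vertices exchanges the lengths of the two
  chains and keeps the number of inversions; hence \<open>c\<close> is symmetric (\<open>array_count_symmetric\<close>).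

  A symmetric function \<open>c\<close> is a combination of Schur polynomials whose coefficients are the alternating
  sums of \<open>c\<close> at the vectors \<open>\<sigma>(\<mu> + \<delta>) - \<delta>\<close> (\<open>symmetric_eq_kostka_sum\<close>). For the arrays, these alternating
  sums are evaluated by Gasharov's involution, which exchanges the tails of two adjacent rows at
  the first place where the column condition of a tableau is violated. Exchanging only the uneven paths
  within the tails, as Shareshian and Wachs do, preserves the inversions too
  (\<open>pivot_swap_rows\<close>, \<open>alternation_array_count\<close>). What survives are the arrays formed by the rows of the
  tableaux \<open>U\<close>. Combining both expansions gives the sum over the pairs \<open>(U, V)\<close>.
\<close>

section \<open>Partitions and a branching recursion\<close>

text \<open>
  Partitions with at most \<open>n\<close> parts, as zero-based functions padded with zeros. Interlacing and adding
  strips then become conditions on each row separately, without reference to the number of parts.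
\<close>

definition Par :: "nat \<Rightarrow> (nat \<Rightarrow> nat) set" where
  "Par n = {p. antimono p \<and> (\<forall>i\<ge>n. p i = 0)}"

definition interlacing :: "nat \<Rightarrow> (nat \<Rightarrow> nat) \<Rightarrow> (nat \<Rightarrow> nat) set" where
  "interlacing n p = {\<nu>. (\<forall>i<n. p (Suc i) \<le> \<nu> i \<and> \<nu> i \<le> p i) \<and> (\<forall>i\<ge>n. \<nu> i = 0)}"

text \<open>
  What the largest variable \<open>x\<close> contributes when the shape shrinks from \<open>p\<close> to \<open>\<nu>\<close>: one factor \<open>x\<close> for
  every removed cell, and for the counted rows whose last cell could hold the largest letter in addition,
  the choice between \<open>1\<close> and \<open>- x\<close>.
\<close>

definition branching_weight :: "'a \<Rightarrow> nat \<Rightarrow> nat \<Rightarrow> (nat \<Rightarrow> nat) \<Rightarrow> (nat \<Rightarrow> nat) \<Rightarrow> 'a::comm_ring_1" where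
  "branching_weight x k n p \<nu> =
     x ^ (sum p {..n} - sum \<nu> {..<n}) * (1 - x) ^ card {i. i < n \<and> i < k \<and> p (Suc i) < \<nu> i}"

text \<open>
  The coefficient of the monomial with exponents \<open>\<gamma> 0, \<dots>, \<gamma> (n - 1)\<close> in a polynomial in \<open>n\<close> variables,
  which is a Schur polynomial for \<open>k = 0\<close> and a Grothendieck polynomial for \<open>k \<ge> n\<close>.
\<close>

fun groth :: "nat \<Rightarrow> nat \<Rightarrow> (nat \<Rightarrow> nat) \<Rightarrow> (nat \<Rightarrow> nat) \<Rightarrow> int poly" where
  "groth k 0 p \<gamma> = 1"
| "groth k (Suc n) p \<gamma> =
     (\<Sum>\<nu>\<in>interlacing n p. groth k n \<nu> \<gamma> * coeff (branching_weight [:0, 1:] k n p \<nu>) (\<gamma> n))"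

text \<open>
  The shapes that arise from \<open>p\<close> by adding a horizontal strip to the rows after the first \<open>k + 1\<close>.
\<close>

definition strips :: "nat \<Rightarrow> nat \<Rightarrow> (nat \<Rightarrow> nat) \<Rightarrow> (nat \<Rightarrow> nat) set" where
  "strips k n p = {\<kappa>. (\<forall>i\<le>k. \<kappa> i = p i) \<and> (\<forall>i. k < i \<and> i < n \<longrightarrow> p i \<le> \<kappa> i \<and> \<kappa> i \<le> p (i - 1)) \<and>
     (\<forall>i\<ge>n. \<kappa> i = 0)}"

lemma Par_mono: "p \<in> Par n \<Longrightarrow> i \<le> j \<Longrightarrow> p j \<le> p i"
  by (auto simp: Par_def antimono_def)

lemma Par_zero: "p \<in> Par n \<Longrightarrow> n \<le> i \<Longrightarrow> p i = 0"
  by (auto simp: Par_def)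

lemma ParI: "(\<And>i. p (Suc i) \<le> p i) \<Longrightarrow> (\<And>i. n \<le> i \<Longrightarrow> p i = 0) \<Longrightarrow> p \<in> Par n"
  by (auto simp: Par_def antimono_iff_le_Suc)

lemma finite_bounded_support:
  "finite {p :: nat \<Rightarrow> nat. (\<forall>i<n. p i \<le> b i) \<and> (\<forall>i\<ge>n. p i = 0)}"
proof (rule finite_subset)
  show "{p :: nat \<Rightarrow> nat. (\<forall>i<n. p i \<le> b i) \<and> (\<forall>i\<ge>n. p i = 0)} \<subseteq>
      (\<lambda>g i. if i < n then g i else 0) ` (PiE {..<n} (\<lambda>i. {..b i}))"
  proof
    fix p :: "nat \<Rightarrow> nat"
    assume p: "p \<in> {p. (\<forall>i<n. p i \<le> b i) \<and> (\<forall>i\<ge>n. p i = 0)}"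
    then have "p = (\<lambda>i. if i < n then restrict p {..<n} i else 0)" by auto
    moreover have "restrict p {..<n} \<in> PiE {..<n} (\<lambda>i. {..b i})" using p by auto
    ultimately show "p \<in> (\<lambda>g i. if i < n then g i else 0) ` (PiE {..<n} (\<lambda>i. {..b i}))" by blast
  qed
qed (intro finite_imageI finite_PiE, auto)

lemma finite_interlacing: "finite (interlacing n p)"
  by (rule finite_subset[OF _ finite_bounded_support[of n p]]) (auto simp: interlacing_def)

lemma strips_Par:
  assumes "p \<in> Par n" "\<kappa> \<in> strips k n p"
  shows "\<kappa> \<in> Par n"
proof (rule ParI)
  fix i
  show "\<kappa> (Suc i) \<le> \<kappa> i"
  proof (cases "Suc i < n \<and> k < Suc i")
    case True
    then have "\<kappa> (Suc i) \<le> p i" using assms(2) by (auto simp: strips_def)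
    also have "p i \<le> \<kappa> i" using assms(2) True by (cases "i = k") (auto simp: strips_def)
    finally show ?thesis .
  next
    case False
    then show ?thesis using assms Par_mono[OF assms(1), of i "Suc i"]
      by (auto simp: strips_def not_less)
  qed
qed (use assms(2) in \<open>auto simp: strips_def\<close>)

lemma finite_strips: "finite (strips k n p)"
proof (rule finite_subset[OF _ finite_bounded_support[of n "\<lambda>i. max (p i) (p (i - 1))"]])
  show "strips k n p \<subseteq> {\<kappa>. (\<forall>i<n. \<kappa> i \<le> max (p i) (p (i - 1))) \<and> (\<forall>i\<ge>n. \<kappa> i = 0)}"
    by (auto simp: strips_def) (metis le_max_iff_disj not_le order_refl)
qed

lemma interlacing_Par: "p \<in> Par (Suc n) \<Longrightarrow> \<nu> \<in> interlacing n p \<Longrightarrow> \<nu> \<in> Par n"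
proof (rule ParI)
  fix i assume *: "p \<in> Par (Suc n)" "\<nu> \<in> interlacing n p"
  show "\<nu> (Suc i) \<le> \<nu> i"
  proof (cases "Suc i < n")
    case True
    then have "\<nu> (Suc i) \<le> p (Suc i)" "p (Suc i) \<le> \<nu> i" using * by (auto simp: interlacing_def)
    then show ?thesis by simp
  qed (use * in \<open>auto simp: interlacing_def\<close>)
qed (auto simp: interlacing_def)

lemma interlacing_size:
  assumes "\<nu> \<in> interlacing n p"
  shows "sum \<nu> {..<n} \<le> sum p {..n}"
proof -
  have "sum \<nu> {..<n} \<le> sum p {..<n}" using assms by (intro sum_mono) (auto simp: interlacing_def)
  also have "\<dots> \<le> sum p {..n}" by (intro sum_mono2) auto
  finally show ?thesis .
qed

section \<open>From Schur to Grothendieck polynomials\<close>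

text \<open>
  The range of the one row that gains a factor \<open>1 - x\<close> in the step from \<open>k\<close> to \<open>k + 1\<close>.
\<close>

lemma telescoping_sum:
  fixes x :: "'a::comm_ring_1"
  assumes "a \<le> b"
  shows "(\<Sum>t\<in>{a..b}. x ^ t * (if t < b then 1 - x else 1)) = x ^ a"
  using assms
proof (induction rule: inc_induct)
  case base
  then show ?case by simp
next
  case (step m)
  have "{m..b} = insert m {Suc m..b}" using step by auto
  then show ?case using step by (simp add: algebra_simps)
qed

text \<open>
  Adding a strip and then passing to an interlacing shape has the same effect as doing this in the
  opposite order, if rows count towards the factor \<open>1 - x\<close> up to row \<open>k\<close> in the first case and before
  row \<open>k\<close> in the second one. If row \<open>k\<close> and the rows before it are compatible with \<open>\<mu>\<close> and \<open>\<nu>\<close>, then \<open>\<kappa> (i + 1)\<close> and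
  \<open>\<rho> i\<close> range over the same interval from \<open>max (\<mu> (i + 1)) (\<nu> (i + 1))\<close> to \<open>min (\<mu> i) (\<nu> i)\<close>, for all
  \<open>i > k\<close>. The size of the inner shape \<open>\<rho>\<close> counts negatively, so these intervals have to be reflected. The
  row \<open>\<kappa> (k + 1)\<close> has no counterpart, and the sum over its values telescopes to a single power of \<open>x\<close>.
\<close>

lemma strip_interlacing_exchange:
  fixes x :: "'a::idom"
  assumes x: "x \<noteq> 0" and \<mu>: "\<mu> \<in> Par (Suc n)" and \<nu>: "\<nu> \<in> Par n"
  shows "(\<Sum>\<kappa>\<in>{\<kappa> \<in> strips k (Suc n) \<mu>. \<nu> \<in> interlacing n \<kappa>}. branching_weight x (Suc k) n \<kappa> \<nu>) =
         (\<Sum>\<rho>\<in>{\<rho> \<in> interlacing n \<mu>. \<nu> \<in> strips k n \<rho>}. branching_weight x k n \<mu> \<rho>)"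
    (is "sum ?f ?L = sum ?g ?R")
proof (cases "n \<le> k")
  case True
  have "strips k (Suc n) \<mu> = {\<mu>}"
  proof -
    have "\<kappa> i = \<mu> i" if "\<kappa> \<in> strips k (Suc n) \<mu>" for \<kappa> i
      using True that Par_zero[OF \<mu>, of i] by (cases "i \<le> k") (auto simp: strips_def)
    moreover have "\<mu> \<in> strips k (Suc n) \<mu>" using True Par_zero[OF \<mu>] by (auto simp: strips_def)
    ultimately have "\<kappa> \<in> strips k (Suc n) \<mu> \<longleftrightarrow> \<kappa> = \<mu>" for \<kappa> by blast
    then show ?thesis by auto
  qed
  then have L: "?L = (if \<nu> \<in> interlacing n \<mu> then {\<mu>} else {})" by auto
  have "\<nu> \<in> strips k n \<rho> \<longleftrightarrow> \<rho> = \<nu>" if "\<rho> \<in> interlacing n \<mu>" for \<rho>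
  proof -
    have "\<nu> i = \<rho> i" if "\<nu> \<in> strips k n \<rho>" for i
      using True that \<open>\<rho> \<in> interlacing n \<mu>\<close>
      by (cases "i \<le> k") (auto simp: strips_def interlacing_def)
    moreover have "\<rho> \<in> strips k n \<rho>" using True that by (auto simp: strips_def interlacing_def)
    ultimately show ?thesis by (metis ext)
  qed
  then have R: "?R = (if \<nu> \<in> interlacing n \<mu> then {\<nu>} else {})" by auto
  have "{i. i < n \<and> i < Suc k \<and> \<mu> (Suc i) < \<nu> i} = {i. i < n \<and> i < k \<and> \<mu> (Suc i) < \<nu> i}"
    using True by auto
  then show ?thesis unfolding L R by (simp add: branching_weight_def)
next
  case False
  then have kn: "k < n" by simp
  \<comment> \<open>The interval from \<open>M i\<close> to \<open>m i\<close> is the range of \<open>\<kappa> (i + 1)\<close> and of \<open>\<rho> i\<close>; \<open>C\<close> is the condition on the rows up to \<open>k\<close>.\<close>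
  define M where "M i = max (\<mu> (Suc i)) (\<nu> (Suc i))" for i
  define m where "m i = min (\<mu> i) (\<nu> i)" for i
  define C where "C \<longleftrightarrow> (\<forall>i<k. \<mu> (Suc i) \<le> \<nu> i \<and> \<nu> i \<le> \<mu> i) \<and> \<nu> k \<le> \<mu> k"
  define a where "a = sum \<mu> {..k}"
  define b where "b = card {i. i < k \<and> \<mu> (Suc i) < \<nu> i}"
  have split_n: "{..n} = {..k} \<union> Suc ` {k..<n}" "{..k} \<inter> Suc ` {k..<n} = {}"
    using kn by (auto simp: image_Suc_atLeastLessThan)
  have sum_n: "sum h {..n} = sum h {..k} + (\<Sum>i\<in>{k..<n}. h (Suc i))" for h :: "nat \<Rightarrow> nat"
  proof -
    have "sum h {..n} = sum h {..k} + sum h (Suc ` {k..<n})"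
      unfolding split_n(1) by (rule sum.union_disjoint) (use split_n(2) in auto)
    then show ?thesis by (simp only: sum.reindex[OF inj_Suc] comp_def)
  qed
  have size_nu: "sum \<nu> {..<n} = sum \<nu> {..n}"
    using Par_zero[OF \<nu>, of n] by (simp add: lessThan_Suc_atMost[symmetric])
  show ?thesis
  proof (cases C)
    case C: True
    then have C': "\<nu> k \<le> \<mu> k" "\<And>i. i < k \<Longrightarrow> \<mu> (Suc i) \<le> \<nu> i \<and> \<nu> i \<le> \<mu> i"
      by (auto simp: C_def)
    define g where "g i t = x ^ t * (if i = k \<and> t < \<nu> k then 1 - x else 1)" for i t
    \<comment> \<open>The factor \<open>x ^ |\<nu>|\<close> turns the subtraction of sizes in the exponents into an addition.\<close>
    have "sum (\<lambda>\<kappa>. x ^ sum \<nu> {..<n} * ?f \<kappa>) ?L =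
        (\<Sum>h\<in>PiE {k..<n} (\<lambda>i. {M i..m i}). x ^ a * (1 - x) ^ b * (\<Prod>i\<in>{k..<n}. g i (h i)))"
    proof (rule sum.reindex_bij_witness[where
          j = "\<lambda>\<kappa>. restrict (\<lambda>i. \<kappa> (Suc i)) {k..<n}" and
          i = "\<lambda>h i. if i \<le> k then \<mu> i else if i \<le> n then h (i - 1) else 0"], goal_cases)
      case (1 \<kappa>)
      then show ?case by (auto simp: strips_def fun_eq_iff le_Suc_eq not_le)
    next
      case (2 \<kappa>)
      show ?case
      proof (rule PiE_I)
        fix i assume i: "i \<in> {k..<n}"
        have "k < Suc i \<and> Suc i < Suc n" using i by auto
        then have "\<mu> (Suc i) \<le> \<kappa> (Suc i) \<and> \<kappa> (Suc i) \<le> \<mu> (Suc i - 1)"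
          using 2 unfolding strips_def by blast
        moreover have "\<kappa> (Suc i) \<le> \<nu> i" using 2 i by (auto simp: interlacing_def)
        moreover have "\<nu> (Suc i) \<le> \<kappa> (Suc i)"
          using 2 i Par_zero[OF \<nu>, of n] by (cases "Suc i = n") (auto simp: interlacing_def)
        ultimately show "restrict (\<lambda>i. \<kappa> (Suc i)) {k..<n} i \<in> {M i..m i}"
          using i by (simp add: M_def m_def)
      qed auto
    next
      case (3 h)
      then show ?case by (auto simp: fun_eq_iff PiE_iff extensional_def)
    next
      case (4 h)
      have h: "\<mu> (Suc i) \<le> h i \<and> \<nu> (Suc i) \<le> h i \<and> h i \<le> \<mu> i \<and> h i \<le> \<nu> i" if "k \<le> i" "i < n" for i
        using 4 that by (auto simp: PiE_iff M_def m_def)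
      let ?l = "\<lambda>i. if i \<le> k then \<mu> i else if i \<le> n then h (i - 1) else 0"
      have "?l \<in> strips k (Suc n) \<mu>"
        unfolding strips_def
      proof (safe, goal_cases)
        case (2 i)
        then show ?case using h[of "i - 1"] by auto
      next
        case (3 i)
        then show ?case using h[of "i - 1"] by auto
      qed (use kn in auto)
      moreover have "\<nu> \<in> interlacing n ?l"
        unfolding interlacing_def
      proof (safe, goal_cases)
        case (1 i)
        then show ?case using h[of i] C'(2)[of i] by auto
      next
        case (2 i)
        then show ?case using h[of "i - 1"] C'(1) C'(2)[of i] by (cases "i < k"; cases "i = k") auto
      qed (use Par_zero[OF \<nu>] in auto)
      ultimately show ?case by simp
    next
      case (5 \<kappa>)
      have l: "\<kappa> i = \<mu> i" if "i \<le> k" for i using 5 that by (auto simp: strips_def)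
      have "x ^ sum \<nu> {..<n} * x ^ (sum \<kappa> {..n} - sum \<nu> {..<n}) = x ^ sum \<kappa> {..n}"
        using interlacing_size[of \<nu> n \<kappa>] 5 by (simp flip: power_add)
      moreover have "sum \<kappa> {..n} = a + (\<Sum>i\<in>{k..<n}. \<kappa> (Suc i))"
        unfolding sum_n a_def using l by simp
      ultimately have e1: "x ^ sum \<nu> {..<n} * x ^ (sum \<kappa> {..n} - sum \<nu> {..<n}) =
          x ^ a * (\<Prod>i\<in>{k..<n}. x ^ \<kappa> (Suc i))" by (metis power_add power_sum)
      have "{i. i < n \<and> i < Suc k \<and> \<kappa> (Suc i) < \<nu> i} =
          {i. i < k \<and> \<mu> (Suc i) < \<nu> i} \<union> (if \<kappa> (Suc k) < \<nu> k then {k} else {})"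
        using kn l by (auto simp: less_Suc_eq)
      then have e2: "card {i. i < n \<and> i < Suc k \<and> \<kappa> (Suc i) < \<nu> i} =
          b + (if \<kappa> (Suc k) < \<nu> k then 1 else 0)"
        by (auto simp: b_def)
      have e3: "(\<Prod>i\<in>{k..<n}. g i (restrict (\<lambda>i. \<kappa> (Suc i)) {k..<n} i)) =
          (\<Prod>i\<in>{k..<n}. x ^ \<kappa> (Suc i)) * (if \<kappa> (Suc k) < \<nu> k then 1 - x else 1)"
      proof -
        have "(\<Prod>i\<in>{k..<n}. g i (restrict (\<lambda>i. \<kappa> (Suc i)) {k..<n} i)) =
          (\<Prod>i\<in>{k..<n}. x ^ \<kappa> (Suc i) * (if k = i then (if \<kappa> (Suc k) < \<nu> k then 1 - x else 1) else 1))"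
          by (intro prod.cong) (auto simp: g_def)
        also have "\<dots> = (\<Prod>i\<in>{k..<n}. x ^ \<kappa> (Suc i)) * (if \<kappa> (Suc k) < \<nu> k then 1 - x else 1)"
          using kn by (simp add: prod.distrib prod.delta)
        finally show ?thesis .
      qed
      show ?case unfolding branching_weight_def e2 e3 using e1
        by (simp add: algebra_simps)
    qed
    also have "\<dots> = x ^ a * (1 - x) ^ b * (\<Prod>i\<in>{k..<n}. \<Sum>t\<in>{M i..m i}. g i t)"
      by (simp add: prod_sum_PiE sum_distrib_left)
    also have "{k..<n} = insert k {Suc k..<n}" using kn by auto
    also have "(\<Prod>i\<in>insert k {Suc k..<n}. \<Sum>t\<in>{M i..m i}. g i t) =
        (\<Sum>t\<in>{M k..m k}. g k t) * (\<Prod>i\<in>{Suc k..<n}. \<Sum>t\<in>{M i..m i}. g i t)" by simp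
    also have "(\<Prod>i\<in>{Suc k..<n}. \<Sum>t\<in>{M i..m i}. g i t) = (\<Prod>i\<in>{Suc k..<n}. \<Sum>t\<in>{M i..m i}. x ^ t)"
      by (intro prod.cong sum.cong) (auto simp: g_def)
    also have "m k = \<nu> k" using C' by (simp add: m_def)
    also have "(\<Sum>t\<in>{M k..\<nu> k}. g k t) = (if M k \<le> \<nu> k then x ^ M k else 0)"
      using telescoping_sum[of "M k" "\<nu> k" x] by (auto simp: g_def)
    finally have L: "x ^ sum \<nu> {..<n} * sum ?f ?L = x ^ a * (1 - x) ^ b *
        ((if M k \<le> \<nu> k then x ^ M k else 0) * (\<Prod>i\<in>{Suc k..<n}. \<Sum>t\<in>{M i..m i}. x ^ t))"
      by (simp add: sum_distrib_left)
    have "x ^ sum \<nu> {..<n} * sum ?g ?R = x ^ a * (1 - x) ^ b *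
        ((if M k \<le> \<nu> k then x ^ M k else 0) * (\<Prod>i\<in>{Suc k..<n}. \<Sum>t\<in>{M i..m i}. x ^ t))"
    proof (cases "M k \<le> \<nu> k")
      case False
      have R0: "?R = {}"
      proof (safe, goal_cases)
        case (1 \<rho>)
        then have "\<rho> k = \<nu> k" "\<mu> (Suc k) \<le> \<rho> k" using kn by (auto simp: strips_def interlacing_def)
        then show ?case using False Par_mono[OF \<nu>, of k "Suc k"] by (auto simp: M_def)
      qed
      show ?thesis unfolding R0 using False by simp
    next
      case Mk: True
      have sizes: "sum \<nu> {..<n} + sum \<mu> {..n} =
          sum \<nu> {..k} + a + M k + (\<Sum>i\<in>{Suc k..<n}. M i + m i)"
      proof -
        have "(\<Sum>i\<in>{k..<n}. \<mu> (Suc i) + \<nu> (Suc i)) =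
            (\<Sum>i\<in>{k..<n}. M i + min (\<mu> (Suc i)) (\<nu> (Suc i)))"
          by (intro sum.cong) (auto simp: M_def)
        also have "\<dots> = (\<Sum>i\<in>{k..<n}. M i) + (\<Sum>i\<in>Suc ` {k..<n}. m i)"
          by (simp only: sum.distrib sum.reindex[OF inj_Suc] comp_def m_def)
        also have "Suc ` {k..<n} = insert n {Suc k..<n}" using kn by auto
        also have "(\<Sum>i\<in>insert n {Suc k..<n}. m i) = (\<Sum>i\<in>{Suc k..<n}. m i)"
          using Par_zero[OF \<nu>, of n] by (simp add: m_def)
        also have "(\<Sum>i\<in>{k..<n}. M i) = M k + (\<Sum>i\<in>{Suc k..<n}. M i)"
          using kn by (simp add: sum.atLeast_Suc_lessThan)
        finally show ?thesis unfolding size_nu sum_n[of \<nu>] sum_n[of \<mu>] a_def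
          by (simp add: sum.distrib)
      qed
      have "sum (\<lambda>\<rho>. x ^ sum \<nu> {..<n} * ?g \<rho>) ?R =
        (\<Sum>h\<in>PiE {Suc k..<n} (\<lambda>i. {M i..m i}).
            x ^ (a + M k) * (1 - x) ^ b * (\<Prod>i\<in>{Suc k..<n}. x ^ (M i + m i - h i)))"
      proof (rule sum.reindex_bij_witness[where
          j = "\<lambda>\<rho>. restrict \<rho> {Suc k..<n}" and
          i = "\<lambda>h i. if i \<le> k then \<nu> i else if i < n then h i else 0"], goal_cases)
        case (1 \<rho>)
        then show ?case by (auto simp: strips_def interlacing_def fun_eq_iff)
      next
        case (2 \<rho>)
        show ?case
        proof (rule PiE_I)
          fix i assume i: "i \<in> {Suc k..<n}"
          have "\<mu> (Suc i) \<le> \<rho> i" "\<rho> i \<le> \<mu> i" "\<rho> i \<le> \<nu> i"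
            using 2 i by (auto simp: strips_def interlacing_def)
          moreover have "\<nu> (Suc i) \<le> \<rho> i"
          proof (cases "Suc i = n")
            case False
            then have "k < Suc i \<and> Suc i < n" using i by auto
            then have "\<nu> (Suc i) \<le> \<rho> (Suc i - 1)" using 2 unfolding strips_def by blast
            then show ?thesis by simp
          qed (use Par_zero[OF \<nu>, of n] in auto)
          ultimately show "restrict \<rho> {Suc k..<n} i \<in> {M i..m i}"
            using i by (simp add: M_def m_def)
        qed auto
      next
        case (3 h)
        then show ?case by (auto simp: fun_eq_iff PiE_iff extensional_def)
      next
        case (4 h)
        have h: "\<mu> (Suc i) \<le> h i \<and> \<nu> (Suc i) \<le> h i \<and> h i \<le> \<mu> i \<and> h i \<le> \<nu> i" if "k < i" "i < n" for i
          using 4 that by (auto simp: PiE_iff M_def m_def)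
        let ?r = "\<lambda>i. if i \<le> k then \<nu> i else if i < n then h i else 0"
        have "?r \<in> interlacing n \<mu>"
          unfolding interlacing_def
        proof (safe, goal_cases)
          case (1 i)
          then show ?case using h[of i] C'(2)[of i] Mk by (cases "i < k"; cases "i = k") (auto simp: M_def)
        next
          case (2 i)
          then show ?case using h[of i] C'(1) C'(2)[of i] by (cases "i < k"; cases "i = k") auto
        qed (use kn in auto)
        moreover have "\<nu> \<in> strips k n ?r"
          unfolding strips_def
        proof (safe, goal_cases)
          case (2 i)
          then show ?case using h[of i] by auto
        next
          case (3 i)
          then show ?case using h[of "i - 1"] Par_mono[OF \<nu>, of "i - 1" i] by (cases "i = Suc k") auto
        qed (use Par_zero[OF \<nu>] in auto)
        ultimately show ?case by simp
      next
        case (5 \<rho>)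
        have r: "\<rho> i = \<nu> i" if "i \<le> k" for i using 5 that by (auto simp: strips_def)
        have rm: "\<rho> i \<le> m i" if "i \<in> {Suc k..<n}" for i
          using 5 that by (auto simp: strips_def interlacing_def m_def)
        have rsum: "sum \<rho> {..<n} = sum \<nu> {..k} + sum \<rho> {Suc k..<n}"
        proof -
          have e: "{..<n} = {..k} \<union> {Suc k..<n}" using kn by auto
          have "sum \<rho> {..<n} = sum \<rho> {..k} + sum \<rho> {Suc k..<n}"
            unfolding e by (rule sum.union_disjoint) auto
          then show ?thesis using r by simp
        qed
        have "(\<Sum>i\<in>{Suc k..<n}. M i + m i - \<rho> i) + sum \<rho> {Suc k..<n} = (\<Sum>i\<in>{Suc k..<n}. M i + m i)"
          using rm by (subst sum.distrib[symmetric], intro sum.cong) (auto simp: trans_le_add2)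
        then have "sum \<nu> {..<n} + (sum \<mu> {..n} - sum \<rho> {..<n}) =
            a + M k + (\<Sum>i\<in>{Suc k..<n}. M i + m i - \<rho> i)"
          using sizes rsum interlacing_size[of \<rho> n \<mu>] 5 by simp
        then have e1: "x ^ sum \<nu> {..<n} * x ^ (sum \<mu> {..n} - sum \<rho> {..<n}) =
            x ^ (a + M k) * (\<Prod>i\<in>{Suc k..<n}. x ^ (M i + m i - \<rho> i))"
          by (simp only: power_add[symmetric] power_sum[symmetric])
        have e2: "{i. i < n \<and> i < k \<and> \<mu> (Suc i) < \<rho> i} = {i. i < k \<and> \<mu> (Suc i) < \<nu> i}"
          using kn r by auto
        have e3: "(\<Prod>i\<in>{Suc k..<n}. x ^ (M i + m i - restrict \<rho> {Suc k..<n} i)) =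
           (\<Prod>i\<in>{Suc k..<n}. x ^ (M i + m i - \<rho> i))" by (intro prod.cong) auto
        show ?case unfolding branching_weight_def e2 e3 b_def using e1
          by (simp add: algebra_simps)
      qed
      also have "\<dots> = x ^ (a + M k) * (1 - x) ^ b *
          (\<Prod>i\<in>{Suc k..<n}. \<Sum>t\<in>{M i..m i}. x ^ (M i + m i - t))"
        by (simp add: prod_sum_PiE sum_distrib_left)
      also have "(\<Prod>i\<in>{Suc k..<n}. \<Sum>t\<in>{M i..m i}. x ^ (M i + m i - t)) =
          (\<Prod>i\<in>{Suc k..<n}. \<Sum>t\<in>{M i..m i}. x ^ t)"
        by (intro prod.cong refl, subst (2) sum.atLeastAtMost_rev) (simp add: add.commute)
      finally show ?thesis using Mk by (simp add: sum_distrib_left power_add algebra_simps)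
    qed
    then have "x ^ sum \<nu> {..<n} * sum ?f ?L = x ^ sum \<nu> {..<n} * sum ?g ?R"
      by (rule trans[OF L sym])
    moreover have "x ^ sum \<nu> {..<n} \<noteq> 0" by (rule power_not_zero[OF x])
    ultimately show ?thesis using mult_left_cancel by blast
  next
    case C: False
    have L0: "?L = {}"
    proof (safe, goal_cases)
      case (1 \<kappa>)
      then have l: "\<kappa> i = \<mu> i" if "i \<le> k" for i using that by (auto simp: strips_def)
      have il: "\<kappa> (Suc i) \<le> \<nu> i \<and> \<nu> i \<le> \<kappa> i" if "i < n" for i
        using 1 that by (auto simp: interlacing_def)
      have "\<mu> (Suc i) \<le> \<nu> i \<and> \<nu> i \<le> \<mu> i" if "i < k" for i
        using l[of i] l[of "Suc i"] il[of i] kn that by auto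
      moreover have "\<nu> k \<le> \<mu> k" using l[of k] il[of k] kn by auto
      ultimately have C by (auto simp: C_def)
      then show ?case using C by simp
    qed
    have R0: "?R = {}"
    proof (safe, goal_cases)
      case (1 \<rho>)
      then have r: "\<rho> i = \<nu> i" if "i \<le> k" for i using that by (auto simp: strips_def)
      have il: "\<mu> (Suc i) \<le> \<rho> i \<and> \<rho> i \<le> \<mu> i" if "i < n" for i
        using 1 that by (auto simp: interlacing_def)
      have "\<mu> (Suc i) \<le> \<nu> i \<and> \<nu> i \<le> \<mu> i" if "i < k" for i
        using r[of i] il[of i] kn that by auto
      moreover have "\<nu> k \<le> \<mu> k" using r[of k] il[of k] kn by auto
      ultimately have C by (auto simp: C_def)
      then show ?case using C by simp
    qed
    show ?thesis unfolding L0 R0 by simp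
  qed
qed

text \<open>
  By induction on the number of variables, both sides become sums over the shape \<open>\<nu>\<close> that is filled with
  the smaller letters, and the coefficients of each \<open>\<nu>\<close> agree by the exchange of strips and interlacing.
\<close>

lemma groth_strips:
  assumes "\<mu> \<in> Par n"
  shows "groth k n \<mu> \<gamma> = (\<Sum>\<kappa>\<in>strips k n \<mu>. groth (Suc k) n \<kappa> \<gamma>)"
  using assms
proof (induction n arbitrary: \<mu>)
  case 0
  have "\<kappa> \<in> strips k 0 \<mu> \<longleftrightarrow> \<kappa> = \<mu>" for \<kappa>
    using Par_zero[OF 0] by (auto simp: strips_def)
  then have "strips k 0 \<mu> = {\<mu>}" by auto
  then show ?case by simp
next
  case (Suc n)
  note \<mu> = Suc.prems
  let ?X = "[:0, 1:] :: int poly poly"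
  let ?w = "\<lambda>k p \<nu>. coeff (branching_weight ?X k n p \<nu>) (\<gamma> n)"
  have fin: "finite (\<Union>\<kappa>\<in>strips k (Suc n) \<mu>. interlacing n \<kappa>)" (is "finite ?A")
    by (simp add: finite_strips finite_interlacing)
  have fin': "finite (\<Union>\<rho>\<in>interlacing n \<mu>. strips k n \<rho>)" (is "finite ?B")
    by (simp add: finite_strips finite_interlacing)
  have AB: "\<nu> \<in> Par n" if "\<nu> \<in> ?A \<union> ?B" for \<nu>
    using that strips_Par[OF \<mu>] interlacing_Par strips_Par interlacing_Par[OF \<mu>] by blast
  have core: "(\<Sum>\<kappa>\<in>{\<kappa> \<in> strips k (Suc n) \<mu>. \<nu> \<in> interlacing n \<kappa>}. ?w (Suc k) \<kappa> \<nu>) =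
      (\<Sum>\<rho>\<in>{\<rho> \<in> interlacing n \<mu>. \<nu> \<in> strips k n \<rho>}. ?w k \<mu> \<rho>)" if "\<nu> \<in> Par n" for \<nu>
    using strip_interlacing_exchange[OF _ \<mu> that, of ?X k]
    by (simp flip: coeff_sum)
  have "(\<Sum>\<kappa>\<in>strips k (Suc n) \<mu>. groth (Suc k) (Suc n) \<kappa> \<gamma>) =
      (\<Sum>\<kappa>\<in>strips k (Suc n) \<mu>. \<Sum>\<nu>\<in>{\<nu> \<in> ?A \<union> ?B. \<nu> \<in> interlacing n \<kappa>}. groth (Suc k) n \<nu> \<gamma> * ?w (Suc k) \<kappa> \<nu>)"
    by (auto intro!: sum.cong)
  also have "\<dots> = (\<Sum>\<nu>\<in>?A \<union> ?B. \<Sum>\<kappa>\<in>{\<kappa> \<in> strips k (Suc n) \<mu>. \<nu> \<in> interlacing n \<kappa>}.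
      groth (Suc k) n \<nu> \<gamma> * ?w (Suc k) \<kappa> \<nu>)"
    by (rule sum.swap_restrict) (use fin fin' finite_strips in auto)
  also have "\<dots> = (\<Sum>\<nu>\<in>?A \<union> ?B. \<Sum>\<rho>\<in>{\<rho> \<in> interlacing n \<mu>. \<nu> \<in> strips k n \<rho>}.
      groth (Suc k) n \<nu> \<gamma> * ?w k \<mu> \<rho>)"
    unfolding sum_distrib_left[symmetric] using core AB by (intro sum.cong refl) simp
  also have "\<dots> = (\<Sum>\<rho>\<in>interlacing n \<mu>. \<Sum>\<nu>\<in>{\<nu> \<in> ?A \<union> ?B. \<nu> \<in> strips k n \<rho>}.
      groth (Suc k) n \<nu> \<gamma> * ?w k \<mu> \<rho>)"
    by (rule sum.swap_restrict) (use fin fin' finite_interlacing in auto)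
  also have "\<dots> = (\<Sum>\<rho>\<in>interlacing n \<mu>. (\<Sum>\<nu>\<in>strips k n \<rho>. groth (Suc k) n \<nu> \<gamma>) * ?w k \<mu> \<rho>)"
    unfolding sum_distrib_right by (rule sum.cong[OF refl], rule sum.cong) auto
  also have "\<dots> = groth k (Suc n) \<mu> \<gamma>"
    using Suc.IH interlacing_Par[OF \<mu>] by simp
  finally show ?case by simp
qed

section \<open>Symmetry of the Kostka numbers\<close>

text \<open>
  The case \<open>k = 0\<close> of \<open>groth\<close>, that is, the number of semistandard tableaux of shape \<open>p\<close> and content \<open>\<gamma>\<close>.
  The content is an integer vector because alternating sums also evaluate it at vectors with negative
  entries, where it is zero.
\<close>

fun kostka :: "nat \<Rightarrow> (nat \<Rightarrow> nat) \<Rightarrow> (nat \<Rightarrow> int) \<Rightarrow> int poly" where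
  "kostka 0 p \<gamma> = 1"
| "kostka (Suc n) p \<gamma> =
     (\<Sum>\<nu>\<in>interlacing n p. if int (sum p {..n}) - int (sum \<nu> {..<n}) = \<gamma> n then kostka n \<nu> \<gamma> else 0)"

lemma groth_0_eq_kostka: "groth 0 n p \<gamma> = kostka n p (\<lambda>i. int (\<gamma> i))"
proof (induction n arbitrary: p)
  case (Suc n)
  have "coeff (branching_weight [:0, 1:] 0 n p \<nu>) (\<gamma> n) =
      (if int (sum p {..n}) - int (sum \<nu> {..<n}) = int (\<gamma> n) then 1 else (0 :: int poly))"
    if "\<nu> \<in> interlacing n p" for \<nu>
  proof -
    have "branching_weight [:0, 1:] 0 n p \<nu> = monom (1 :: int poly) (sum p {..n} - sum \<nu> {..<n})"
      by (simp add: branching_weight_def monom_altdef)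
    then show ?thesis using interlacing_size[OF that] by (auto simp del: of_nat_sum)
  qed
  then show ?case using Suc by (auto intro!: sum.cong simp del: of_nat_sum)
qed simp

lemma kostka_cong: "(\<And>i. i < n \<Longrightarrow> \<gamma> i = \<gamma>' i) \<Longrightarrow> kostka n p \<gamma> = kostka n p \<gamma>'"
proof (induction n arbitrary: p)
  case (Suc n)
  then have "kostka n \<nu> \<gamma> = kostka n \<nu> \<gamma>'" for \<nu> by simp
  then show ?case using Suc.prems by (simp cong: if_cong)
qed simp

lemma kostka_negative: "i < n \<Longrightarrow> \<gamma> i < 0 \<Longrightarrow> kostka n p \<gamma> = 0"
proof (induction n arbitrary: p)
  case (Suc n)
  show ?case
  proof (cases "i = n")
    case True
    have "int (sum p {..n}) - int (sum \<nu> {..<n}) \<noteq> \<gamma> n" if "\<nu> \<in> interlacing n p" for \<nu>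
      using interlacing_size[OF that] Suc.prems True by (simp del: of_nat_sum)
    then show ?thesis by (auto intro!: sum.neutral)
  next
    case False
    then show ?thesis using Suc by (auto intro!: sum.neutral)
  qed
qed simp

lemma sum_involution_zero:
  fixes f :: "'b \<Rightarrow> int poly"
  assumes "\<And>x. x \<in> S \<Longrightarrow> h x \<in> S" "\<And>x. x \<in> S \<Longrightarrow> h (h x) = x" "\<And>x. x \<in> S \<Longrightarrow> f (h x) = - f x"
  shows "sum f S = 0"
proof -
  have "sum f S = sum (\<lambda>x. - f x) S"
    by (rule sum.reindex_bij_witness[where i = h and j = h]) (use assms in auto)
  then show ?thesis by (simp add: sum_negf)
qed

lemma sum_remove_two:
  fixes h :: "'b \<Rightarrow> 'c::comm_monoid_add"
  assumes "finite A" "i \<in> A" "j \<in> A" "i \<noteq> j"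
  shows "sum h A = h i + h j + sum h (A - {i, j})"
proof -
  have "sum h A = h i + sum h (A - {i})" using assms by (simp add: sum.remove)
  also have "sum h (A - {i}) = h j + sum h (A - {i} - {j})" using assms by (intro sum.remove) auto
  also have "A - {i} - {j} = A - {i, j}" by auto
  finally show ?thesis by (simp add: add.assoc)
qed

text \<open>
  The involution of Bender and Knuth. Between fixed shapes \<open>p\<close> and \<open>\<kappa>\<close>, the rows of \<open>\<nu>\<close> range independently
  over intervals, and reflecting all of them exchanges the two differences of sizes.
\<close>

lemma interlacing_two_step_count:
  "card {\<nu> \<in> interlacing (Suc m) p. \<kappa> \<in> interlacing m \<nu> \<and>
      int (sum p {..Suc m}) - int (sum \<nu> {..m}) = a \<and> int (sum \<nu> {..m}) - int (sum \<kappa> {..<m}) = b} =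
   card {\<nu> \<in> interlacing (Suc m) p. \<kappa> \<in> interlacing m \<nu> \<and>
      int (sum p {..Suc m}) - int (sum \<nu> {..m}) = b \<and> int (sum \<nu> {..m}) - int (sum \<kappa> {..<m}) = a}"
  (is "card (?S a b) = card (?S b a)")
proof (cases "\<forall>i\<ge>m. \<kappa> i = 0")
  case \<kappa>: True
  define lo where "lo i = max (p (Suc i)) (\<kappa> i)" for i
  define hi where "hi i = (if i = 0 then p 0 else min (p i) (\<kappa> (i - 1)))" for i
  define refl where "refl \<nu> i = (if i \<le> m then lo i + hi i - \<nu> i else 0)" for \<nu> :: "nat \<Rightarrow> nat" and i
  have mem: "\<nu> \<in> interlacing (Suc m) p \<and> \<kappa> \<in> interlacing m \<nu> \<longleftrightarrow>
      (\<forall>i\<le>m. lo i \<le> \<nu> i \<and> \<nu> i \<le> hi i) \<and> (\<forall>i>m. \<nu> i = 0)" for \<nu>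
  proof (intro iffI conjI allI impI)
    fix i assume *: "\<nu> \<in> interlacing (Suc m) p \<and> \<kappa> \<in> interlacing m \<nu>" "i \<le> m"
    then show "lo i \<le> \<nu> i" using \<kappa> by (cases "i = m") (auto simp: interlacing_def lo_def)
    show "\<nu> i \<le> hi i" using * by (cases i) (auto simp: interlacing_def hi_def)
  next
    fix i assume *: "\<nu> \<in> interlacing (Suc m) p \<and> \<kappa> \<in> interlacing m \<nu>" "m < i"
    then show "\<nu> i = 0" by (auto simp: interlacing_def)
  next
    assume *: "(\<forall>i\<le>m. lo i \<le> \<nu> i \<and> \<nu> i \<le> hi i) \<and> (\<forall>i>m. \<nu> i = 0)"
    then have h: "lo i \<le> \<nu> i \<and> \<nu> i \<le> hi i" if "i \<le> m" for i using that by blast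
    have "p (Suc i) \<le> \<nu> i \<and> \<nu> i \<le> p i" if "i \<le> m" for i
      using h[OF that] by (auto simp: lo_def hi_def split: if_splits)
    then show "\<nu> \<in> interlacing (Suc m) p" using * by (auto simp: interlacing_def less_Suc_eq_le)
    have "\<nu> (Suc i) \<le> \<kappa> i \<and> \<kappa> i \<le> \<nu> i" if "i < m" for i
      using h[of i] h[of "Suc i"] that by (auto simp: lo_def hi_def split: if_splits)
    then show "\<kappa> \<in> interlacing m \<nu>" using \<kappa> by (auto simp: interlacing_def)
  qed
  have total: "(\<Sum>i\<le>m. lo i + hi i) = sum p {..Suc m} + sum \<kappa> {..<m}"
  proof -
    have "(\<Sum>i\<le>m. lo i) = (\<Sum>i<m. lo i) + p (Suc m)"
      using \<kappa> by (simp add: lessThan_Suc_atMost[symmetric] lo_def)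
    moreover have "(\<Sum>i\<le>m. hi i) = p 0 + (\<Sum>i<m. hi (Suc i))"
      by (simp add: lessThan_Suc_atMost[symmetric] sum.lessThan_Suc_shift hi_def del: sum.lessThan_Suc)
    moreover have "(\<Sum>i<m. lo i) + (\<Sum>i<m. hi (Suc i)) = (\<Sum>i<m. p (Suc i)) + (\<Sum>i<m. \<kappa> i)"
      unfolding sum.distrib[symmetric] by (intro sum.cong) (auto simp: lo_def hi_def)
    moreover have "sum p {..Suc m} = p 0 + (\<Sum>i<m. p (Suc i)) + p (Suc m)"
      unfolding sum.atMost_Suc_shift by (simp add: lessThan_Suc_atMost[symmetric])
    ultimately show ?thesis by (simp add: sum.distrib)
  qed
  have refl_sum: "sum (refl \<nu>) {..m} + sum \<nu> {..m} = sum p {..Suc m} + sum \<kappa> {..<m}"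
    if "\<forall>i\<le>m. lo i \<le> \<nu> i \<and> \<nu> i \<le> hi i" for \<nu>
    unfolding total[symmetric] sum.distrib[symmetric]
    using that by (intro sum.cong) (auto simp: refl_def trans_le_add2)
  have sub: "refl \<nu> \<in> ?S b a \<and> refl (refl \<nu>) = \<nu>" if "\<nu> \<in> ?S a b" for a b \<nu>
  proof -
    from that have \<nu>: "\<forall>i\<le>m. lo i \<le> \<nu> i \<and> \<nu> i \<le> hi i" "\<forall>i>m. \<nu> i = 0" using mem by blast+
    have "refl (refl \<nu>) = \<nu>" using \<nu> by (auto simp: fun_eq_iff refl_def not_le trans_le_add2)
    moreover have "(\<forall>i\<le>m. lo i \<le> refl \<nu> i \<and> refl \<nu> i \<le> hi i) \<and> (\<forall>i>m. refl \<nu> i = 0)"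
    proof (intro conjI allI impI)
      fix i assume "i \<le> m"
      then have "lo i \<le> \<nu> i" "\<nu> i \<le> hi i" using \<nu> by auto
      then show "lo i \<le> refl \<nu> i" "refl \<nu> i \<le> hi i" using \<open>i \<le> m\<close> by (auto simp: refl_def)
    qed (simp add: refl_def)
    then have "refl \<nu> \<in> interlacing (Suc m) p \<and> \<kappa> \<in> interlacing m (refl \<nu>)" using mem by blast
    ultimately show ?thesis using that refl_sum[OF \<nu>(1)] by (auto simp del: of_nat_sum)
  qed
  have "bij_betw refl (?S a b) (?S b a)"
    by (rule bij_betw_byWitness[where f' = refl]) (use sub in blast)+
  then show ?thesis by (rule bij_betw_same_card)
next
  case False
  then have "\<kappa> \<notin> interlacing m \<nu>" for \<nu> by (auto simp: interlacing_def)
  then show ?thesis by simp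
qed

lemma kostka_two_step:
  "kostka (Suc (Suc m)) p \<gamma> = (\<Sum>\<kappa>\<in>(\<Union>\<nu>\<in>interlacing (Suc m) p. interlacing m \<nu>).
     of_nat (card {\<nu> \<in> interlacing (Suc m) p. \<kappa> \<in> interlacing m \<nu> \<and>
       int (sum p {..Suc m}) - int (sum \<nu> {..m}) = \<gamma> (Suc m) \<and>
       int (sum \<nu> {..m}) - int (sum \<kappa> {..<m}) = \<gamma> m}) * kostka m \<kappa> \<gamma>)"
proof -
  let ?U = "\<Union>\<nu>\<in>interlacing (Suc m) p. interlacing m \<nu>"
  let ?c = "\<lambda>\<nu> \<kappa>. int (sum p {..Suc m}) - int (sum \<nu> {..m}) = \<gamma> (Suc m) \<and>
       int (sum \<nu> {..m}) - int (sum \<kappa> {..<m}) = \<gamma> m"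
  have "kostka (Suc (Suc m)) p \<gamma> = (\<Sum>\<nu>\<in>interlacing (Suc m) p. \<Sum>\<kappa>\<in>{\<kappa> \<in> ?U. \<kappa> \<in> interlacing m \<nu>}.
      if ?c \<nu> \<kappa> then kostka m \<kappa> \<gamma> else 0)"
    unfolding kostka.simps lessThan_Suc_atMost
    by (intro sum.cong refl) (auto intro!: sum.cong)
  also have "\<dots> = (\<Sum>\<kappa>\<in>?U. \<Sum>\<nu>\<in>{\<nu> \<in> interlacing (Suc m) p. \<kappa> \<in> interlacing m \<nu>}.
      if ?c \<nu> \<kappa> then kostka m \<kappa> \<gamma> else 0)"
    by (rule sum.swap_restrict) (auto simp: finite_interlacing)
  also have "\<dots> = (\<Sum>\<kappa>\<in>?U. of_nat (card {\<nu> \<in> interlacing (Suc m) p. \<kappa> \<in> interlacing m \<nu> \<and> ?c \<nu> \<kappa>}) *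
      kostka m \<kappa> \<gamma>)"
  proof (intro sum.cong refl)
    fix \<kappa>
    have "{\<nu> \<in> interlacing (Suc m) p. \<kappa> \<in> interlacing m \<nu>} \<inter> {\<nu>. ?c \<nu> \<kappa>} =
        {\<nu> \<in> interlacing (Suc m) p. \<kappa> \<in> interlacing m \<nu> \<and> ?c \<nu> \<kappa>}" by auto
    then show "(\<Sum>\<nu>\<in>{\<nu> \<in> interlacing (Suc m) p. \<kappa> \<in> interlacing m \<nu>}. if ?c \<nu> \<kappa> then kostka m \<kappa> \<gamma> else 0) =
        of_nat (card {\<nu> \<in> interlacing (Suc m) p. \<kappa> \<in> interlacing m \<nu> \<and> ?c \<nu> \<kappa>}) * kostka m \<kappa> \<gamma>"
      by (simp add: sum.If_cases finite_interlacing)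
  qed
  finally show ?thesis .
qed

lemma kostka_symmetric:
  assumes "Suc i < n"
  shows "kostka n p (\<gamma> \<circ> transpose i (Suc i)) = kostka n p \<gamma>"
  using assms
proof (induction n arbitrary: p)
  case (Suc n)
  show ?case
  proof (cases "Suc i = n")
    case False
    then show ?thesis using Suc by (simp add: transpose_apply_other cong: if_cong)
  next
    case True
    then obtain n': "n = Suc i" by simp
    have "kostka i \<kappa> (\<gamma> \<circ> transpose i (Suc i)) = kostka i \<kappa> \<gamma>" for \<kappa>
      by (rule kostka_cong) (simp add: transpose_apply_other)
    then show ?thesis unfolding n' kostka_two_step
      using interlacing_two_step_count[of i p _ "\<gamma> i" "\<gamma> (Suc i)"] by simp
  qed
qed simp

section \<open>Alternating sums of Kostka numbers\<close>

text \<open>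
  For symmetric \<open>c\<close> and \<open>l = \<mu> + \<delta>\<close> with \<open>\<delta> i = n - 1 - i\<close>, this is the coefficient of the monomial \<open>l\<close> in
  the product of \<open>c\<close> and the Vandermonde determinant.
\<close>

definition alternation :: "nat \<Rightarrow> ((nat \<Rightarrow> int) \<Rightarrow> int poly) \<Rightarrow> (nat \<Rightarrow> int) \<Rightarrow> int poly" where
  "alternation n c l =
     (\<Sum>\<sigma> | \<sigma> permutes {..<n}. of_int (sign \<sigma>) * c (\<lambda>i. l (\<sigma> i) - (int n - 1 - int i)))"

lemma sign_compose_transpose:
  fixes \<sigma> :: "nat \<Rightarrow> nat"
  assumes "\<sigma> permutes {..<n}" "i \<noteq> j"
  shows "sign (\<sigma> \<circ> transpose i j) = - sign \<sigma>"
  using assms permutes_imp_permutation[OF finite_lessThan assms(1)]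
  by (simp add: sign_compose permutation_swap_id sign_swap_id)

lemma permutes_compose_transpose:
  fixes \<sigma> :: "nat \<Rightarrow> nat"
  assumes "\<sigma> permutes {..<n}" "i < n" "j < n"
  shows "\<sigma> \<circ> transpose i j permutes {..<n}"
  using assms by (intro permutes_compose permutes_swap_id) auto

text \<open>
  Put \<open>r i = \<rho> i + (n - i)\<close>. The shape \<open>\<nu>\<close> interlaces with \<open>\<rho>\<close> exactly if the vector \<open>a = l \<circ> \<sigma>\<close> satisfies
  \<open>r (i + 1) < a i \<le> r i\<close> for all \<open>i < n\<close>, and equality of the sums bounds the last entry by
  \<open>r n \<le> a n \<le> r 0\<close>. If \<open>a n > r n\<close>, then \<open>a n\<close> lies in one of these disjoint intervals, and exchanging it with
  the entry that already lives there is a sign-reversing involution. The remaining case \<open>a n = r n\<close> forces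
  \<open>a = r\<close>.
\<close>

lemma alternating_sum_interlacing:
  fixes \<rho> :: "nat \<Rightarrow> nat" and l :: "nat \<Rightarrow> int"
  assumes "\<rho> \<in> Par (Suc n)"
  shows "(\<Sum>\<sigma> | \<sigma> permutes {..<Suc n}. of_int (sign \<sigma>) * (\<Sum>\<nu>\<in>interlacing n \<rho>.
            if int (sum \<rho> {..n}) - int (sum \<nu> {..<n}) = l (\<sigma> n) \<and>
               (\<forall>i<n. l (\<sigma> i) = int (\<nu> i) + (int n - int i)) then 1 else (0 :: int poly))) =
         (\<Sum>\<sigma> | \<sigma> permutes {..<Suc n}. of_int (sign \<sigma>) *
            (if \<forall>i<Suc n. l (\<sigma> i) = int (\<rho> i) + (int n - int i) then 1 else 0))"
proof -
  define r where "r i = int (\<rho> i) + (int n - int i)" for i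
  have r_less: "r j < r i" if "i < j" for i j
    using Par_mono[OF assms, of i j] that by (auto simp: r_def)
  define good where "good \<sigma> \<longleftrightarrow> (\<forall>i<n. r (Suc i) < l (\<sigma> i) \<and> l (\<sigma> i) \<le> r i) \<and>
      (\<Sum>i\<le>n. l (\<sigma> i)) = (\<Sum>i\<le>n. r i)" for \<sigma> :: "nat \<Rightarrow> nat"
  define exact where "exact \<sigma> \<longleftrightarrow> (\<forall>i<Suc n. l (\<sigma> i) = r i)" for \<sigma> :: "nat \<Rightarrow> nat"
  have ind: "(\<Sum>\<nu>\<in>interlacing n \<rho>.
            if int (sum \<rho> {..n}) - int (sum \<nu> {..<n}) = l (\<sigma> n) \<and>
               (\<forall>i<n. l (\<sigma> i) = int (\<nu> i) + (int n - int i)) then 1 else (0 :: int poly)) =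
      (if good \<sigma> then 1 else 0)" (is "(\<Sum>\<nu>\<in>_. if ?c \<nu> then 1 else 0) = _") for \<sigma>
  proof -
    define \<nu>0 where "\<nu>0 i = (if i < n then nat (l (\<sigma> i) - (int n - int i)) else 0)" for i
    have sums: "(\<Sum>i\<le>n. l (\<sigma> i)) - (\<Sum>i\<le>n. r i) =
        int (sum \<nu> {..<n}) + l (\<sigma> n) - int (sum \<rho> {..n})"
      if "\<forall>i<n. l (\<sigma> i) = int (\<nu> i) + (int n - int i)" for \<nu>
    proof -
      have "(\<Sum>i<n. l (\<sigma> i)) = (\<Sum>i<n. int (\<nu> i) + (int n - int i))" using that by simp
      then show ?thesis unfolding lessThan_Suc_atMost[symmetric] r_def by (simp add: sum.distrib)
    qed
    have uniq: "\<nu> = \<nu>0" if "\<nu> \<in> interlacing n \<rho>" "?c \<nu>" for \<nu>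
      using that by (auto simp: fun_eq_iff \<nu>0_def interlacing_def)
    have A: "good \<sigma>" if "\<nu> \<in> interlacing n \<rho>" "?c \<nu>" for \<nu>
    proof -
      have "r (Suc i) < l (\<sigma> i) \<and> l (\<sigma> i) \<le> r i" if "i < n" for i
        using \<open>\<nu> \<in> interlacing n \<rho>\<close> \<open>?c \<nu>\<close> that by (auto simp: r_def interlacing_def)
      then show ?thesis unfolding good_def using sums[of \<nu>] \<open>?c \<nu>\<close> by auto
    qed
    have B: "\<nu>0 \<in> interlacing n \<rho> \<and> ?c \<nu>0" if g: "good \<sigma>"
    proof -
      have b: "int (\<rho> (Suc i)) \<le> l (\<sigma> i) - (int n - int i) \<and> l (\<sigma> i) - (int n - int i) \<le> int (\<rho> i)"
        if "i < n" for i
      proof -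
        have "r (Suc i) < l (\<sigma> i) \<and> l (\<sigma> i) \<le> r i" using g that by (auto simp: good_def)
        then show ?thesis by (auto simp: r_def)
      qed
      have eq: "\<forall>i<n. l (\<sigma> i) = int (\<nu>0 i) + (int n - int i)"
      proof (intro allI impI)
        fix i assume "i < n"
        then show "l (\<sigma> i) = int (\<nu>0 i) + (int n - int i)" using b[of i] by (simp add: \<nu>0_def)
      qed
      have "\<nu>0 \<in> interlacing n \<rho>"
        unfolding interlacing_def
      proof (intro CollectI conjI allI impI)
        fix i assume "i < n"
        then show "\<rho> (Suc i) \<le> \<nu>0 i" "\<nu>0 i \<le> \<rho> i" using b[of i] by (auto simp: \<nu>0_def)
      qed (simp add: \<nu>0_def)
      then show ?thesis using eq sums[OF eq] g by (auto simp: good_def)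
    qed
    have "{\<nu> \<in> interlacing n \<rho>. ?c \<nu>} = (if good \<sigma> then {\<nu>0} else {})"
    proof (cases "good \<sigma>")
      case True
      have "{\<nu> \<in> interlacing n \<rho>. ?c \<nu>} = {\<nu>0}" using uniq B[OF True] by blast
      then show ?thesis using True by (simp only: if_True)
    next
      case False
      then have "{\<nu> \<in> interlacing n \<rho>. ?c \<nu>} = {}" using A by blast
      then show ?thesis using False by (simp only: if_False)
    qed
    moreover have "(\<Sum>\<nu>\<in>interlacing n \<rho>. if ?c \<nu> then 1 else (0 :: int poly)) =
        (\<Sum>\<nu>\<in>{\<nu> \<in> interlacing n \<rho>. ?c \<nu>}. 1)"
      by (rule sum.inter_filter[symmetric]) (rule finite_interlacing)
    ultimately show ?thesis by (simp del: of_nat_sum)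
  qed
  \<comment> \<open>The index of the interval that contains \<open>x\<close>.\<close>
  define J where "J x = (LEAST j. r (Suc j) < x)" for x
  have J: "J x = j" if "r (Suc j) < x" "x \<le> r j" for x j
    unfolding J_def
  proof (rule Least_equality)
    show "r (Suc j) < x" by (rule that(1))
  next
    fix y assume "r (Suc y) < x"
    show "j \<le> y"
    proof (rule ccontr)
      assume "\<not> j \<le> y"
      then have "r j \<le> r (Suc y)" using r_less[of "Suc y" j] by (cases "Suc y = j") auto
      then show False using that(2) \<open>r (Suc y) < x\<close> by simp
    qed
  qed
  have last: "\<exists>j<n. r (Suc j) < l (\<sigma> n) \<and> l (\<sigma> n) \<le> r j" if "good \<sigma>" "\<not> exact \<sigma>" for \<sigma>
  proof -
    have g: "r (Suc i) < l (\<sigma> i)" "l (\<sigma> i) \<le> r i" if "i < n" for i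
      using \<open>good \<sigma>\<close> that by (auto simp: good_def)
    have tot: "(\<Sum>i<n. l (\<sigma> i)) + l (\<sigma> n) = (\<Sum>i<n. r i) + r n"
      using \<open>good \<sigma>\<close> by (simp add: good_def lessThan_Suc_atMost[symmetric])
    have gt: "r n < l (\<sigma> n)"
    proof (rule ccontr)
      assume "\<not> r n < l (\<sigma> n)"
      then have "(\<Sum>i<n. r i) \<le> (\<Sum>i<n. l (\<sigma> i))" using tot by linarith
      moreover have "(\<Sum>i<n. l (\<sigma> i)) \<le> (\<Sum>i<n. r i)" using g by (intro sum_mono) auto
      ultimately have e: "(\<Sum>i<n. r i - l (\<sigma> i)) = 0" by (simp add: sum_subtractf)
      have "\<forall>i\<in>{..<n}. r i - l (\<sigma> i) = 0"
        using e g by (subst (asm) sum_nonneg_eq_0_iff) auto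
      moreover from e have "l (\<sigma> n) = r n" using tot by (simp add: sum_subtractf)
      ultimately have "exact \<sigma>" by (auto simp: exact_def less_Suc_eq)
      then show False using that by simp
    qed
    have "(\<Sum>i<n. r (Suc i)) \<le> (\<Sum>i<n. l (\<sigma> i))" using g by (intro sum_mono) (auto intro: less_imp_le)
    moreover have "(\<Sum>i<n. r i) + r n = r 0 + (\<Sum>i<n. r (Suc i))"
      using sum.lessThan_Suc_shift[of r n] by simp
    ultimately have le: "l (\<sigma> n) \<le> r 0" using tot by linarith
    let ?j = "LEAST j. r (Suc j) < l (\<sigma> n)"
    have "n \<noteq> 0" using gt le by (cases n) auto
    then have n1: "r (Suc (n - 1)) < l (\<sigma> n)" using gt by simp
    then have "?j \<le> n - 1" by (rule Least_le)
    then have "?j < n" using \<open>n \<noteq> 0\<close> by simp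
    moreover have "r (Suc ?j) < l (\<sigma> n)" using n1 by (rule LeastI)
    moreover have "l (\<sigma> n) \<le> r ?j"
    proof (cases ?j)
      case 0
      then show ?thesis using le by simp
    next
      case (Suc k)
      then have "\<not> r (Suc k) < l (\<sigma> n)" using not_less_Least[of k "\<lambda>j. r (Suc j) < l (\<sigma> n)"] by simp
      then show ?thesis using Suc by simp
    qed
    ultimately show ?thesis by blast
  qed
  have exact_good: "good \<sigma>" if "exact \<sigma>" for \<sigma>
    using that r_less by (auto simp: exact_def good_def)
  let ?f = "\<lambda>\<sigma>. of_int (sign \<sigma>) :: int poly"
  let ?P = "{\<sigma>. \<sigma> permutes {..<Suc n}}"
  have fin: "finite ?P" by (simp add: finite_permutations)
  define h where "h \<sigma> = \<sigma> \<circ> transpose (J (l (\<sigma> n))) n" for \<sigma>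
  have step: "h \<sigma> \<in> ?P \<and> good (h \<sigma>) \<and> \<not> exact (h \<sigma>) \<and> h (h \<sigma>) = \<sigma> \<and> sign (h \<sigma>) = - sign \<sigma>"
    if asm: "\<sigma> \<in> ?P" "good \<sigma>" "\<not> exact \<sigma>" for \<sigma>
  proof -
    obtain j where j: "j < n" "r (Suc j) < l (\<sigma> n)" "l (\<sigma> n) \<le> r j" using last[OF asm(2,3)] by blast
    have h: "h \<sigma> = \<sigma> \<circ> transpose j n" using J[OF j(2,3)] by (simp add: h_def)
    have gj: "r (Suc j) < l (\<sigma> j)" "l (\<sigma> j) \<le> r j" using asm(2) j by (auto simp: good_def)
    have hn: "h \<sigma> n = \<sigma> j" by (simp add: h)
    have hj: "h \<sigma> j = \<sigma> n" by (simp add: h)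
    have ho: "h \<sigma> i = \<sigma> i" if "i \<noteq> j" "i \<noteq> n" for i using that by (simp add: h transpose_apply_other)
    have per: "h \<sigma> \<in> ?P" using asm(1) j by (simp add: h permutes_compose_transpose)
    have "(\<Sum>i\<le>n. l (h \<sigma> i)) = (\<Sum>i\<le>n. l (\<sigma> i))"
      using sum_remove_two[of "{..n}" j n "\<lambda>i. l (h \<sigma> i)"] sum_remove_two[of "{..n}" j n "\<lambda>i. l (\<sigma> i)"]
        j(1) hn hj ho by simp
    moreover have "r (Suc i) < l (h \<sigma> i) \<and> l (h \<sigma> i) \<le> r i" if "i < n" for i
      using j hj ho[of i] \<open>good \<sigma>\<close> that by (cases "i = j") (auto simp: good_def)
    ultimately have good: "good (h \<sigma>)" using asm(2) by (simp add: good_def)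
    have "r n \<le> r (Suc j)" using r_less[of "Suc j" n] j by (cases "Suc j = n") auto
    then have "l (h \<sigma> n) \<noteq> r n" using gj hn by simp
    then have "\<not> exact (h \<sigma>)" by (auto simp: exact_def)
    moreover have "h (h \<sigma>) = \<sigma>"
      using J[OF gj] hn by (simp add: h_def[of "h \<sigma>"]) (simp add: h comp_assoc)
    moreover have "sign (h \<sigma>) = - sign \<sigma>"
      unfolding h using asm(1) j by (intro sign_compose_transpose[of _ "Suc n"]) auto
    ultimately show ?thesis using per good by blast
  qed
  have "sum ?f {\<sigma> \<in> ?P. good \<sigma> \<and> \<not> exact \<sigma>} = 0"
    by (rule sum_involution_zero[where h = h]) (use step in auto)
  moreover have "sum ?f {\<sigma> \<in> ?P. good \<sigma>} =
      sum ?f {\<sigma> \<in> ?P. exact \<sigma>} + sum ?f {\<sigma> \<in> ?P. good \<sigma> \<and> \<not> exact \<sigma>}"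
  proof -
    have "{\<sigma> \<in> ?P. good \<sigma>} = {\<sigma> \<in> ?P. exact \<sigma>} \<union> {\<sigma> \<in> ?P. good \<sigma> \<and> \<not> exact \<sigma>}"
      using exact_good by blast
    then show ?thesis using fin by (simp only:) (rule sum.union_disjoint, auto)
  qed
  moreover have "(\<Sum>\<sigma>\<in>?P. ?f \<sigma> * (if Q \<sigma> then 1 else 0)) = sum ?f {\<sigma> \<in> ?P. Q \<sigma>}" for Q
  proof -
    have "(\<Sum>\<sigma>\<in>?P. ?f \<sigma> * (if Q \<sigma> then 1 else 0)) = (\<Sum>\<sigma>\<in>?P. if Q \<sigma> then ?f \<sigma> else 0)"
      by (intro sum.cong) auto
    also have "\<dots> = sum ?f {\<sigma> \<in> ?P. Q \<sigma>}" by (rule sum.inter_filter[OF fin, symmetric])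
    finally show ?thesis .
  qed
  ultimately show ?thesis unfolding ind exact_def[symmetric] r_def[symmetric] by simp
qed

text \<open>
  The last entry of the content determines the size of the smaller shape in the branching recursion, so the
  permutations are grouped by their value at \<open>n\<close>, and the induction hypothesis applies to the others.
\<close>

lemma alternation_kostka:
  assumes "\<rho> \<in> Par n"
  shows "alternation n (kostka n \<rho>) l = (\<Sum>\<sigma> | \<sigma> permutes {..<n}. of_int (sign \<sigma>) *
    (if \<forall>i<n. l (\<sigma> i) = int (\<rho> i) + (int n - 1 - int i) then 1 else 0))"
  using assms
proof (induction n arbitrary: \<rho> l)
  case 0
  then show ?case by (simp add: alternation_def)
next
  case (Suc n)
  have ins: "{..<Suc n} = insert n {..<n}" by auto
  let ?t = "\<lambda>b. transpose n b"
  let ?s = "\<lambda>\<sigma>. of_int (sign \<sigma>) :: int poly"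
  have split: "(\<Sum>\<sigma> | \<sigma> permutes {..<Suc n}. ?s \<sigma> * F \<sigma>) =
      (\<Sum>b\<in>insert n {..<n}. ?s (?t b) * (\<Sum>q | q permutes {..<n}. ?s q * F (?t b \<circ> q)))" for F
  proof -
    have "sign (?t b \<circ> q) = sign (?t b) * sign q" if "q permutes {..<n}" for b q
      using permutes_imp_permutation[OF finite_lessThan that] by (simp add: sign_compose permutation_swap_id)
    then show ?thesis unfolding ins
      by (subst sum_over_permutations_insert) (auto simp: sum_distrib_left mult.assoc intro!: sum.cong)
  qed
  have qn: "q n = n" if "q permutes {..<n}" for q using that by (simp add: permutes_def)
  let ?d = "\<lambda>b \<nu>. int (sum \<rho> {..n}) - int (sum \<nu> {..<n}) = l b"
  have "alternation (Suc n) (kostka (Suc n) \<rho>) l =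
      (\<Sum>b\<in>insert n {..<n}. ?s (?t b) * (\<Sum>q | q permutes {..<n}. ?s q *
         (\<Sum>\<nu>\<in>interlacing n \<rho>. if ?d b \<nu> then
            kostka n \<nu> (\<lambda>i. l (?t b (q i)) - 1 - (int n - 1 - int i)) else 0)))"
    unfolding alternation_def split
  proof (rule sum.cong[OF refl], rule arg_cong[where f = "\<lambda>x. _ * x"], rule sum.cong[OF refl], goal_cases)
    case (1 b q)
    then have "q n = n" using qn by simp
    moreover have "kostka n \<nu> (\<lambda>i. l (?t b (q i)) - (int (Suc n) - 1 - int i)) =
        kostka n \<nu> (\<lambda>i. l (?t b (q i)) - 1 - (int n - 1 - int i))" for \<nu>
      by (rule kostka_cong) simp
    ultimately show ?case by (simp add: comp_def cong: if_cong)
  qed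
  also have "\<dots> = (\<Sum>b\<in>insert n {..<n}. ?s (?t b) * (\<Sum>\<nu>\<in>interlacing n \<rho>.
      if ?d b \<nu> then alternation n (kostka n \<nu>) (\<lambda>i. l (?t b i) - 1) else 0))"
  proof (rule sum.cong[OF refl], rule arg_cong[where f = "\<lambda>x. _ * x"], goal_cases)
    case (1 b)
    show ?case unfolding alternation_def sum_distrib_left
      by (subst sum.swap) (auto intro!: sum.cong)
  qed
  also have "\<dots> = (\<Sum>b\<in>insert n {..<n}. ?s (?t b) * (\<Sum>\<nu>\<in>interlacing n \<rho>.
      if ?d b \<nu> then (\<Sum>q | q permutes {..<n}. ?s q *
        (if \<forall>i<n. l (?t b (q i)) - 1 = int (\<nu> i) + (int n - 1 - int i) then 1 else 0)) else 0))"
    using Suc.IH interlacing_Par[OF Suc.prems] by (simp cong: if_cong)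
  also have "\<dots> = (\<Sum>b\<in>insert n {..<n}. ?s (?t b) * (\<Sum>q | q permutes {..<n}. ?s q *
      (\<Sum>\<nu>\<in>interlacing n \<rho>. if ?d ((?t b \<circ> q) n) \<nu> \<and>
         (\<forall>i<n. l ((?t b \<circ> q) i) = int (\<nu> i) + (int n - int i)) then 1 else 0)))"
  proof (rule sum.cong[OF refl], rule arg_cong[where f = "\<lambda>x. _ * x"], goal_cases)
    case (1 b)
    have e: "x - 1 = y + (int n - 1 - z) \<longleftrightarrow> x = y + (int n - z)" for x y z by auto
    show ?case unfolding sum_distrib_left e
      by (subst sum.swap) (auto intro!: sum.cong simp: qn)
  qed
  also have "\<dots> = (\<Sum>\<sigma> | \<sigma> permutes {..<Suc n}. ?s \<sigma> * (\<Sum>\<nu>\<in>interlacing n \<rho>.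
       if ?d (\<sigma> n) \<nu> \<and> (\<forall>i<n. l (\<sigma> i) = int (\<nu> i) + (int n - int i)) then 1 else 0))"
    unfolding split ..
  also have "\<dots> = (\<Sum>\<sigma> | \<sigma> permutes {..<Suc n}. ?s \<sigma> *
            (if \<forall>i<Suc n. l (\<sigma> i) = int (\<rho> i) + (int n - int i) then 1 else 0))"
    by (rule alternating_sum_interlacing[OF Suc.prems])
  finally show ?case by (simp del: kostka.simps)
qed

section \<open>Symmetric functions are determined by their alternating sums\<close>

lemma permutes_descent:
  fixes \<sigma> :: "nat \<Rightarrow> nat"
  assumes "\<sigma> permutes {..<n}" "\<sigma> \<noteq> id"
  shows "\<exists>i. Suc i < n \<and> \<sigma> (Suc i) < \<sigma> i"
proof (rule ccontr)
  assume no: "\<not> ?thesis"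
  have ge: "i \<le> \<sigma> i" if "i < n" for i
    using that
  proof (induction i)
    case (Suc i)
    then have "\<not> \<sigma> (Suc i) < \<sigma> i" using no by blast
    moreover have "\<sigma> i \<noteq> \<sigma> (Suc i)" using permutes_inj[OF assms(1)] by (simp add: inj_eq)
    moreover have "i \<le> \<sigma> i" using Suc by simp
    ultimately show ?case by linarith
  qed simp
  then have "\<sigma> = id" using assms(1) by (intro permutes_natset_ge) auto
  then show False using assms(2) by simp
qed

text \<open>
  A strict rearrangement inequality: a permutation that is not the identity has a descent, and undoing it
  brings \<open>l \<circ> \<sigma>\<close> closer to \<open>d\<close>. So the minimum, which exists, can only be attained at the identity.
\<close>

lemma square_distance_minimal:
  fixes l d :: "nat \<Rightarrow> int"
  assumes \<sigma>: "\<sigma> permutes {..<n}" "\<sigma> \<noteq> id"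
    and l: "\<And>i j. i < j \<Longrightarrow> j < n \<Longrightarrow> l j < l i" and d: "\<And>i j. i < j \<Longrightarrow> j < n \<Longrightarrow> d j < d i"
  shows "(\<Sum>i<n. (l i - d i)\<^sup>2) < (\<Sum>i<n. (l (\<sigma> i) - d i)\<^sup>2)"
proof -
  define F where "F \<sigma> = (\<Sum>i<n. (l (\<sigma> i) - d i)\<^sup>2)" for \<sigma> :: "nat \<Rightarrow> nat"
  have step: "\<exists>\<sigma>'. \<sigma>' permutes {..<n} \<and> F \<sigma>' < F \<sigma>" if \<sigma>: "\<sigma> permutes {..<n}" "\<sigma> \<noteq> id" for \<sigma>
  proof -
    obtain i where i: "Suc i < n" "\<sigma> (Suc i) < \<sigma> i" using permutes_descent[OF \<sigma>] by blast
    let ?\<sigma>' = "\<sigma> \<circ> transpose i (Suc i)"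
    have "\<sigma> i < n" using permutes_in_image[OF \<sigma>(1), of i] i by simp
    then have li: "l (\<sigma> i) < l (\<sigma> (Suc i))" using i l by blast
    have di: "d (Suc i) < d i" using i d by blast
    have "F ?\<sigma>' = (l (\<sigma> (Suc i)) - d i)\<^sup>2 + (l (\<sigma> i) - d (Suc i))\<^sup>2 +
        (\<Sum>j\<in>{..<n} - {i, Suc i}. (l (\<sigma> j) - d j)\<^sup>2)"
      unfolding F_def using i
      by (subst sum_remove_two[of _ i "Suc i"]) (auto simp: transpose_apply_other intro!: sum.cong)
    moreover have "F \<sigma> = (l (\<sigma> i) - d i)\<^sup>2 + (l (\<sigma> (Suc i)) - d (Suc i))\<^sup>2 +
        (\<Sum>j\<in>{..<n} - {i, Suc i}. (l (\<sigma> j) - d j)\<^sup>2)"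
      unfolding F_def using i by (subst sum_remove_two[of _ i "Suc i"]) auto
    moreover have "(l (\<sigma> (Suc i)) - l (\<sigma> i)) * (d i - d (Suc i)) > 0" using li di by simp
    then have "(l (\<sigma> (Suc i)) - d i)\<^sup>2 + (l (\<sigma> i) - d (Suc i))\<^sup>2 <
        (l (\<sigma> i) - d i)\<^sup>2 + (l (\<sigma> (Suc i)) - d (Suc i))\<^sup>2"
      by (simp add: power2_eq_square algebra_simps)
    ultimately have "F ?\<sigma>' < F \<sigma>" by simp
    then show ?thesis using permutes_compose_transpose[OF \<sigma>(1)] i by (intro exI[of _ ?\<sigma>']) auto
  qed
  have fin: "finite {\<sigma>. \<sigma> permutes {..<n}}" by (simp add: finite_permutations)
  have "{\<sigma>. \<sigma> permutes {..<n}} \<noteq> {}" using \<sigma>(1) by auto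
  then obtain \<tau> where \<tau>: "\<tau> permutes {..<n}" "\<And>\<sigma>. \<sigma> permutes {..<n} \<Longrightarrow> F \<tau> \<le> F \<sigma>"
    using arg_min_if_finite(1)[OF fin, of F] arg_min_least[OF fin, of _ F] by fastforce
  have "\<tau> = id" using step[OF \<tau>(1)] \<tau>(2) by (meson not_le)
  then have "F id \<le> F \<sigma>'" if "\<sigma>' permutes {..<n}" for \<sigma>' using \<tau>(2) that by simp
  moreover obtain \<sigma>' where "\<sigma>' permutes {..<n}" "F \<sigma>' < F \<sigma>" using step[OF \<sigma>] by blast
  ultimately have "F id < F \<sigma>" by fastforce
  then show ?thesis by (simp add: F_def)
qed

text \<open>
  In the alternating sum at a partition, every permutation except the identity evaluates \<open>c\<close> at a vector
  with the same sum but a larger sum of squares. Hence \<open>c\<close> vanishes at the partition by induction, from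
  large to small sums of squares, and by symmetry at all its rearrangements.
\<close>

lemma symmetric_eq_0_if_alternation_0:
  fixes c :: "(nat \<Rightarrow> int) \<Rightarrow> int poly"
  assumes cong: "\<And>\<gamma> \<gamma>'. (\<And>i. i < n \<Longrightarrow> \<gamma> i = \<gamma>' i) \<Longrightarrow> c \<gamma> = c \<gamma>'"
    and neg: "\<And>\<gamma> i. i < n \<Longrightarrow> \<gamma> i < 0 \<Longrightarrow> c \<gamma> = 0"
    and sym: "\<And>\<gamma> i. Suc i < n \<Longrightarrow> c (\<gamma> \<circ> transpose i (Suc i)) = c \<gamma>"
    and alt: "\<And>\<mu>. \<mu> \<in> Par n \<Longrightarrow> alternation n c (\<lambda>i. int (\<mu> i) + (int n - 1 - int i)) = 0"
  shows "c \<gamma> = 0"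
proof -
  \<comment> \<open>\<open>Q\<close> decreases as the sum of squares grows; \<open>M\<close> decreases when an ascent is sorted away.\<close>
  define Q where "Q \<gamma> = nat ((\<Sum>i<n. \<gamma> i)\<^sup>2 - (\<Sum>i<n. (\<gamma> i)\<^sup>2))" for \<gamma> :: "nat \<Rightarrow> int"
  define M where "M \<gamma> = nat (\<Sum>i<n. int i * \<gamma> i)" for \<gamma> :: "nat \<Rightarrow> int"
  define R where "R = inv_image (less_than <*lex*> less_than) (\<lambda>\<gamma>. (Q \<gamma>, M \<gamma>))"
  have "wf R" unfolding R_def by (intro wf_inv_image wf_lex_prod wf_less_than)
  then show ?thesis
  proof (induction \<gamma> rule: wf_induct_rule)
    case (less \<gamma>)
    have IH: "c \<gamma>' = 0" if "Q \<gamma>' < Q \<gamma> \<or> Q \<gamma>' = Q \<gamma> \<and> M \<gamma>' < M \<gamma>" for \<gamma>'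
      by (rule less) (use that in \<open>auto simp: R_def\<close>)
    show ?case
    proof (cases "\<exists>i<n. \<gamma> i < 0")
      case True
      then show ?thesis using assms(2) by blast
    next
      case False
      then have nonneg: "0 \<le> \<gamma> i" if "i < n" for i using that by (meson not_le)
      show ?thesis
      proof (cases "\<exists>i. Suc i < n \<and> \<gamma> i < \<gamma> (Suc i)")
        case True
        then obtain i where ascent: "Suc i < n" "\<gamma> i < \<gamma> (Suc i)" by blast
        let ?g = "\<gamma> \<circ> transpose i (Suc i)"
        have s: "(\<Sum>j<n. h j (?g j)) = h i (\<gamma> (Suc i)) + h (Suc i) (\<gamma> i) + (\<Sum>j\<in>{..<n} - {i, Suc i}. h j (\<gamma> j))"
          for h :: "nat \<Rightarrow> int \<Rightarrow> int"
          using ascent(1) by (subst sum_remove_two[of _ i "Suc i"]) (auto simp: transpose_apply_other intro!: sum.cong)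
        have s': "(\<Sum>j<n. h j (\<gamma> j)) = h i (\<gamma> i) + h (Suc i) (\<gamma> (Suc i)) + (\<Sum>j\<in>{..<n} - {i, Suc i}. h j (\<gamma> j))"
          for h :: "nat \<Rightarrow> int \<Rightarrow> int"
          using ascent(1) by (subst sum_remove_two[of _ i "Suc i"]) auto
        have "Q ?g = Q \<gamma>"
          using s[of "\<lambda>_ x. x"] s'[of "\<lambda>_ x. x"] s[of "\<lambda>_ x. x\<^sup>2"] s'[of "\<lambda>_ x. x\<^sup>2"] by (simp add: Q_def add.commute)
        moreover have "(\<Sum>j<n. int j * ?g j) < (\<Sum>j<n. int j * \<gamma> j)"
          unfolding s[of "\<lambda>j x. int j * x"] s'[of "\<lambda>j x. int j * x"] using ascent(2)
          by (simp add: algebra_simps)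
        moreover have "0 \<le> (\<Sum>j<n. int j * ?g j)"
          unfolding s[of "\<lambda>j x. int j * x"] using ascent(1)
          by (intro add_nonneg_nonneg sum_nonneg mult_nonneg_nonneg nonneg) auto
        ultimately have "c ?g = 0" by (intro IH) (auto simp: M_def)
        then show ?thesis using sym ascent(1) by simp
      next
        case False
        then have sorted: "\<gamma> (Suc i) \<le> \<gamma> i" if "Suc i < n" for i using that by (meson not_le)
        define \<mu> where "\<mu> i = (if i < n then nat (\<gamma> i) else 0)" for i
        have \<mu>: "\<mu> \<in> Par n" 
        proof (rule ParI)
          fix i show "\<mu> (Suc i) \<le> \<mu> i" using sorted[of i] by (simp add: \<mu>_def nat_mono)
        qed (simp add: \<mu>_def)
        have \<mu>\<gamma>: "int (\<mu> i) = \<gamma> i" if "i < n" for i using nonneg[OF that] that by (simp add: \<mu>_def)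
        let ?d = "\<lambda>i. int n - 1 - int i"
        define l where "l i = int (\<mu> i) + ?d i" for i
        let ?b = "\<lambda>\<sigma> i. l (\<sigma> i) - ?d i"
        have zero: "c (?b \<sigma>) = 0" if \<sigma>: "\<sigma> permutes {..<n}" "\<sigma> \<noteq> id" for \<sigma>
        proof (cases "\<exists>i<n. ?b \<sigma> i < 0")
          case True
          then obtain i where "i < n" "?b \<sigma> i < 0" by blast
          then show ?thesis by (rule neg)
        next
          case False
          then have nonneg_b: "0 \<le> ?b \<sigma> i" if "i < n" for i using that by (meson not_le)
          have "(\<Sum>i<n. l (\<sigma> i)) = (\<Sum>i<n. l i)" using sum.permute[OF \<sigma>(1), of l] by (simp add: comp_def)
          then have "(\<Sum>i<n. ?b \<sigma> i) = (\<Sum>i<n. l i - ?d i)" by (simp add: sum_subtractf)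
          also have "\<dots> = (\<Sum>i<n. \<gamma> i)" using \<mu>\<gamma> by (intro sum.cong) (auto simp: l_def)
          finally have e: "(\<Sum>i<n. ?b \<sigma> i) = (\<Sum>i<n. \<gamma> i)" .
          have "(\<Sum>i<n. (\<gamma> i)\<^sup>2) = (\<Sum>i<n. (l i - ?d i)\<^sup>2)" using \<mu>\<gamma> by (intro sum.cong) (auto simp: l_def)
          also have "\<dots> < (\<Sum>i<n. (?b \<sigma> i)\<^sup>2)"
          proof (rule square_distance_minimal[OF \<sigma>])
            fix i j :: nat assume "i < j" "j < n"
            then show "l j < l i" using Par_mono[OF \<mu>, of i j] by (simp add: l_def)
          qed simp
          finally have lt: "(\<Sum>i<n. (\<gamma> i)\<^sup>2) < (\<Sum>i<n. (?b \<sigma> i)\<^sup>2)" .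
          have "(\<Sum>i<n. (?b \<sigma> i)\<^sup>2) \<le> (\<Sum>i<n. ?b \<sigma> i * (\<Sum>j<n. ?b \<sigma> j))"
          proof (rule sum_mono)
            fix i assume "i \<in> {..<n}"
            then have "?b \<sigma> i \<le> (\<Sum>j<n. ?b \<sigma> j)" by (intro member_le_sum nonneg_b) auto
            then show "(?b \<sigma> i)\<^sup>2 \<le> ?b \<sigma> i * (\<Sum>j<n. ?b \<sigma> j)"
              using nonneg_b[of i] \<open>i \<in> {..<n}\<close> unfolding power2_eq_square by (intro mult_left_mono) auto
          qed
          also have "\<dots> = (\<Sum>i<n. \<gamma> i)\<^sup>2" unfolding sum_distrib_right[symmetric] e power2_eq_square ..
          finally have "Q (?b \<sigma>) < Q \<gamma>" 
            unfolding Q_def e using lt by (subst nat_mono_iff) linarith+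
          then show ?thesis by (intro IH disjI1)
        qed
        have "0 = alternation n c l" using alt[OF \<mu>] by (simp add: l_def[abs_def])
        also have "\<dots> = (\<Sum>\<sigma> | \<sigma> permutes {..<n}. if \<sigma> = id then c (?b id) else 0)"
          unfolding alternation_def
        proof (rule sum.cong[OF refl])
          fix \<sigma> assume "\<sigma> \<in> {\<sigma>. \<sigma> permutes {..<n}}"
          then show "of_int (sign \<sigma>) * c (?b \<sigma>) = (if \<sigma> = id then c (?b id) else 0)"
            using zero[of \<sigma>] by (cases "\<sigma> = id") (simp_all only: sign_id of_int_1 mult_1 if_True if_False mult_zero_right mem_Collect_eq simp_thms)
        qed
        also have "\<dots> = c (?b id)" by (simp add: finite_permutations permutes_id)
        also have "\<dots> = c \<gamma>" using \<mu>\<gamma> by (intro cong) (simp add: l_def)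
        finally show ?thesis by simp
      qed
    qed
  qed
qed

text \<open>
  Since \<open>\<mu> + \<delta>\<close> and \<open>\<rho> + \<delta>\<close> are both strictly decreasing, only the identity can carry one to the other.
\<close>

lemma alternation_kostka_strict:
  assumes "\<rho> \<in> Par n" "\<mu> \<in> Par n"
  shows "alternation n (kostka n \<rho>) (\<lambda>i. int (\<mu> i) + (int n - 1 - int i)) = (if \<mu> = \<rho> then 1 else 0)"
proof -
  let ?l = "\<lambda>i. int (\<mu> i) + (int n - 1 - int i)" and ?r = "\<lambda>i. int (\<rho> i) + (int n - 1 - int i)"
  have only_id: "\<sigma> = id" if \<sigma>: "\<sigma> permutes {..<n}" and eq: "\<forall>i<n. ?l (\<sigma> i) = ?r i" for \<sigma>
  proof (rule ccontr)
    assume "\<sigma> \<noteq> id"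
    then obtain i where i: "Suc i < n" "\<sigma> (Suc i) < \<sigma> i" using permutes_descent[OF \<sigma>] by blast
    have "?l (\<sigma> i) < ?l (\<sigma> (Suc i))" using Par_mono[OF assms(2), of "\<sigma> (Suc i)" "\<sigma> i"] i by simp
    moreover have "?r (Suc i) < ?r i" using Par_mono[OF assms(1), of i "Suc i"] by simp
    ultimately show False using eq i by (metis Suc_lessD order.asym)
  qed
  have "(\<forall>i<n. ?l i = ?r i) \<longleftrightarrow> \<mu> = \<rho>"
    using assms by (auto simp: fun_eq_iff) (metis Par_zero not_le)
  then have "of_int (sign \<sigma>) * (if \<forall>i<n. ?l (\<sigma> i) = ?r i then 1 else (0 :: int poly)) =
      (if \<sigma> = id then if \<mu> = \<rho> then 1 else 0 else 0)" if "\<sigma> permutes {..<n}" for \<sigma>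
    using only_id[OF that] by (auto simp: sign_id)
  then have "alternation n (kostka n \<rho>) ?l =
      (\<Sum>\<sigma> | \<sigma> permutes {..<n}. if \<sigma> = id then if \<mu> = \<rho> then 1 else 0 else 0)"
    unfolding alternation_kostka[OF assms(1)] by (intro sum.cong) auto
  then show ?thesis by (simp add: finite_permutations permutes_id)
qed

lemma alternation_diff_sum:
  "alternation n (\<lambda>\<gamma>. c \<gamma> - (\<Sum>a\<in>A. w a * f a \<gamma>)) l =
     alternation n c l - (\<Sum>a\<in>A. w a * alternation n (f a) l)"
proof -
  have "(\<Sum>\<sigma>\<in>S. of_int (sign \<sigma>) * (g \<sigma> - (\<Sum>a\<in>A. w a * h a \<sigma>))) =
      (\<Sum>\<sigma>\<in>S. of_int (sign \<sigma>) * g \<sigma>) - (\<Sum>a\<in>A. w a * (\<Sum>\<sigma>\<in>S. of_int (sign \<sigma>) * h a \<sigma>))"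
    for S and g :: "(nat \<Rightarrow> nat) \<Rightarrow> int poly" and h
  proof -
    have "(\<Sum>\<sigma>\<in>S. of_int (sign \<sigma>) * (\<Sum>a\<in>A. w a * h a \<sigma>)) =
        (\<Sum>a\<in>A. w a * (\<Sum>\<sigma>\<in>S. of_int (sign \<sigma>) * h a \<sigma>))"
      unfolding sum_distrib_left by (subst sum.swap) (simp only: mult.left_commute)
    then show ?thesis by (simp only: right_diff_distrib sum_subtractf)
  qed
  then show ?thesis unfolding alternation_def .
qed

text \<open>
  The two sides are symmetric and have the same alternating sums, and these determine a symmetric function.
\<close>

lemma symmetric_eq_kostka_sum:
  fixes c :: "(nat \<Rightarrow> int) \<Rightarrow> int poly"
  assumes cong: "\<And>\<gamma> \<gamma>'. (\<And>i. i < n \<Longrightarrow> \<gamma> i = \<gamma>' i) \<Longrightarrow> c \<gamma> = c \<gamma>'"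
    and neg: "\<And>\<gamma> i. i < n \<Longrightarrow> \<gamma> i < 0 \<Longrightarrow> c \<gamma> = 0"
    and sym: "\<And>\<gamma> i. Suc i < n \<Longrightarrow> c (\<gamma> \<circ> transpose i (Suc i)) = c \<gamma>"
    and fin: "finite A" and shape: "\<And>a. a \<in> A \<Longrightarrow> s a \<in> Par n"
    and alt: "\<And>\<mu>. \<mu> \<in> Par n \<Longrightarrow>
      alternation n c (\<lambda>i. int (\<mu> i) + (int n - 1 - int i)) = (\<Sum>a | a \<in> A \<and> s a = \<mu>. w a)"
  shows "c \<gamma> = (\<Sum>a\<in>A. w a * kostka n (s a) \<gamma>)"
proof -
  define D where "D \<gamma> = c \<gamma> - (\<Sum>a\<in>A. w a * kostka n (s a) \<gamma>)" for \<gamma>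
  have "D \<gamma> = 0"
  proof (rule symmetric_eq_0_if_alternation_0[of n D])
    fix \<gamma> \<gamma>' :: "nat \<Rightarrow> int"
    assume e: "\<And>i. i < n \<Longrightarrow> \<gamma> i = \<gamma>' i"
    have "c \<gamma> = c \<gamma>'" by (rule cong) (rule e)
    moreover have "kostka n p \<gamma> = kostka n p \<gamma>'" for p by (rule kostka_cong) (rule e)
    ultimately show "D \<gamma> = D \<gamma>'" by (simp only: D_def)
  next
    fix \<gamma> :: "nat \<Rightarrow> int" and i
    assume i: "i < n" "\<gamma> i < 0"
    then have "c \<gamma> = 0" by (rule neg)
    moreover have "kostka n p \<gamma> = 0" for p using i by (rule kostka_negative)
    ultimately show "D \<gamma> = 0" by (simp only: D_def mult_zero_right sum.neutral_const diff_self)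
  next
    fix \<gamma> :: "nat \<Rightarrow> int" and i
    assume i: "Suc i < n"
    show "D (\<gamma> \<circ> transpose i (Suc i)) = D \<gamma>" by (simp only: D_def sym[OF i] kostka_symmetric[OF i])
  next
    fix \<mu> assume \<mu>: "\<mu> \<in> Par n"
    let ?l = "\<lambda>i. int (\<mu> i) + (int n - 1 - int i)"
    have "alternation n D ?l = alternation n c ?l - (\<Sum>a\<in>A. w a * alternation n (kostka n (s a)) ?l)"
      unfolding D_def[abs_def] by (rule alternation_diff_sum)
    also have "\<dots> = alternation n c ?l - (\<Sum>a\<in>A. if s a = \<mu> then w a else 0)"
      by (rule arg_cong2[where f = "(-)", OF refl], rule sum.cong[OF refl])
        (simp add: alternation_kostka_strict[OF shape \<mu>] eq_commute[of \<mu>])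
    also have "(\<Sum>a\<in>A. if s a = \<mu> then w a else 0) = (\<Sum>a | a \<in> A \<and> s a = \<mu>. w a)"
      by (rule sum.inter_filter[OF fin, symmetric])
    finally show "alternation n D ?l = 0" by (simp only: alt[OF \<mu>] diff_self)
  qed
  then show ?thesis by (simp only: D_def right_minus_eq)
qed

section \<open>Natural unit interval orders\<close>

locale unit_interval_poset =
  fixes P :: "nat set" and r :: "nat rel"
  assumes natural_order: "natural_unit_interval_order P r"
begin

abbreviation below :: "nat \<Rightarrow> nat \<Rightarrow> bool" where "below \<equiv> strictly_below r"
abbreviation incomp :: "nat \<Rightarrow> nat \<Rightarrow> bool" where "incomp \<equiv> incomparable P r"

lemma finite_P: "finite P"
  using natural_order by (simp add: natural_unit_interval_order_def)

lemma below_trans: "below x y \<Longrightarrow> below y z \<Longrightarrow> below x z"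
  using natural_order
  unfolding natural_unit_interval_order_def partial_order_on_def preorder_on_def strictly_below_def
  by (metis antisymD transD)

lemma below_less: "below x y \<Longrightarrow> x < y"
  using natural_order unfolding natural_unit_interval_order_def by blast

lemma below_in_P: "below x y \<Longrightarrow> x \<in> P \<and> y \<in> P"
  using natural_order
  unfolding natural_unit_interval_order_def partial_order_on_def preorder_on_def strictly_below_def
  by blast

lemma incomp_between: "below x z \<Longrightarrow> incomp x y \<Longrightarrow> incomp y z \<Longrightarrow> x < y \<and> y < z"
  using natural_order unfolding natural_unit_interval_order_def by blast

lemma incomp_sym: "incomp x y \<Longrightarrow> incomp y x"
  by (auto simp: incomparable_def)

lemma not_incomp_self: "\<not> incomp x x"
  using natural_order
  unfolding natural_unit_interval_order_def partial_order_on_def preorder_on_def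
  by (auto simp: incomparable_def refl_on_def)

lemma incomp_iff: "x \<in> P \<Longrightarrow> y \<in> P \<Longrightarrow> incomp x y \<longleftrightarrow> x \<noteq> y \<and> \<not> below x y \<and> \<not> below y x"
  using not_incomp_self by (auto simp: incomparable_def strictly_below_def)

lemma incomp_not_below: "incomp x y \<Longrightarrow> \<not> below x y \<and> \<not> below y x"
  by (auto simp: incomparable_def strictly_below_def)

definition chain :: "nat set \<Rightarrow> bool" where
  "chain A \<longleftrightarrow> A \<subseteq> P \<and> (\<forall>x\<in>A. \<forall>y\<in>A. \<not> incomp x y)"

lemma chain_finite: "chain A \<Longrightarrow> finite A"
  using finite_P by (auto simp: chain_def intro: finite_subset)

lemma chain_below: "chain A \<Longrightarrow> x \<in> A \<Longrightarrow> y \<in> A \<Longrightarrow> x < y \<Longrightarrow> below x y"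
  using incomp_iff[of x y] below_less[of y x] by (auto simp: chain_def)

text \<open>
  An edge between two chains never jumps over an element \<open>w\<close> of either chain: \<open>w\<close> is comparable to the end in
  its own chain, hence incomparable to the other end, which would have to lie between them.
\<close>

lemma no_crossing:
  assumes "chain A" "chain B" "y < w" "w < x" "incomp x y" "x \<in> A \<union> B" "y \<in> A \<union> B" "w \<in> A \<union> B"
  shows False
proof -
  have in_P: "x \<in> P" "y \<in> P" "w \<in> P" using assms by (auto simp: chain_def)
  have one: False if "chain A" "chain B" "y \<in> A" "x \<in> B" "w \<in> A \<union> B" for A B
  proof (cases "w \<in> A")
    case True
    have yw: "below y w" using chain_below[OF \<open>chain A\<close> \<open>y \<in> A\<close> True \<open>y < w\<close>] .
    then have "\<not> below w x" using below_trans incomp_not_below[OF \<open>incomp x y\<close>] by blast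
    moreover have "\<not> below x w" using below_less \<open>w < x\<close> by (metis not_less_iff_gr_or_eq)
    ultimately have "incomp x w" using incomp_iff in_P \<open>w < x\<close> by auto
    then show False using incomp_between[OF yw incomp_sym[OF \<open>incomp x y\<close>]] \<open>w < x\<close> by auto
  next
    case False
    then have "w \<in> B" using that by auto
    then have wx: "below w x" using chain_below[OF \<open>chain B\<close> _ \<open>x \<in> B\<close> \<open>w < x\<close>] by blast
    then have "\<not> below y w" using below_trans incomp_not_below[OF \<open>incomp x y\<close>] by blast
    moreover have "\<not> below w y" using below_less \<open>y < w\<close> by (metis not_less_iff_gr_or_eq)
    ultimately have "incomp w y" using incomp_iff in_P \<open>y < w\<close> by auto
    then show False using incomp_between[OF wx _ incomp_sym[OF \<open>incomp x y\<close>]] \<open>y < w\<close> by auto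
  qed
  have "\<not> (x \<in> A \<and> y \<in> A)" "\<not> (x \<in> B \<and> y \<in> B)" using assms by (auto simp: chain_def)
  then show False using one[of A B] one[of B A] assms by blast
qed

section \<open>Exchanging components of two chains\<close>

definition component :: "nat set \<Rightarrow> nat \<Rightarrow> nat set" where
  "component Z z = {w. (z, w) \<in> {(u, v). u \<in> Z \<and> v \<in> Z \<and> incomp u v}\<^sup>*}"

text \<open>
  Apart from the elements common to both chains, which are isolated, a component is a path that alternates
  between the chains, so it is uneven exactly if its number of vertices is odd. Comparing the two parts instead makes the effect of an exchange on the lengths immediate.
\<close>

definition uneven :: "nat set \<Rightarrow> nat set \<Rightarrow> nat \<Rightarrow> bool" where
  "uneven A B z \<longleftrightarrow> card (A \<inter> component (A \<union> B) z) \<noteq> card (B \<inter> component (A \<union> B) z)"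

text \<open>
  The new first chain when the uneven components inside the region \<open>Y\<close> are exchanged between \<open>A\<close> and \<open>B\<close>;
  the new second chain is obtained by exchanging the roles of \<open>A\<close> and \<open>B\<close>.
\<close>

definition swap_components :: "nat set \<Rightarrow> nat set \<Rightarrow> nat set \<Rightarrow> nat set" where
  "swap_components Y A B = {z \<in> A \<union> B. if z \<in> Y \<and> uneven A B z then z \<in> B else z \<in> A}"

definition inversions :: "nat set \<Rightarrow> nat set \<Rightarrow> nat" where
  "inversions A B = card {(u, v). u \<in> A \<and> v \<in> B \<and> incomp u v \<and> v < u}"

lemma component_refl: "z \<in> component Z z"
  by (simp add: component_def)

lemma component_subset: "z \<in> Z \<Longrightarrow> component Z z \<subseteq> Z"
proof
  fix w assume "z \<in> Z" "w \<in> component Z z"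
  then have "(z, w) \<in> {(u, v). u \<in> Z \<and> v \<in> Z \<and> incomp u v}\<^sup>*" by (simp add: component_def)
  then show "w \<in> Z" using \<open>z \<in> Z\<close> by (induction rule: rtrancl_induct) auto
qed

lemma component_eq: "w \<in> component Z z \<Longrightarrow> component Z w = component Z z"
proof -
  assume "w \<in> component Z z"
  moreover have "sym ({(u, v). u \<in> Z \<and> v \<in> Z \<and> incomp u v}\<^sup>*)"
    using incomp_sym by (intro sym_rtrancl) (auto simp: sym_def)
  ultimately show ?thesis
    unfolding component_def by (auto dest: symD intro: rtrancl_trans)
qed

lemma component_edge: "u \<in> Z \<Longrightarrow> v \<in> Z \<Longrightarrow> incomp u v \<Longrightarrow> component Z u = component Z v"
  by (intro component_eq) (auto simp: component_def intro: incomp_sym)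

lemma component_closed:
  assumes "z \<in> S" "\<And>u v. u \<in> S \<Longrightarrow> u \<in> Z \<Longrightarrow> v \<in> Z \<Longrightarrow> incomp u v \<Longrightarrow> v \<in> S"
  shows "component Z z \<subseteq> S"
proof
  fix w assume "w \<in> component Z z"
  then have "(z, w) \<in> {(u, v). u \<in> Z \<and> v \<in> Z \<and> incomp u v}\<^sup>*" by (simp add: component_def)
  then show "w \<in> S" using assms by (induction rule: rtrancl_induct) auto
qed

lemma card_by_components:
  assumes "finite Z" "A \<subseteq> Z"
  shows "card A = (\<Sum>K\<in>component Z ` Z. card (A \<inter> K))"
proof -
  have "A = (\<Union>K\<in>component Z ` Z. A \<inter> K)" using assms component_refl by blast
  also have "card \<dots> = (\<Sum>K\<in>component Z ` Z. card (A \<inter> K))"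
  proof (rule card_UN_disjoint)
    show "\<forall>K\<in>component Z ` Z. finite (A \<inter> K)" using assms finite_subset by blast
    show "\<forall>K\<in>component Z ` Z. \<forall>L\<in>component Z ` Z. K \<noteq> L \<longrightarrow> A \<inter> K \<inter> (A \<inter> L) = {}"
      using component_eq by blast
  qed (use assms in auto)
  finally show ?thesis .
qed

context
  fixes A B :: "nat set"
  assumes chains: "chain A" "chain B"
begin

lemma finite_rows: "finite (A \<union> B)"
  using chains chain_finite by auto

lemma component_props:
  assumes "z \<in> A \<union> B"
  shows "finite (component (A \<union> B) z)" "component (A \<union> B) z \<noteq> {}"
  using component_subset[OF assms] finite_rows component_refl finite_subset by blast+

text \<open>
  An element without a lower neighbour bounds its component from below, because no edge jumps over it.
\<close>

lemma lower_neighbour_iff: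
  assumes "u \<in> A \<union> B"
  shows "(\<exists>v\<in>A \<union> B. incomp u v \<and> v < u) \<longleftrightarrow> u \<noteq> Min (component (A \<union> B) u)"
proof
  assume "\<exists>v\<in>A \<union> B. incomp u v \<and> v < u"
  then obtain v where v: "v \<in> A \<union> B" "incomp u v" "v < u" by blast
  then have "v \<in> component (A \<union> B) u" using component_edge[OF assms v(1,2)] component_refl by blast
  then have "Min (component (A \<union> B) u) \<le> v" using component_props[OF assms] by simp
  then show "u \<noteq> Min (component (A \<union> B) u)" using v by simp
next
  assume ne: "u \<noteq> Min (component (A \<union> B) u)"
  show "\<exists>v\<in>A \<union> B. incomp u v \<and> v < u"
  proof (rule ccontr)
    assume no: "\<not> ?thesis"
    have "component (A \<union> B) u \<subseteq> {u..}"
    proof (rule component_closed)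
      fix x v assume x: "x \<in> {u..}" "x \<in> A \<union> B" and v: "v \<in> A \<union> B" "incomp x v"
      show "v \<in> {u..}"
      proof (rule ccontr)
        assume "v \<notin> {u..}"
        then have "v < u" by simp
        then have "x \<noteq> u" using no v by blast
        then have "u < x" using x by simp
        then show False using no_crossing[OF chains \<open>v < u\<close> _ v(2) x(2) v(1) assms] by blast
      qed
    qed simp
    then have "Min (component (A \<union> B) u) = u"
      using component_props[OF assms] component_refl by (intro Min_eqI) auto
    then show False using ne by simp
  qed
qed

lemma upper_neighbour_iff:
  assumes "u \<in> A \<union> B"
  shows "(\<exists>v\<in>A \<union> B. incomp u v \<and> u < v) \<longleftrightarrow> u \<noteq> Max (component (A \<union> B) u)"
proof
  assume "\<exists>v\<in>A \<union> B. incomp u v \<and> u < v"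
  then obtain v where v: "v \<in> A \<union> B" "incomp u v" "u < v" by blast
  then have "v \<in> component (A \<union> B) u" using component_edge[OF assms v(1,2)] component_refl by blast
  then have "v \<le> Max (component (A \<union> B) u)" using component_props[OF assms] by simp
  then show "u \<noteq> Max (component (A \<union> B) u)" using v by simp
next
  assume ne: "u \<noteq> Max (component (A \<union> B) u)"
  show "\<exists>v\<in>A \<union> B. incomp u v \<and> u < v"
  proof (rule ccontr)
    assume no: "\<not> ?thesis"
    have "component (A \<union> B) u \<subseteq> {..u}"
    proof (rule component_closed)
      fix x v assume x: "x \<in> {..u}" "x \<in> A \<union> B" and v: "v \<in> A \<union> B" "incomp x v"
      show "v \<in> {..u}"
      proof (rule ccontr)
        assume "v \<notin> {..u}"
        then have "u < v" by simp
        then have "x \<noteq> u" using no v by blast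
        then have "x < u" using x by simp
        then show False
          using no_crossing[OF chains _ \<open>u < v\<close> incomp_sym[OF v(2)] v(1) x(2) assms] by blast
      qed
    qed simp
    then have "Max (component (A \<union> B) u) = u"
      using component_props[OF assms] component_refl by (intro Max_eqI) auto
    then show False using ne by simp
  qed
qed

text \<open>
  Two lower neighbours of \<open>u\<close> would be comparable, and \<open>u\<close> would have to lie between them.
\<close>

lemma lower_neighbour_unique:
  "inj_on fst {(u, v). u \<in> A \<and> v \<in> B \<and> incomp u v \<and> v < u}"
proof -
  have False if "u \<in> A" "v \<in> B" "v' \<in> B" "incomp u v" "incomp u v'" "v' < u" "v < v'" for u v v'
    using incomp_between[OF chain_below[OF chains(2) that(2,3,7)] incomp_sym[OF that(4)] that(5)] that(6)
    by simp
  then show ?thesis by (auto simp: inj_on_def) (metis linorder_neqE_nat)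
qed

lemma upper_neighbour_unique:
  "inj_on snd {(u, v). u \<in> A \<and> v \<in> B \<and> incomp u v \<and> v < u}"
proof -
  have False if "u \<in> A" "u' \<in> A" "v \<in> B" "incomp u v" "incomp u' v" "v < u" "u < u'" for u u' v
    using incomp_between[OF chain_below[OF chains(1) that(1,2,7)] that(4) incomp_sym[OF that(5)]] that(6)
    by simp
  then show ?thesis by (auto simp: inj_on_def) (metis linorder_neqE_nat)
qed

text \<open>
  An inversion is determined by its larger element, which can be any element of \<open>A\<close> that is not the least
  one of its component.
\<close>

lemma inversions_by_components:
  "inversions A B =
     (\<Sum>K\<in>component (A \<union> B) ` (A \<union> B). card (A \<inter> K - {Min K}))"
proof -
  let ?L = "{u \<in> A. \<exists>v\<in>A \<union> B. incomp u v \<and> v < u}"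
  have "fst ` {(u, v). u \<in> A \<and> v \<in> B \<and> incomp u v \<and> v < u} = ?L"
    using chains(1) by (force simp: chain_def image_iff)
  then have "inversions A B = card ?L"
    unfolding inversions_def using card_image[OF lower_neighbour_unique] by simp
  also have "\<dots> = (\<Sum>K\<in>component (A \<union> B) ` (A \<union> B). card (?L \<inter> K))"
    by (rule card_by_components[OF finite_rows]) auto
  also have "\<dots> = (\<Sum>K\<in>component (A \<union> B) ` (A \<union> B). card (A \<inter> K - {Min K}))"
  proof (rule sum.cong[OF refl])
    fix K assume "K \<in> component (A \<union> B) ` (A \<union> B)"
    then obtain z where z: "z \<in> A \<union> B" "K = component (A \<union> B) z" by blast
    have "u \<in> ?L \<longleftrightarrow> u \<in> A \<and> u \<noteq> Min K" if "u \<in> K" for u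
      using lower_neighbour_iff[of u] component_eq[of u "A \<union> B" z] that z by auto
    then have "?L \<inter> K = A \<inter> K - {Min K}" by blast
    then show "card (?L \<inter> K) = card (A \<inter> K - {Min K})" by simp
  qed
  finally show ?thesis .
qed

text \<open>
  The inversions inside a component, counted by the larger and by the smaller element.
\<close>

lemma component_double_count:
  assumes "z \<in> A \<union> B"
  defines "K \<equiv> component (A \<union> B) z"
  shows "card (A \<inter> K - {Min K}) = card (B \<inter> K - {Max K})"
proof -
  let ?T = "{(u, v). u \<in> A \<and> v \<in> B \<and> incomp u v \<and> v < u}"
  let ?S = "{(u, v). u \<in> A \<inter> K \<and> v \<in> B \<inter> K \<and> incomp u v \<and> v < u}"
  have K: "component (A \<union> B) u = K" if "u \<in> K" for u
    using component_eq that by (simp add: K_def)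
  have K': "v \<in> K" if "u \<in> K" "u \<in> A \<union> B" "v \<in> A \<union> B" "incomp u v" for u v
    using component_edge[OF that(2-4)] K[OF that(1)] component_refl by blast
  have "?S \<subseteq> ?T" by auto
  then have inj: "inj_on fst ?S" "inj_on snd ?S"
    using lower_neighbour_unique upper_neighbour_unique inj_on_subset by blast+
  have "fst ` ?S = A \<inter> K - {Min K}"
  proof (intro equalityI subsetI)
    fix u assume "u \<in> fst ` ?S"
    then obtain v where v: "u \<in> A" "u \<in> K" "v \<in> B" "incomp u v" "v < u" by auto
    then show "u \<in> A \<inter> K - {Min K}" using lower_neighbour_iff[of u] K[of u] by auto
  next
    fix u assume u: "u \<in> A \<inter> K - {Min K}"
    then obtain v where v: "v \<in> A \<union> B" "incomp u v" "v < u"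
      using lower_neighbour_iff[of u] K[of u] by auto
    then have "v \<in> B" using u chains by (auto simp: chain_def)
    moreover have "v \<in> K" using K'[of u v] u v by auto
    ultimately have "(u, v) \<in> ?S" using u v by auto
    then show "u \<in> fst ` ?S" by force
  qed
  moreover have "snd ` ?S = B \<inter> K - {Max K}"
  proof (intro equalityI subsetI)
    fix v assume "v \<in> snd ` ?S"
    then obtain u where u: "u \<in> A" "v \<in> K" "v \<in> B" "incomp u v" "v < u" by auto
    then show "v \<in> B \<inter> K - {Max K}" using upper_neighbour_iff[of v] K[of v] incomp_sym by auto
  next
    fix v assume v: "v \<in> B \<inter> K - {Max K}"
    then obtain u where u: "u \<in> A \<union> B" "incomp v u" "v < u"
      using upper_neighbour_iff[of v] K[of v] by auto
    then have "u \<in> A" using v chains by (auto simp: chain_def)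
    moreover have "u \<in> K" using K'[of v u] u v by auto
    ultimately have "(u, v) \<in> ?S" using u v incomp_sym by auto
    then show "v \<in> snd ` ?S" by force
  qed
  ultimately show ?thesis using card_image[OF inj(1)] card_image[OF inj(2)] by simp
qed

end

text \<open>
  Let \<open>a\<close> and \<open>b\<close> be the sizes of the two parts. Counting the inversions from \<open>A\<close> to \<open>B\<close> and those from \<open>B\<close> to
  \<open>A\<close> in two ways each expresses \<open>a - b\<close> by the chains that contain the least and the greatest element. If
  \<open>a \<noteq> b\<close>, then both lie in the larger part, which exceeds the other one by \<open>1\<close>, and an exchange of
  the two parts does not change the number of inversions.
\<close>

lemma uneven_component_balanced:
  assumes "chain A" "chain B" "z \<in> A \<union> B" "uneven A B z"
  defines "K \<equiv> component (A \<union> B) z"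
  shows "card (A \<inter> K - {Min K}) = card (B \<inter> K - {Min K})"
proof -
  have K: "K \<subseteq> A \<union> B" "finite K" "K \<noteq> {}"
    using component_subset[OF assms(3)] component_props[OF assms(1-3)] by (auto simp: K_def)
  have c: "card (X \<inter> K) = card (X \<inter> K - {k}) + (if k \<in> X then 1 else 0)" if "k \<in> K" for X k
  proof (cases "k \<in> X")
    case True
    then show ?thesis using that K(2) card_Suc_Diff1[of "X \<inter> K" k] by simp
  qed simp
  have Min: "Min K \<in> K" and Max: "Max K \<in> K" using K by auto
  have "Min K \<in> A \<or> Min K \<in> B" "Max K \<in> A \<or> Max K \<in> B" using Min Max K by blast+
  moreover have "card (A \<inter> K - {Min K}) = card (B \<inter> K - {Max K})"
    using component_double_count[OF assms(1-3)] by (simp add: K_def)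
  moreover have "card (B \<inter> K - {Min K}) = card (A \<inter> K - {Max K})"
    using component_double_count[OF assms(2,1)] assms(3) by (simp add: K_def Un_commute)
  moreover have "card (A \<inter> K) \<noteq> card (B \<inter> K)" using assms(4) by (simp add: uneven_def K_def)
  ultimately show ?thesis
    using c[OF Min, of A] c[OF Min, of B] c[OF Max, of A] c[OF Max, of B] by (auto split: if_splits)
qed

lemma uneven_sym: "uneven A B z = uneven B A z"
  by (auto simp: uneven_def Un_commute)

lemma swap_components_Un: "swap_components Y A B \<union> swap_components Y B A = A \<union> B"
  by (auto simp: swap_components_def uneven_sym[of B A])

lemma swap_components_Int: "swap_components Y A B \<inter> swap_components Y B A = A \<inter> B"
  by (auto simp: swap_components_def uneven_sym[of B A] split: if_splits)

lemma swap_components_outside: "swap_components Y A B - Y = A - Y"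
  by (auto simp: swap_components_def split: if_splits)

lemma uneven_component: "w \<in> component (A \<union> B) z \<Longrightarrow> uneven A B w = uneven A B z"
  by (simp add: uneven_def component_eq)

text \<open>
  No edge leaves the region, so every component lies inside or outside of it.
\<close>

lemma component_in_region:
  assumes "\<forall>h\<in>Z - Y. \<forall>t\<in>Z \<inter> Y. \<not> incomp h t" "z \<in> Z" "w \<in> component Z z"
  shows "w \<in> Y \<longleftrightarrow> z \<in> Y"
proof (cases "z \<in> Y")
  case True
  have "component Z z \<subseteq> Y"
    by (rule component_closed[OF True]) (use assms(1) incomp_sym in blast)
  then show ?thesis using True assms(3) by blast
next
  case False
  have "component Z z \<subseteq> - Y"
    by (rule component_closed) (use assms(1) incomp_sym False in blast)+
  then show ?thesis using False assms(3) by blast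
qed

context
  fixes A B Y :: "nat set"
  assumes chains: "chain A" "chain B"
    and sep: "\<forall>h\<in>(A \<union> B) - Y. \<forall>t\<in>(A \<union> B) \<inter> Y. \<not> incomp h t"
begin

text \<open>
  Incomparable elements lie in a common component. So they are exchanged together or not at all, and
  would have belonged to one chain before.
\<close>

lemma swap_components_chain: "chain (swap_components Y A B)"
  unfolding chain_def
proof (intro conjI ballI notI)
  show "swap_components Y A B \<subseteq> P" using chains by (auto simp: swap_components_def chain_def)
  fix x y assume xy: "x \<in> swap_components Y A B" "y \<in> swap_components Y A B" and i: "incomp x y"
  then have z: "x \<in> A \<union> B" "y \<in> A \<union> B" by (auto simp: swap_components_def)
  then have y: "y \<in> component (A \<union> B) x" using component_edge[OF z i] component_refl by blast
  have "y \<in> Y \<longleftrightarrow> x \<in> Y" by (rule component_in_region[OF sep z(1) y])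
  moreover have "uneven A B y = uneven A B x" by (rule uneven_component[OF y])
  ultimately have "x \<in> A \<and> y \<in> A \<or> x \<in> B \<and> y \<in> B"
    using xy by (auto simp: swap_components_def split: if_splits)
  then show False using i chains by (auto simp: chain_def)
qed

lemma swap_components_Int_component:
  assumes "z \<in> A \<union> B"
  shows "swap_components Y A B \<inter> component (A \<union> B) z =
    (if z \<in> Y \<and> uneven A B z then B else A) \<inter> component (A \<union> B) z"
proof -
  have "w \<in> swap_components Y A B \<longleftrightarrow> w \<in> (if z \<in> Y \<and> uneven A B z then B else A)"
    if w: "w \<in> component (A \<union> B) z" for w
  proof -
    have "w \<in> A \<union> B" using component_subset[OF assms] w by blast
    then show ?thesis
      using component_in_region[OF sep assms w] uneven_component[OF w]
      by (auto simp: swap_components_def)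
  qed
  then show ?thesis by blast
qed

text \<open>
  On a component inside \<open>Y\<close>, the new chain has as many elements as \<open>B\<close> had: either the component is
  exchanged, or it is even.
\<close>

lemma card_swap_components: "card (swap_components Y A B) = card (A - Y) + card (B \<inter> Y)"
proof -
  let ?K = "component (A \<union> B) ` (A \<union> B)"
  have "card (swap_components Y A B) = (\<Sum>K\<in>?K. card (swap_components Y A B \<inter> K))"
    by (rule card_by_components[OF finite_rows[OF chains]]) (auto simp: swap_components_def)
  also have "\<dots> = (\<Sum>K\<in>?K. card ((A - Y) \<inter> K) + card ((B \<inter> Y) \<inter> K))"
  proof (rule sum.cong[OF refl])
    fix K assume "K \<in> ?K"
    then obtain z where z: "z \<in> A \<union> B" "K = component (A \<union> B) z" by blast
    have Y: "w \<in> Y \<longleftrightarrow> z \<in> Y" if "w \<in> K" for w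
      using component_in_region[OF sep z(1)] that z(2) by blast
    have "card (swap_components Y A B \<inter> K) = card ((if z \<in> Y then B else A) \<inter> K)"
      using swap_components_Int_component[OF z(1)] z(2) by (auto simp: uneven_def)
    also have "\<dots> = card ((A - Y) \<inter> K) + card ((B \<inter> Y) \<inter> K)"
    proof (cases "z \<in> Y")
      case True
      then have "(A - Y) \<inter> K = {}" "(B \<inter> Y) \<inter> K = B \<inter> K" using Y by auto
      then show ?thesis using True by simp
    next
      case False
      then have "(A - Y) \<inter> K = A \<inter> K" "(B \<inter> Y) \<inter> K = {}" using Y by auto
      then show ?thesis using False by simp
    qed
    finally show "card (swap_components Y A B \<inter> K) = card ((A - Y) \<inter> K) + card ((B \<inter> Y) \<inter> K)" .
  qed
  also have "\<dots> = card (A - Y) + card (B \<inter> Y)"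
  proof -
    have "A - Y \<subseteq> A \<union> B" "B \<inter> Y \<subseteq> A \<union> B" by auto
    then show ?thesis using card_by_components[OF finite_rows[OF chains]] by (simp add: sum.distrib)
  qed
  finally show ?thesis .
qed

text \<open>
  The union of the chains is unchanged, hence so are the components and which of them are uneven.
\<close>

lemma swap_components_involution:
  "swap_components Y (swap_components Y A B) (swap_components Y B A) = A"
proof -
  let ?A = "swap_components Y A B" and ?B = "swap_components Y B A"
  have sepB: "\<forall>h\<in>(B \<union> A) - Y. \<forall>t\<in>(B \<union> A) \<inter> Y. \<not> incomp h t" using sep by auto
  have un: "?A \<union> ?B = A \<union> B" by (rule swap_components_Un)
  have inter: "?B \<inter> component (A \<union> B) z =
    (if z \<in> Y \<and> uneven A B z then A else B) \<inter> component (A \<union> B) z" if "z \<in> A \<union> B" for z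
  proof -
    have "w \<in> ?B \<longleftrightarrow> w \<in> (if z \<in> Y \<and> uneven A B z then A else B)"
      if w: "w \<in> component (A \<union> B) z" for w
    proof -
      have "w \<in> A \<union> B" using component_subset[OF \<open>z \<in> A \<union> B\<close>] w by blast
      then show ?thesis
        using component_in_region[OF sep \<open>z \<in> A \<union> B\<close> w] uneven_component[OF w]
        by (auto simp: swap_components_def uneven_sym[of B A])
    qed
    then show ?thesis by blast
  qed
  have "uneven ?A ?B z = uneven A B z" if "z \<in> A \<union> B" for z
    unfolding uneven_def un swap_components_Int_component[OF that] inter[OF that]
    by (auto simp: uneven_def)
  then have "z \<in> swap_components Y ?A ?B \<longleftrightarrow> z \<in> A" for z
    using un by (auto simp: swap_components_def[of Y ?A ?B]) (auto simp: swap_components_def uneven_sym[of B A] split: if_splits)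
  then show ?thesis by blast
qed

end

lemma inversions_swap_components:
  assumes "chain A" "chain B" "\<forall>h\<in>(A \<union> B) - Y. \<forall>t\<in>(A \<union> B) \<inter> Y. \<not> incomp h t"
  shows "inversions (swap_components Y A B) (swap_components Y B A) = inversions A B"
proof -
  let ?A = "swap_components Y A B" and ?B = "swap_components Y B A"
  have "chain ?A" by (rule swap_components_chain[OF assms])
  moreover have "chain ?B" by (rule swap_components_chain) (use assms in \<open>auto simp: Un_commute\<close>)
  moreover have un: "?A \<union> ?B = A \<union> B" by (rule swap_components_Un)
  ultimately have "inversions ?A ?B =
      (\<Sum>K\<in>component (A \<union> B) ` (A \<union> B). card (?A \<inter> K - {Min K}))"
    using inversions_by_components[of ?A ?B] by simp
  also have "\<dots> = (\<Sum>K\<in>component (A \<union> B) ` (A \<union> B). card (A \<inter> K - {Min K}))"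
  proof (rule sum.cong[OF refl])
    fix K assume "K \<in> component (A \<union> B) ` (A \<union> B)"
    then obtain z where z: "z \<in> A \<union> B" "K = component (A \<union> B) z" by blast
    show "card (?A \<inter> K - {Min K}) = card (A \<inter> K - {Min K})"
      using swap_components_Int_component[OF assms z(1)] uneven_component_balanced[OF assms(1,2) z(1)] z(2)
      by auto
  qed
  also have "\<dots> = inversions A B" using inversions_by_components[OF assms(1,2)] by simp
  finally show ?thesis .
qed

section \<open>Arrays of chains\<close>

definition arrays :: "nat \<Rightarrow> (nat \<Rightarrow> nat set) set" where
  "arrays n = {C. (\<forall>i. chain (C i)) \<and> (\<forall>i\<ge>n. C i = {}) \<and> (\<Union>i. C i) = P}"

definition array_inversions :: "nat \<Rightarrow> (nat \<Rightarrow> nat set) \<Rightarrow> nat" where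
  "array_inversions n C = (\<Sum>k<n. \<Sum>i<k. inversions (C i) (C k))"

definition array_count :: "nat \<Rightarrow> (nat \<Rightarrow> int) \<Rightarrow> int poly" where
  "array_count n \<gamma> =
     (\<Sum>C | C \<in> arrays n \<and> (\<forall>i<n. int (card (C i)) = \<gamma> i). monom 1 (array_inversions n C))"

definition swap_rows :: "nat set \<Rightarrow> nat \<Rightarrow> (nat \<Rightarrow> nat set) \<Rightarrow> nat \<Rightarrow> nat set" where
  "swap_rows Y i C = C(i := swap_components Y (C i) (C (Suc i)),
                       Suc i := swap_components Y (C (Suc i)) (C i))"

definition separated :: "nat set \<Rightarrow> nat \<Rightarrow> (nat \<Rightarrow> nat set) \<Rightarrow> bool" where
  "separated Y i C \<longleftrightarrow>
     (\<forall>h\<in>(C i \<union> C (Suc i)) - Y. \<forall>t\<in>(C i \<union> C (Suc i)) \<inter> Y. \<not> incomp h t)"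

lemma finite_arrays: "finite (arrays n)"
proof (rule finite_subset)
  show "arrays n \<subseteq> (\<lambda>g i. if i < n then g i else {}) ` (PiE {..<n} (\<lambda>_. Pow P))"
  proof
    fix C assume C: "C \<in> arrays n"
    then have "C i = {}" if "n \<le> i" for i using that by (simp add: arrays_def)
    then have "C = (\<lambda>i. if i < n then restrict C {..<n} i else {})" by (intro ext) simp
    moreover have "restrict C {..<n} \<in> PiE {..<n} (\<lambda>_. Pow P)" using C by (auto simp: arrays_def)
    ultimately show "C \<in> (\<lambda>g i. if i < n then g i else {}) ` (PiE {..<n} (\<lambda>_. Pow P))" by blast
  qed
qed (intro finite_imageI finite_PiE, auto simp: finite_P)

lemma array_count_cong: "(\<And>i. i < n \<Longrightarrow> \<gamma> i = \<gamma>' i) \<Longrightarrow> array_count n \<gamma> = array_count n \<gamma>'"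
  unfolding array_count_def by (intro sum.cong) auto

lemma array_count_negative: "i < n \<Longrightarrow> \<gamma> i < 0 \<Longrightarrow> array_count n \<gamma> = 0"
proof -
  assume "i < n" "\<gamma> i < 0"
  then have "int (card (C i)) \<noteq> \<gamma> i" for C :: "nat \<Rightarrow> nat set" by simp
  then have "{C. C \<in> arrays n \<and> (\<forall>i<n. int (card (C i)) = \<gamma> i)} = {}"
    using \<open>i < n\<close> by blast
  then show ?thesis unfolding array_count_def by (simp only: sum.empty)
qed

lemma inversions_alt:
  assumes "finite A" "finite B"
  shows "inversions A B = (\<Sum>u\<in>A. \<Sum>v\<in>B. if incomp u v \<and> v < u then 1 else 0)"
proof -
  have "{(u, v). u \<in> A \<and> v \<in> B \<and> incomp u v \<and> v < u} =
      {p \<in> A \<times> B. incomp (fst p) (snd p) \<and> snd p < fst p}" by auto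
  then have "inversions A B = (\<Sum>p\<in>A \<times> B. if incomp (fst p) (snd p) \<and> snd p < fst p then 1 else 0)"
    unfolding inversions_def using assms by (simp add: sum.inter_filter[symmetric])
  then show ?thesis by (simp add: sum.cartesian_product case_prod_unfold)
qed

lemma inversions_add_right:
  assumes "finite D" "finite A" "finite B" "A' \<union> B' = A \<union> B" "A' \<inter> B' = A \<inter> B"
  shows "inversions D A' + inversions D B' = inversions D A + inversions D B"
proof -
  have fin: "finite A'" "finite B'" using assms by (metis finite_Un)+
  let ?f = "\<lambda>v. \<Sum>u\<in>D. if incomp u v \<and> v < u then 1 else (0 :: nat)"
  have "sum ?f A' + sum ?f B' = sum ?f A + sum ?f B"
    using sum.union_inter[OF fin, of ?f] sum.union_inter[OF assms(2,3), of ?f] assms(4,5) by simp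
  then show ?thesis
    unfolding inversions_alt[OF assms(1) fin(1)] inversions_alt[OF assms(1) fin(2)]
      inversions_alt[OF assms(1,2)] inversions_alt[OF assms(1,3)] by (simp only: sum.swap[of _ D])
qed

lemma inversions_add_left:
  assumes "finite D" "finite A" "finite B" "A' \<union> B' = A \<union> B" "A' \<inter> B' = A \<inter> B"
  shows "inversions A' D + inversions B' D = inversions A D + inversions B D"
proof -
  have fin: "finite A'" "finite B'" using assms by (metis finite_Un)+
  let ?f = "\<lambda>u. \<Sum>v\<in>D. if incomp u v \<and> v < u then 1 else (0 :: nat)"
  have "sum ?f A' + sum ?f B' = sum ?f A + sum ?f B"
    using sum.union_inter[OF fin, of ?f] sum.union_inter[OF assms(2,3), of ?f] assms(4,5) by simp
  then show ?thesis
    unfolding inversions_alt[OF fin(1) assms(1)] inversions_alt[OF fin(2) assms(1)]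
      inversions_alt[OF assms(2,1)] inversions_alt[OF assms(3,1)] .
qed

text \<open>
  Inversions with a third row depend only on the two rows taken together, with multiplicity.
\<close>

lemma array_inversions_two_rows:
  assumes "Suc i < n" and fin: "\<And>k. finite (C k)"
    and "C' i \<union> C' (Suc i) = C i \<union> C (Suc i)" "C' i \<inter> C' (Suc i) = C i \<inter> C (Suc i)"
    and inv: "inversions (C' i) (C' (Suc i)) = inversions (C i) (C (Suc i))"
    and other: "\<And>k. k \<noteq> i \<Longrightarrow> k \<noteq> Suc i \<Longrightarrow> C' k = C k"
  shows "array_inversions n C' = array_inversions n C"
proof -
  have split: "array_inversions n D = (\<Sum>k<i. \<Sum>j<k. inversions (D j) (D k)) +
      ((\<Sum>j<i. inversions (D j) (D i) + inversions (D j) (D (Suc i))) + inversions (D i) (D (Suc i)) +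
       (\<Sum>k\<in>{Suc (Suc i)..<n}. (\<Sum>j<i. inversions (D j) (D k)) +
          (inversions (D i) (D k) + inversions (D (Suc i)) (D k)) +
          (\<Sum>j\<in>{Suc (Suc i)..<k}. inversions (D j) (D k))))" for D
  proof -
    have seg: "(\<Sum>k<m. h k) = (\<Sum>k<i. h k) + (h i + h (Suc i)) + (\<Sum>k\<in>{Suc (Suc i)..<m}. h k)"
      if "Suc (Suc i) \<le> m" for h :: "nat \<Rightarrow> nat" and m
    proof -
      have "(\<Sum>k<m. h k) = (\<Sum>k<Suc (Suc i). h k) + (\<Sum>k\<in>{Suc (Suc i)..<m}. h k)"
        using that by (metis lessThan_atLeast0 sum.atLeastLessThan_concat zero_le)
      then show ?thesis by simp
    qed
    have "array_inversions n D = (\<Sum>k<i. \<Sum>j<k. inversions (D j) (D k)) +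
      ((\<Sum>j<i. inversions (D j) (D i)) + (\<Sum>j<Suc i. inversions (D j) (D (Suc i)))) +
       (\<Sum>k\<in>{Suc (Suc i)..<n}. \<Sum>j<k. inversions (D j) (D k))"
      unfolding array_inversions_def using seg[of n] assms(1) by simp
    also have "(\<Sum>k\<in>{Suc (Suc i)..<n}. \<Sum>j<k. inversions (D j) (D k)) =
      (\<Sum>k\<in>{Suc (Suc i)..<n}. (\<Sum>j<i. inversions (D j) (D k)) +
          (inversions (D i) (D k) + inversions (D (Suc i)) (D k)) +
          (\<Sum>j\<in>{Suc (Suc i)..<k}. inversions (D j) (D k)))"
      by (rule sum.cong[OF refl]) (rule seg, simp)
    finally show ?thesis by (simp add: sum.distrib)
  qed
  have o: "C' k = C k" if "k < i \<or> Suc (Suc i) \<le> k" for k using other[of k] that by auto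
  have right: "inversions (C k) (C' i) + inversions (C k) (C' (Suc i)) =
      inversions (C k) (C i) + inversions (C k) (C (Suc i))" for k
    by (rule inversions_add_right) (use assms fin in auto)
  have left: "inversions (C' i) (C k) + inversions (C' (Suc i)) (C k) =
      inversions (C i) (C k) + inversions (C (Suc i)) (C k)" for k
    by (rule inversions_add_left) (use assms fin in auto)
  have t1: "(\<Sum>k<i. \<Sum>j<k. inversions (C' j) (C' k)) = (\<Sum>k<i. \<Sum>j<k. inversions (C j) (C k))"
    by (intro sum.cong refl) (simp add: o)
  have t2: "(\<Sum>j<i. inversions (C' j) (C' i) + inversions (C' j) (C' (Suc i))) =
      (\<Sum>j<i. inversions (C j) (C i) + inversions (C j) (C (Suc i)))"
    by (rule sum.cong[OF refl]) (simp only: o right lessThan_iff simp_thms)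
  have t3: "(\<Sum>j<i. inversions (C' j) (C' k)) + (inversions (C' i) (C' k) + inversions (C' (Suc i)) (C' k)) +
          (\<Sum>j\<in>{Suc (Suc i)..<k}. inversions (C' j) (C' k)) =
      (\<Sum>j<i. inversions (C j) (C k)) + (inversions (C i) (C k) + inversions (C (Suc i)) (C k)) +
          (\<Sum>j\<in>{Suc (Suc i)..<k}. inversions (C j) (C k))" if "k \<in> {Suc (Suc i)..<n}" for k
  proof -
    have "C' k = C k" using that o by simp
    then show ?thesis using o by (simp add: left)
  qed
  show ?thesis unfolding split[of C'] split[of C] inv t1 t2 by (simp only: t3 cong: sum.cong)
qed

lemma separatedD:
  assumes "separated Y i C"
  shows "\<forall>h\<in>(C i \<union> C (Suc i)) - Y. \<forall>t\<in>(C i \<union> C (Suc i)) \<inter> Y. \<not> incomp h t"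
    and "\<forall>h\<in>(C (Suc i) \<union> C i) - Y. \<forall>t\<in>(C (Suc i) \<union> C i) \<inter> Y. \<not> incomp h t"
  using assms by (auto simp: separated_def)

lemma swap_rows:
  assumes C: "C \<in> arrays n" and i: "Suc i < n" and sep: "separated Y i C"
  shows "swap_rows Y i C \<in> arrays n"
    and "array_inversions n (swap_rows Y i C) = array_inversions n C"
    and "separated Y i (swap_rows Y i C)"
    and "swap_rows Y i (swap_rows Y i C) = C"
    and "card (swap_rows Y i C i) = card (C i - Y) + card (C (Suc i) \<inter> Y)"
    and "card (swap_rows Y i C (Suc i)) = card (C (Suc i) - Y) + card (C i \<inter> Y)"
proof -
  have chains: "chain (C k)" for k using C by (auto simp: arrays_def)
  let ?C = "swap_rows Y i C"
  have un: "?C i \<union> ?C (Suc i) = C i \<union> C (Suc i)"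
    by (simp add: swap_rows_def swap_components_Un)
  have int: "?C i \<inter> ?C (Suc i) = C i \<inter> C (Suc i)"
    by (simp add: swap_rows_def swap_components_Int)
  have other: "?C k = C k" if "k \<noteq> i" "k \<noteq> Suc i" for k using that by (simp add: swap_rows_def)
  have "chain (?C k)" for k
    using swap_components_chain[OF chains chains separatedD(1)[OF sep]]
      swap_components_chain[OF chains chains separatedD(2)[OF sep]] chains
    by (simp add: swap_rows_def)
  moreover have "(\<Union>k. ?C k) = (\<Union>k. C k)"
  proof -
    have "(\<Union>k. D k) = (\<Union>k\<in>- {i, Suc i}. D k) \<union> (D i \<union> D (Suc i))" for D :: "nat \<Rightarrow> nat set" by auto
    moreover have "(\<Union>k\<in>- {i, Suc i}. ?C k) = (\<Union>k\<in>- {i, Suc i}. C k)" using other by auto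
    ultimately show ?thesis using un by metis
  qed
  ultimately show "?C \<in> arrays n" using C i other by (simp add: arrays_def)
  show "array_inversions n ?C = array_inversions n C"
    by (rule array_inversions_two_rows[OF i _ un int _ other])
      (use chains chain_finite inversions_swap_components[OF chains chains separatedD(1)[OF sep]]
        in \<open>auto simp: swap_rows_def\<close>)
  show "separated Y i ?C" using sep unfolding separated_def un .
  show "swap_rows Y i ?C = C"
    using swap_components_involution[OF chains chains separatedD(1)[OF sep]]
      swap_components_involution[OF chains chains separatedD(2)[OF sep]]
    by (auto simp: swap_rows_def fun_eq_iff)
  show "card (?C i) = card (C i - Y) + card (C (Suc i) \<inter> Y)"
    "card (?C (Suc i)) = card (C (Suc i) - Y) + card (C i \<inter> Y)"
    using card_swap_components[OF chains chains separatedD(1)[OF sep]]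
      card_swap_components[OF chains chains separatedD(2)[OF sep]]
    by (simp_all add: swap_rows_def)
qed

text \<open>
  The uneven components of rows \<open>i\<close> and \<open>i + 1\<close> are exchanged everywhere.
\<close>

lemma array_count_symmetric:
  assumes i: "Suc i < n"
  shows "array_count n (\<gamma> \<circ> transpose i (Suc i)) = array_count n \<gamma>"
proof -
  have sep: "separated UNIV i C" for C by (simp add: separated_def)
  have card: "(\<forall>k<n. int (card (swap_rows UNIV i C k)) = (\<gamma> \<circ> transpose i (Suc i)) k)"
    if "C \<in> arrays n" "\<forall>k<n. int (card (C k)) = \<gamma> k" for C and \<gamma> :: "nat \<Rightarrow> int"
  proof (intro allI impI)
    fix k assume "k < n"
    show "int (card (swap_rows UNIV i C k)) = (\<gamma> \<circ> transpose i (Suc i)) k"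
      using swap_rows(5,6)[OF that(1) i sep] that(2) i \<open>k < n\<close>
      by (cases "k = i"; cases "k = Suc i") (auto simp: transpose_apply_other swap_rows_def)
  qed
  show ?thesis
    unfolding array_count_def
  proof (rule sum.reindex_bij_witness[where i = "swap_rows UNIV i" and j = "swap_rows UNIV i"], goal_cases)
    case (2 C)
    then show ?case using card[of C "\<gamma> \<circ> transpose i (Suc i)"] swap_rows(1)[OF _ i sep]
      by (simp add: comp_assoc)
  qed (use card swap_rows[OF _ i sep] in auto)
qed

section \<open>Flaws of an array\<close>

definition column :: "nat set \<Rightarrow> nat \<Rightarrow> nat" where
  "column D y = card {z \<in> D. z \<le> y}"

text \<open>
  The entry \<open>y\<close> in column \<open>j\<close> of the lower row \<open>E\<close> violates the column condition of a tableau, or stands below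
  an empty cell, exactly if the \<open>j\<close>-th element of the chain \<open>D\<close> is above \<open>y\<close> or missing. As the elements of \<open>D\<close>
  above \<open>y\<close> form a final segment, it suffices to count the others.
\<close>

definition flaw_at :: "nat set \<Rightarrow> nat set \<Rightarrow> nat \<Rightarrow> nat \<Rightarrow> bool" where
  "flaw_at D E j y \<longleftrightarrow> y \<in> E \<and> column E y = j \<and> card {x \<in> D. \<not> below y x} < j"

definition unflawed :: "(nat \<Rightarrow> nat set) \<Rightarrow> bool" where
  "unflawed C \<longleftrightarrow> (\<forall>i j y. \<not> flaw_at (C i) (C (Suc i)) j y)"

text \<open>
  The flaw in the first possible column \<open>j\<close> and, in this column, the last possible row \<open>i\<close>. The
  last row is chosen because an exchange of the tails of rows \<open>i\<close> and \<open>i + 1\<close> can create flaws in column \<open>j\<close>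
  only between rows \<open>i - 1\<close> and \<open>i\<close>.
\<close>

definition pivot :: "(nat \<Rightarrow> nat set) \<Rightarrow> nat \<times> nat \<times> nat \<Rightarrow> bool" where
  "pivot C = (\<lambda>(j, i, y). flaw_at (C i) (C (Suc i)) j y \<and>
     (\<forall>j' k y'. flaw_at (C k) (C (Suc k)) j' y' \<longrightarrow> j < j' \<or> j = j' \<and> k \<le> i))"

lemma column_inject:
  assumes "finite D" "y \<in> D" "y' \<in> D" "column D y = column D y'"
  shows "y = y'"
proof (rule ccontr)
  assume "y \<noteq> y'"
  have "column D u < column D v" if "u < v" "v \<in> D" for u v
  proof -
    have "v \<in> {z \<in> D. z \<le> v}" "v \<notin> {z \<in> D. z \<le> u}" using that by auto
    moreover have "{z \<in> D. z \<le> u} \<subseteq> {z \<in> D. z \<le> v}" using that by auto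
    ultimately have "{z \<in> D. z \<le> u} \<subset> {z \<in> D. z \<le> v}" by blast
    then show ?thesis unfolding column_def using assms(1) by (intro psubset_card_mono) auto
  qed
  then show False using assms \<open>y \<noteq> y'\<close> by (metis less_irrefl linorder_neqE_nat)
qed

lemma flaw_at_row:
  assumes "C \<in> arrays n" "flaw_at (C i) (C (Suc i)) j y"
  shows "Suc i < n"
  using assms by (cases "Suc i < n") (auto simp: arrays_def flaw_at_def)

lemma pivot_exists:
  assumes "C \<in> arrays n" "\<not> unflawed C"
  shows "\<exists>p. pivot C p"
proof -
  let ?F = "\<lambda>j i. \<exists>y. flaw_at (C i) (C (Suc i)) j y"
  define j where "j = (LEAST j. \<exists>i. ?F j i)"
  have "\<exists>j i. ?F j i" using assms(2) by (auto simp: unflawed_def)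
  then have j: "\<exists>i. ?F j i" unfolding j_def by (rule LeastI_ex)
  have le: "j \<le> j'" if "?F j' k" for j' k unfolding j_def using that by (intro Least_le) blast
  have "{i. ?F j i} \<subseteq> {..<n}" using flaw_at_row[OF assms(1)] by fastforce
  then have fin: "finite {i. ?F j i}" by (rule finite_subset) simp
  have "{i. ?F j i} \<noteq> {}" using j by blast
  then have "Max {i. ?F j i} \<in> {i. ?F j i}" using fin by (intro Max_in)
  then obtain y where "flaw_at (C (Max {i. ?F j i})) (C (Suc (Max {i. ?F j i}))) j y" by blast
  moreover have "k \<le> Max {i. ?F j i}" if "?F j k" for k using that fin by (intro Max_ge) auto
  ultimately have "pivot C (j, Max {i. ?F j i}, y)" unfolding pivot_def using le le_neq_implies_less by blast
  then show ?thesis by blast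
qed

lemma pivot_unique:
  assumes "C \<in> arrays n" "pivot C p" "pivot C q"
  shows "p = q"
proof -
  obtain j i y j' i' y' where pq: "p = (j, i, y)" "q = (j', i', y')" by (metis prod_cases3)
  have a: "flaw_at (C i) (C (Suc i)) j y" "flaw_at (C i') (C (Suc i')) j' y'"
    using assms by (auto simp: pq pivot_def)
  have "j < j' \<or> j = j' \<and> i' \<le> i" using assms(2) a(2) unfolding pq pivot_def by blast
  moreover have "j' < j \<or> j' = j \<and> i \<le> i'" using assms(3) a(1) unfolding pq pivot_def by blast
  ultimately have e: "j = j'" "i = i'" by auto
  have fin: "finite (C (Suc i'))" using assms(1) chain_finite by (auto simp: arrays_def)
  have "y \<in> C (Suc i')" "y' \<in> C (Suc i')" "column (C (Suc i')) y = column (C (Suc i')) y'"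
    using a unfolding e flaw_at_def by simp_all
  then have "y = y'" by (rule column_inject[OF fin])
  then show ?thesis using e by (simp add: pq)
qed

text \<open>
  The last entry of a row that is longer than the row above it would be a flaw.
\<close>

lemma unflawed_antimono:
  assumes "C \<in> arrays n" "unflawed C"
  shows "(\<lambda>i. card (C i)) \<in> Par n"
proof (rule ParI)
  fix i
  have fin: "finite (C k)" for k using assms(1) chain_finite by (auto simp: arrays_def)
  show "card (C (Suc i)) \<le> card (C i)"
  proof (cases "C (Suc i) = {}")
    case False
    let ?y = "Max (C (Suc i))"
    have "{z \<in> C (Suc i). z \<le> ?y} = C (Suc i)" using fin by auto
    then have "column (C (Suc i)) ?y = card (C (Suc i))" by (simp only: column_def)
    moreover have "?y \<in> C (Suc i)" using False fin by simp
    moreover have "\<not> flaw_at (C i) (C (Suc i)) (card (C (Suc i))) ?y"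
      using assms(2) by (simp add: unflawed_def)
    ultimately have "card (C (Suc i)) \<le> card {x \<in> C i. \<not> below ?y x}"
      unfolding flaw_at_def by (simp only: simp_thms not_less)
    also have "\<dots> \<le> card (C i)" using fin by (intro card_mono) auto
    finally show ?thesis .
  qed simp
qed (use assms(1) in \<open>auto simp: arrays_def\<close>)

lemma chain_column_less:
  assumes "chain B" "y \<in> B"
  shows "B - {x. below y x} = {z \<in> B. z \<le> y}"
  using chain_below[OF assms(1,2)] below_less by force

lemma pred_column:
  assumes "finite B" "y \<in> B" "column B y = Suc (Suc m)"
  shows "\<exists>y'\<in>B. y' < y \<and> column B y' = Suc m"
proof -
  let ?S = "{z \<in> B. z < y}"
  have "{z \<in> B. z \<le> y} = insert y ?S" using assms(2) by auto
  then have c: "card ?S = Suc m" using assms(1,3) by (simp add: column_def)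
  then have ne: "?S \<noteq> {}" by (metis card.empty nat.distinct(1))
  have fin: "finite ?S" using assms(1) by simp
  have M: "Max ?S \<in> ?S" using fin ne by (rule Max_in)
  have "{z \<in> B. z \<le> Max ?S} = ?S"
  proof (intro equalityI subsetI)
    fix z assume "z \<in> ?S"
    then show "z \<in> {z \<in> B. z \<le> Max ?S}" using fin by simp
  qed (use M in auto)
  then show ?thesis using M c by (intro bexI[of _ "Max ?S"]) (auto simp: column_def)
qed

text \<open>
  Let \<open>Y\<close> be the set of elements above the pivot \<open>y\<close>. The tails consist of the elements of the two rows in \<open>Y\<close>.
  If \<open>j > 1\<close>, then the predecessor \<open>y'\<close> of \<open>y\<close> in its row is not a flaw, so row \<open>i\<close> has exactly \<open>j - 1\<close> elements that are not
  above \<open>y\<close>, and these are also not above \<open>y'\<close>. Suppose such an element \<open>h\<close> is incomparable to an element \<open>t\<close> of a tail.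
  Then \<open>h\<close> is incomparable to \<open>y'\<close> and \<open>y\<close> as well. From the pair \<open>y'\<close>, \<open>y\<close> it follows that \<open>h < y\<close>, but from
  the pair \<open>y\<close>, \<open>t\<close> that \<open>y < h\<close>.
\<close>

lemma pivot_heads_below_tails:
  assumes C: "C \<in> arrays n" and piv: "pivot C (j, i, y)"
  defines "Y \<equiv> {x. below y x}"
  shows "card (C i - Y) = j - 1" and "card (C (Suc i) - Y) = j" and "0 < j"
    and "\<And>h t. h \<in> (C i \<union> C (Suc i)) - Y \<Longrightarrow> t \<in> (C i \<union> C (Suc i)) \<inter> Y \<Longrightarrow> below h t"
proof -
  have chains: "chain (C k)" for k using C by (auto simp: arrays_def)
  have fin: "finite (C k)" for k using chains chain_finite by blast
  have fl: "y \<in> C (Suc i)" "column (C (Suc i)) y = j" "card {x \<in> C i. \<not> below y x} < j"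
    using piv by (auto simp: pivot_def flaw_at_def)
  have noflaw: "\<not> flaw_at (C k) (C (Suc k)) j' y'" if "j' < j" for k j' y'
  proof
    assume "flaw_at (C k) (C (Suc k)) j' y'"
    then have "j < j' \<or> j = j' \<and> k \<le> i" using piv unfolding pivot_def by blast
    then show False using that by auto
  qed
  have headA: "C i - Y = {x \<in> C i. \<not> below y x}" by (auto simp: Y_def)
  have headB: "C (Suc i) - Y = {z \<in> C (Suc i). z \<le> y}"
    unfolding Y_def by (rule chain_column_less[OF chains fl(1)])
  show cB: "card (C (Suc i) - Y) = j" using fl(2) headB by (simp add: column_def)
  show "0 < j" using fl(3) by simp
  have "y \<in> C (Suc i) - Y" using fl(1) headB by simp
  have prev: "\<exists>y'\<in>C (Suc i). below y' y \<and> {x \<in> C i. \<not> below y' x} = C i - Y \<and> card (C i - Y) = j - 1"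
    if j1: "1 < j"
  proof -
    obtain m where m: "j = Suc (Suc m)" using less_imp_Suc_add[OF j1] by auto
    obtain y' where y': "y' \<in> C (Suc i)" "y' < y" "column (C (Suc i)) y' = Suc m"
      using pred_column[OF fin fl(1)] fl(2) m by blast
    have b: "below y' y" using chain_below[OF chains y'(1) fl(1) y'(2)] .
    have sub: "{x \<in> C i. \<not> below y' x} \<subseteq> C i - Y" using below_trans[OF b] by (auto simp: Y_def)
    have "Suc m \<le> card {x \<in> C i. \<not> below y' x}"
      using noflaw[of "Suc m" i y'] y'(1,3) m unfolding flaw_at_def by (simp only: simp_thms not_less lessI)
    moreover have "card (C i - Y) \<le> Suc m" using fl(3) headA m by simp
    moreover have "card {x \<in> C i. \<not> below y' x} \<le> card (C i - Y)" using sub fin by (intro card_mono) auto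
    ultimately have "card {x \<in> C i. \<not> below y' x} = card (C i - Y)" "card (C i - Y) = j - 1"
      using m by auto
    moreover have "{x \<in> C i. \<not> below y' x} = C i - Y"
      using sub calculation(1) fin by (intro card_subset_eq) auto
    ultimately show ?thesis using y'(1) b by blast
  qed
  show cA: "card (C i - Y) = j - 1"
  proof (cases "1 < j")
    case False
    then show ?thesis using fl(3) headA by simp
  qed (use prev in blast)
  fix h t assume h: "h \<in> (C i \<union> C (Suc i)) - Y" and t: "t \<in> (C i \<union> C (Suc i)) \<inter> Y"
  have yt: "below y t" using t by (simp add: Y_def)
  have inP: "h \<in> P" "t \<in> P" "y \<in> P" using h t fl(1) chains by (auto simp: chain_def)
  have "h \<noteq> t" using h t by blast
  have nth: "\<not> below t h" using below_trans[OF yt] h by (auto simp: Y_def)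
  show "below h t"
  proof (cases "h \<in> C (Suc i)")
    case True
    then have "h \<le> y" using h headB by blast
    then have "h = y \<or> below h y" using chain_below[OF chains True fl(1)] by (cases "h < y") auto
    then show ?thesis using yt below_trans by blast
  next
    case False
    then have hA: "h \<in> C i - Y" using h by blast
    then have "card (C i - Y) \<noteq> 0" using fin by auto
    then have "1 < j" using cA by simp
    then obtain y' where y': "y' \<in> C (Suc i)" "below y' y" "{x \<in> C i. \<not> below y' x} = C i - Y"
      using prev by blast
    have nh: "\<not> below y' h" using hA y'(3) by blast
    have y't: "below y' t" using below_trans[OF y'(2) yt] .
    show ?thesis
    proof (rule ccontr)
      assume "\<not> below h t"
      then have ht: "incomp h t" using incomp_iff inP \<open>h \<noteq> t\<close> nth by blast
      have hy: "\<not> below h y" using below_trans yt \<open>\<not> below h t\<close> by blast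
      have hy': "\<not> below h y'" using below_trans y't \<open>\<not> below h t\<close> by blast
      have "h \<noteq> y'" using y't \<open>\<not> below h t\<close> by blast
      then have "incomp h y'" using incomp_iff inP nh hy' below_in_P[OF y't] by blast
      have "h \<noteq> y" using yt \<open>\<not> below h t\<close> by blast
      moreover have "\<not> below y h" using h by (simp add: Y_def)
      ultimately have "incomp h y" using incomp_iff inP hy by blast
      have "h < y"
        using incomp_between[OF y'(2) incomp_sym[OF \<open>incomp h y'\<close>] \<open>incomp h y\<close>] by simp
      moreover have "y < h" using incomp_between[OF yt incomp_sym[OF \<open>incomp h y\<close>] ht] by simp
      ultimately show False by simp
    qed
  qed
qed

section \<open>The sign-reversing involution\<close>

lemma column_head:
  assumes "y \<in> E - Y" "\<And>h t. h \<in> E - Y \<Longrightarrow> t \<in> E \<inter> Y \<Longrightarrow> h < t"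
  shows "column E y = card {z \<in> E - Y. z \<le> y}"
proof -
  have "\<not> z \<le> y" if "z \<in> E \<inter> Y" for z using assms(2)[OF assms(1) that] by simp
  then have "{z \<in> E. z \<le> y} = {z \<in> E - Y. z \<le> y}" by blast
  then show ?thesis by (simp add: column_def)
qed

lemma column_tail:
  assumes "finite E" "y \<in> E \<inter> Y" "\<And>h t. h \<in> E - Y \<Longrightarrow> t \<in> E \<inter> Y \<Longrightarrow> h < t"
  shows "card (E - Y) < column E y"
  unfolding column_def
proof (rule psubset_card_mono)
  have "h \<le> y" if "h \<in> E - Y" for h using assms(3)[OF that assms(2)] by simp
  then have "E - Y \<subseteq> {z \<in> E. z \<le> y}" by blast
  moreover have "y \<in> {z \<in> E. z \<le> y}" "y \<notin> E - Y" using assms(2) by auto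
  ultimately show "E - Y \<subset> {z \<in> E. z \<le> y}" by blast
qed (use assms(1) in simp)

text \<open>
  The first \<open>j\<close> columns of a row are determined by its head if the head has at least \<open>j\<close> elements.
\<close>

lemma column_in_head:
  assumes "finite E" "finite E'" "E' - Y = E - Y"
    and "\<And>h t. h \<in> E - Y \<Longrightarrow> t \<in> E \<inter> Y \<Longrightarrow> h < t"
    and "\<And>h t. h \<in> E' - Y \<Longrightarrow> t \<in> E' \<inter> Y \<Longrightarrow> h < t"
    and "j \<le> card (E - Y)"
  shows "y \<in> E \<and> column E y = j \<longleftrightarrow> y \<in> E - Y \<and> column E y = j"
    and "y \<in> E' \<and> column E' y = j \<longleftrightarrow> y \<in> E - Y \<and> column E y = j"
proof -
  show "y \<in> E \<and> column E y = j \<longleftrightarrow> y \<in> E - Y \<and> column E y = j"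
    using column_tail[OF assms(1) _ assms(4)] assms(6) by fastforce
  have "y \<in> E' \<and> column E' y = j \<longleftrightarrow> y \<in> E' - Y \<and> column E' y = j"
    using column_tail[OF assms(2) _ assms(5)] assms(6) unfolding assms(3)[symmetric] by fastforce
  moreover have "column E' y = column E y" if "y \<in> E - Y"
    using column_head[OF that assms(4)] column_head[of y E' Y] that assms(3,5) by simp
  ultimately show "y \<in> E' \<and> column E' y = j \<longleftrightarrow> y \<in> E - Y \<and> column E y = j"
    using assms(3) by auto
qed

lemma not_below_in_head:
  assumes "finite D" "\<And>h t. h \<in> D - Y \<Longrightarrow> t \<in> D \<inter> Y \<Longrightarrow> below h t"
    and "j \<le> card (D - Y)" "card {x \<in> D - Y. \<not> below y x} < j"
  shows "{x \<in> D. \<not> below y x} = {x \<in> D - Y. \<not> below y x}"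
proof -
  have "{x \<in> D - Y. \<not> below y x} \<noteq> D - Y" using assms(3,4) by auto
  then obtain h where h: "h \<in> D - Y" "below y h" by blast
  have "below y t" if "t \<in> D \<inter> Y" for t using below_trans[OF h(2) assms(2)[OF h(1) that]] .
  then show ?thesis by blast
qed

text \<open>
  Whether an entry in one of the first \<open>j\<close> columns has a flaw with the row above is determined by the head
  of that row if it has at least \<open>j\<close> elements: if some element of the head is above \<open>y\<close>, then so is the tail.
\<close>

lemma not_below_card_cong:
  assumes "finite D" "finite D'" "D' - Y = D - Y"
    and "\<And>h t. h \<in> D - Y \<Longrightarrow> t \<in> D \<inter> Y \<Longrightarrow> below h t"
    and "\<And>h t. h \<in> D' - Y \<Longrightarrow> t \<in> D' \<inter> Y \<Longrightarrow> below h t"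
    and "j \<le> card (D - Y)"
  shows "card {x \<in> D. \<not> below y x} < j \<longleftrightarrow> card {x \<in> D'. \<not> below y x} < j"
proof -
  have one: "card {x \<in> F. \<not> below y x} < j \<longleftrightarrow> card {x \<in> F - Y. \<not> below y x} < j"
    if "finite F" "\<And>h t. h \<in> F - Y \<Longrightarrow> t \<in> F \<inter> Y \<Longrightarrow> below h t" "j \<le> card (F - Y)" for F
  proof
    assume "card {x \<in> F. \<not> below y x} < j"
    moreover have "card {x \<in> F - Y. \<not> below y x} \<le> card {x \<in> F. \<not> below y x}"
      using that(1) by (intro card_mono) auto
    ultimately show "card {x \<in> F - Y. \<not> below y x} < j" by simp
  next
    assume *: "card {x \<in> F - Y. \<not> below y x} < j"
    then show "card {x \<in> F. \<not> below y x} < j" using not_below_in_head[OF that *] by simp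
  qed
  have "card {x \<in> D'. \<not> below y x} < j \<longleftrightarrow> card {x \<in> D' - Y. \<not> below y x} < j"
    by (rule one[OF assms(2,5)]) (simp_all add: assms(3,6))
  then show ?thesis using one[OF assms(1,4,6)] by (simp only: assms(3))
qed

lemma swap_rows_outside:
  "swap_rows Y i C i - Y = C i - Y" "swap_rows Y i C (Suc i) - Y = C (Suc i) - Y"
  by (simp_all add: swap_rows_def swap_components_outside)

lemma swap_rows_Un: "swap_rows Y i C i \<union> swap_rows Y i C (Suc i) = C i \<union> C (Suc i)"
  by (simp add: swap_rows_def swap_components_Un)

text \<open>
  The exchange only changes the tails, which start in column \<open>j\<close> of row \<open>i\<close> and in column \<open>j + 1\<close> of row
  \<open>i + 1\<close>. So it affects no flaw in a column before \<open>j\<close>, and in column \<open>j\<close> none from row \<open>i\<close> on. The pivot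
  stays the pivot, and repeating the exchange undoes it.
\<close>

lemma pivot_swap_rows:
  assumes C: "C \<in> arrays n" and piv: "pivot C (j, i, y)"
  defines "Y \<equiv> {x. below y x}"
  shows "separated Y i C" and "pivot (swap_rows Y i C) (j, i, y)"
proof -
  let ?C = "swap_rows Y i C"
  note heads = pivot_heads_below_tails[OF C piv, folded Y_def]
  show sep: "separated Y i C"
    unfolding separated_def using heads(4) incomp_not_below by blast
  have i: "Suc i < n" using piv flaw_at_row[OF C, of i j y] by (simp add: pivot_def)
  have C': "?C \<in> arrays n" by (rule swap_rows(1)[OF C i sep])
  have fin: "finite (C k)" "finite (?C k)" for k using C C' chain_finite by (auto simp: arrays_def)
  have heads': "below h t" if "h \<in> (?C i \<union> ?C (Suc i)) - Y" "t \<in> (?C i \<union> ?C (Suc i)) \<inter> Y" for h t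
    using heads(4) that unfolding swap_rows_Un by blast
  have other: "?C k = C k" if "k \<noteq> i" "k \<noteq> Suc i" for k using that by (simp add: swap_rows_def)
  have y: "y \<in> C (Suc i) - Y"
    using piv below_less by (auto simp: pivot_def flaw_at_def Y_def)
  have y_head: "z = y \<or> below z y" if "z \<in> C (Suc i) - Y" for z
  proof -
    have "chain (C (Suc i))" using C by (simp add: arrays_def)
    then show ?thesis using chain_below[of "C (Suc i)" z y] chain_below[of "C (Suc i)" y z] that y
      by (cases z y rule: linorder_cases) (auto simp: Y_def)
  qed
  have second: "z \<in> ?C (Suc i) \<and> column (?C (Suc i)) z = j' \<longleftrightarrow> z \<in> C (Suc i) - Y \<and> column (C (Suc i)) z = j'"
      "z \<in> C (Suc i) \<and> column (C (Suc i)) z = j' \<longleftrightarrow> z \<in> C (Suc i) - Y \<and> column (C (Suc i)) z = j'"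
    if "j' \<le> j" for z j'
    using column_in_head[OF fin(1) fin(2) swap_rows_outside(2)[of Y i C], where j = j' and y = z]
      heads(2,4) heads' below_less that by blast+
  have first: "z \<in> ?C i \<and> column (?C i) z = j' \<longleftrightarrow> z \<in> C i - Y \<and> column (C i) z = j'"
      "z \<in> C i \<and> column (C i) z = j' \<longleftrightarrow> z \<in> C i - Y \<and> column (C i) z = j'"
    if "j' < j" for z j'
    using column_in_head[OF fin(1) fin(2) swap_rows_outside(1)[of Y i C], where j = j' and y = z]
      heads(1,4) heads' below_less that by fastforce+
  have eqv: "flaw_at (?C k) (?C (Suc k)) j' z \<longleftrightarrow> flaw_at (C k) (C (Suc k)) j' z"
    if jk: "j' < j \<or> j' = j \<and> i \<le> k" for j' k z
  proof -
    consider "k = i" | "k = Suc i" | "Suc k = i" | "k \<noteq> i" "k \<noteq> Suc i" "Suc k \<noteq> i" by blast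
    then show ?thesis
    proof cases
      case 1
      have "{x \<in> ?C i. \<not> below z x} = {x \<in> C i. \<not> below z x}" if z: "z \<in> C (Suc i) - Y"
      proof -
        have "below z t" if "t \<in> Y" for t
          using y_head[OF z] that below_trans by (auto simp: Y_def)
        then have "{x \<in> F. \<not> below z x} = {x \<in> F - Y. \<not> below z x}" for F by blast
        then show ?thesis using swap_rows_outside(1)[of Y i C] by metis
      qed
      then show ?thesis using second[of j' z] jk 1 unfolding flaw_at_def by auto
    next
      case 2
      have "card {x \<in> C (Suc i). \<not> below z x} < j' \<longleftrightarrow> card {x \<in> ?C (Suc i). \<not> below z x} < j'"
        by (rule not_below_card_cong[OF fin(1) fin(2) swap_rows_outside(2)])
          (use heads(2,4) heads' jk in auto)
      then show ?thesis using 2 other[of "Suc (Suc i)"] by (simp add: flaw_at_def)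
    next
      case 3
      then have "j' < j" using jk by auto
      then show ?thesis using first[of j' z] 3 other[of k] by (auto simp: flaw_at_def)
    next
      case 4
      then show ?thesis using other[of k] other[of "Suc k"] by simp
    qed
  qed
  show "pivot ?C (j, i, y)"
    unfolding pivot_def prod.case
  proof (intro conjI allI impI)
    show "flaw_at (?C i) (?C (Suc i)) j y" using eqv[of j i y] piv by (simp add: pivot_def)
    fix j' k z assume f: "flaw_at (?C k) (?C (Suc k)) j' z"
    show "j < j' \<or> j = j' \<and> k \<le> i"
    proof (rule ccontr)
      assume no: "\<not> ?thesis"
      then have "j' < j \<or> j' = j \<and> i \<le> k" by auto
      then have "flaw_at (C k) (C (Suc k)) j' z" using eqv f by blast
      then show False using piv no unfolding pivot_def by blast
    qed
  qed
qed

definition swap_at_pivot :: "(nat \<Rightarrow> nat) \<times> (nat \<Rightarrow> nat set) \<Rightarrow> (nat \<Rightarrow> nat) \<times> (nat \<Rightarrow> nat set)" where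
  "swap_at_pivot = (\<lambda>(\<sigma>, C). case (SOME p. pivot C p) of (j, i, y) \<Rightarrow>
     (\<sigma> \<circ> transpose i (Suc i), swap_rows {x. below y x} i C))"

lemma swap_at_pivot_eq:
  assumes "C \<in> arrays n" "pivot C (j, i, y)"
  shows "swap_at_pivot (\<sigma>, C) = (\<sigma> \<circ> transpose i (Suc i), swap_rows {x. below y x} i C)"
proof -
  have "(SOME p. pivot C p) = (j, i, y)"
    using pivot_unique[OF assms(1)] assms(2) by (metis someI)
  then show ?thesis by (simp add: swap_at_pivot_def)
qed

text \<open>
  The exchange at the pivot turns the lengths of rows \<open>i\<close> and \<open>i + 1\<close> from \<open>a\<close> and \<open>b\<close> into \<open>b - 1\<close> and
  \<open>a + 1\<close>. After adding \<open>\<delta>\<close> the two lengths are interchanged, which amounts to composing \<open>\<sigma>\<close> with a transposition.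
  An array without flaws has a partition as its shape, and then \<open>\<sigma>\<close> must be the identity.
\<close>

lemma alternation_array_count:
  assumes \<mu>: "\<mu> \<in> Par n"
  shows "alternation n (array_count n) (\<lambda>i. int (\<mu> i) + (int n - 1 - int i)) =
    (\<Sum>C | C \<in> {C \<in> arrays n. unflawed C} \<and> (\<lambda>i. card (C i)) = \<mu>. monom 1 (array_inversions n C))"
proof -
  define l where "l i = int (\<mu> i) + (int n - 1 - int i)" for i
  define T where "T \<sigma> = {C \<in> arrays n. \<forall>i<n. int (card (C i)) = l (\<sigma> i) - (int n - 1 - int i)}" for \<sigma>
  define S where "S = (SIGMA \<sigma>:{\<sigma>. \<sigma> permutes {..<n}}. T \<sigma>)"
  define f :: "(nat \<Rightarrow> nat) \<times> (nat \<Rightarrow> nat set) \<Rightarrow> int poly"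
    where "f = (\<lambda>(\<sigma>, C). of_int (sign \<sigma>) * monom 1 (array_inversions n C))"
  have finS: "finite S"
    unfolding S_def T_def using finite_arrays by (intro finite_SigmaI) (auto simp: finite_permutations)
  have "alternation n (array_count n) l = sum f S"
    unfolding alternation_def array_count_def S_def f_def T_def sum_distrib_left
    by (subst sum.Sigma) (auto simp: finite_permutations finite_arrays)
  also have "\<dots> = sum f {p \<in> S. unflawed (snd p)} + sum f {p \<in> S. \<not> unflawed (snd p)}"
    using finS by (subst sum.union_disjoint[symmetric]) (auto intro!: sum.cong)
  also have "sum f {p \<in> S. \<not> unflawed (snd p)} = 0"
  proof -
    have step: "swap_at_pivot p \<in> {p \<in> S. \<not> unflawed (snd p)} \<and> swap_at_pivot (swap_at_pivot p) = p \<and>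
        f (swap_at_pivot p) = - f p" if pS: "p \<in> {p \<in> S. \<not> unflawed (snd p)}" for p
    proof -
      obtain \<sigma> C where p: "p = (\<sigma>, C)" by (cases p)
      have \<sigma>: "\<sigma> permutes {..<n}" and C: "C \<in> arrays n" and nf: "\<not> unflawed C"
        and c: "\<And>k. k < n \<Longrightarrow> int (card (C k)) = l (\<sigma> k) - (int n - 1 - int k)"
        using pS by (auto simp: p S_def T_def)
      obtain j i y where piv: "pivot C (j, i, y)" using pivot_exists[OF C nf] by (metis prod_cases3)
      let ?Y = "{x. below y x}"
      let ?C = "swap_rows ?Y i C" and ?\<sigma> = "\<sigma> \<circ> transpose i (Suc i)"
      have i: "Suc i < n" using piv flaw_at_row[OF C, of i j y] by (simp add: pivot_def)
      have sep: "separated ?Y i C" and piv': "pivot ?C (j, i, y)" using pivot_swap_rows[OF C piv] by auto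
      note sw = swap_rows[OF C i sep]
      note heads = pivot_heads_below_tails[OF C piv]
      have psi: "swap_at_pivot p = (?\<sigma>, ?C)" unfolding p by (rule swap_at_pivot_eq[OF C piv])
      have psi2: "swap_at_pivot (?\<sigma>, ?C) = (\<sigma>, C)"
        unfolding swap_at_pivot_eq[OF sw(1) piv'] sw(4) by (simp add: comp_assoc)
      have \<sigma>': "?\<sigma> permutes {..<n}" using permutes_compose_transpose[OF \<sigma>] i by simp
      have fin: "finite (C k)" for k using C chain_finite by (auto simp: arrays_def)
      have part: "card (C k) = card (C k - ?Y) + card (C k \<inter> ?Y)" for k
        using card_Int_Diff[OF fin, of k ?Y] by simp
      have "int (card (?C k)) = l (?\<sigma> k) - (int n - 1 - int k)" if "k < n" for k
      proof -
        consider "k = i" | "k = Suc i" | "k \<noteq> i" "k \<noteq> Suc i" by blast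
        then show ?thesis
        proof cases
          case 1
          have "int (card (?C i)) = int (card (C (Suc i))) - 1"
            using sw(5) heads(1,2,3) part[of "Suc i"] by simp
          then show ?thesis using 1 c[OF i] by simp
        next
          case 2
          have "int (card (?C (Suc i))) = int (card (C i)) + 1"
            using sw(6) heads(1,2,3) part[of i] by simp
          then show ?thesis using 2 c[of i] i by simp
        next
          case 3
          then show ?thesis using c[OF that] by (simp add: swap_rows_def transpose_apply_other)
        qed
      qed
      moreover have "\<not> unflawed ?C" using piv' by (auto simp: pivot_def unflawed_def)
      ultimately have "swap_at_pivot p \<in> {p \<in> S. \<not> unflawed (snd p)}"
        unfolding psi using sw(1) \<sigma>' by (simp add: S_def T_def)
      moreover have "f (swap_at_pivot p) = - f p"
        unfolding psi unfolding p f_def using sw(2) sign_compose_transpose[OF \<sigma>, of i "Suc i"] by simp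
      moreover have "swap_at_pivot (swap_at_pivot p) = p" unfolding psi psi2 by (simp only: p)
      ultimately show ?thesis by blast
    qed
    show ?thesis by (rule sum_involution_zero[where h = swap_at_pivot]) (use step in blast)+
  qed
  also have "sum f {p \<in> S. unflawed (snd p)} =
      (\<Sum>C | C \<in> {C \<in> arrays n. unflawed C} \<and> (\<lambda>i. card (C i)) = \<mu>. monom 1 (array_inversions n C))"
  proof -
    have id: "\<sigma> = id" if "(\<sigma>, C) \<in> S" "unflawed C" for \<sigma> C
    proof (rule ccontr)
      assume "\<sigma> \<noteq> id"
      have \<sigma>: "\<sigma> permutes {..<n}" and C: "C \<in> arrays n"
        and c: "\<And>k. k < n \<Longrightarrow> int (card (C k)) = l (\<sigma> k) - (int n - 1 - int k)"
        using that by (auto simp: S_def T_def)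
      obtain i where i: "Suc i < n" "\<sigma> (Suc i) < \<sigma> i" using permutes_descent[OF \<sigma> \<open>\<sigma> \<noteq> id\<close>] by blast
      have "card (C (Suc i)) \<le> card (C i)" using Par_mono[OF unflawed_antimono[OF C that(2)], of i "Suc i"] by simp
      moreover have "l (\<sigma> i) < l (\<sigma> (Suc i))" using Par_mono[OF \<mu>, of "\<sigma> (Suc i)" "\<sigma> i"] i by (simp add: l_def)
      ultimately show False using c[of i] c[of "Suc i"] i by simp
    qed
    have T_id: "C \<in> T id \<longleftrightarrow> C \<in> arrays n \<and> (\<lambda>i. card (C i)) = \<mu>" for C
    proof -
      have out: "card (C k) = \<mu> k" if "C \<in> arrays n" "n \<le> k" for k
        using that Par_zero[OF \<mu>, of k] by (simp add: arrays_def)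
      have "(\<forall>k<n. int (card (C k)) = l (id k) - (int n - 1 - int k)) \<longleftrightarrow> (\<forall>k<n. card (C k) = \<mu> k)"
        by (simp add: l_def)
      also have "\<dots> \<longleftrightarrow> (\<lambda>i. card (C i)) = \<mu>" if "C \<in> arrays n"
        using out[OF that] by (auto simp: fun_eq_iff) (meson not_le)
      finally show ?thesis unfolding T_def by blast
    qed
    have "{p \<in> S. unflawed (snd p)} = Pair (id :: nat \<Rightarrow> nat) ` {C. C \<in> {C \<in> arrays n. unflawed C} \<and> (\<lambda>i. card (C i)) = \<mu>}"
      (is "?L = ?I ` ?R")
    proof (intro equalityI subsetI)
      fix p assume "p \<in> ?L"
      moreover obtain \<sigma> C where "p = (\<sigma>, C)" by (cases p)
      ultimately show "p \<in> ?I ` ?R" using id[of \<sigma> C] T_id[of C] by (auto simp: S_def)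
    next
      fix p assume "p \<in> ?I ` ?R"
      then obtain C where "p = (id, C)" "C \<in> ?R" by blast
      then show "p \<in> ?L" using T_id[of C] permutes_id by (auto simp: S_def)
    qed
    then have "sum f ?L = sum f (?I ` ?R)" by (rule arg_cong)
    also have "\<dots> = sum (f \<circ> ?I) ?R" by (rule sum.reindex) (simp add: inj_on_def)
    finally show ?thesis by (simp add: f_def sign_id comp_def)
  qed
  finally show ?thesis by (simp add: l_def[abs_def])
qed

text \<open>
  The Schur expansion of the generating function of the arrays.
\<close>

theorem array_count_eq_kostka_sum:
  "array_count n \<gamma> = (\<Sum>C\<in>{C \<in> arrays n. unflawed C}.
     monom 1 (array_inversions n C) * kostka n (\<lambda>i. card (C i)) \<gamma>)"
proof (rule symmetric_eq_kostka_sum[of n "array_count n"])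
  fix \<gamma> \<gamma>' :: "nat \<Rightarrow> int" assume "\<And>i. i < n \<Longrightarrow> \<gamma> i = \<gamma>' i"
  then show "array_count n \<gamma> = array_count n \<gamma>'" by (rule array_count_cong)
next
  fix \<gamma> :: "nat \<Rightarrow> int" and i assume "i < n" "\<gamma> i < 0"
  then show "array_count n \<gamma> = 0" by (rule array_count_negative)
next
  fix \<gamma> :: "nat \<Rightarrow> int" and i assume "Suc i < n"
  then show "array_count n (\<gamma> \<circ> transpose i (Suc i)) = array_count n \<gamma>" by (rule array_count_symmetric)
next
  show "finite {C \<in> arrays n. unflawed C}" using finite_arrays by simp
next
  fix C assume "C \<in> {C \<in> arrays n. unflawed C}"
  then show "(\<lambda>i. card (C i)) \<in> Par n" using unflawed_antimono by blast
next
  fix \<mu> assume "\<mu> \<in> Par n"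
  then show "alternation n (array_count n) (\<lambda>i. int (\<mu> i) + (int n - 1 - int i)) =
    (\<Sum>C | C \<in> {C \<in> arrays n. unflawed C} \<and> (\<lambda>i. card (C i)) = \<mu>. monom 1 (array_inversions n C))"
    by (rule alternation_array_count)
qed

end

section \<open>Diagrams\<close>

definition cells :: "(nat \<Rightarrow> nat) \<Rightarrow> (nat \<times> nat) set" where
  "cells p = {(i, j). 1 \<le> i \<and> 1 \<le> j \<and> j \<le> p (i - 1)}"

definition part :: "nat list \<Rightarrow> nat \<Rightarrow> nat" where
  "part lam i = (if i < length lam then lam ! i else 0)"

lemma cells_Suc [simp]: "(Suc i, j) \<in> cells p \<longleftrightarrow> 1 \<le> j \<and> j \<le> p i"
  by (simp add: cells_def)

lemma cellsE:
  assumes "c \<in> cells p"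
  obtains i j where "c = (Suc i, j)" "1 \<le> j" "j \<le> p i"
proof -
  obtain a b where c: "c = (a, b)" by (cases c)
  with assms obtain i where "a = Suc i" by (cases a) (auto simp: cells_def)
  then show thesis using that assms c by auto
qed

lemma diagram_eq_cells: "diagram lam = cells (part lam)"
  by (auto simp: diagram_def cells_def part_def split: if_splits)

lemma part_Par:
  assumes "is_partition lam" "length lam \<le> n"
  shows "part lam \<in> Par n"
proof (rule ParI)
  fix i
  have "lam ! Suc i \<le> lam ! i" if "Suc i < length lam"
    using assms(1) that by (auto simp: is_partition_def sorted_wrt_iff_nth_less)
  then show "part lam (Suc i) \<le> part lam i" by (auto simp: part_def)
qed (use assms(2) in \<open>auto simp: part_def\<close>)

lemma sum_part: "length lam \<le> n \<Longrightarrow> sum (part lam) {..<n} = sum_list lam"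
proof -
  assume n: "length lam \<le> n"
  have "sum (part lam) {..<n} = sum (part lam) {..<length lam}"
    using n by (intro sum.mono_neutral_right) (auto simp: part_def)
  also have "\<dots> = sum_list lam" by (simp add: sum_list_sum_nth part_def lessThan_atLeast0)
  finally show ?thesis .
qed

lemma part_surj:
  assumes "p \<in> Par n"
  shows "\<exists>lam. is_partition lam \<and> length lam \<le> n \<and> part lam = p"
proof -
  define k where "k = (LEAST k. p k = 0)"
  have pn: "p n = 0" using Par_zero[OF assms] by simp
  have k: "p k = 0" unfolding k_def using pn by (rule LeastI)
  have kn: "k \<le> n" unfolding k_def using pn by (rule Least_le)
  have pos: "p i \<noteq> 0" if "i < k" for i using that not_less_Least unfolding k_def by blast
  have zero: "p i = 0" if "k \<le> i" for i using Par_mono[OF assms that] k by simp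
  have "is_partition (map p [0..<k])"
    using pos Par_mono[OF assms] by (force simp: is_partition_def sorted_wrt_iff_nth_less)
  moreover have "part (map p [0..<k]) = p" using zero by (auto simp: part_def fun_eq_iff)
  ultimately show ?thesis using kn by (intro exI[of _ "map p [0..<k]"]) simp
qed

lemma finite_cells: "p \<in> Par n \<Longrightarrow> finite (cells p)"
  using part_surj finite_diagram by (metis diagram_eq_cells)

lemma card_cells:
  assumes "p \<in> Par n"
  shows "card (cells p) = sum p {..<n}"
proof -
  have "cells p = (\<lambda>(i, j). (Suc i, Suc j)) ` (SIGMA i:{..<n}. {..<p i})"
  proof (intro equalityI subsetI)
    fix c assume "c \<in> cells p"
    then obtain i j where c: "c = (Suc i, j)" "1 \<le> j" "j \<le> p i" by (rule cellsE)
    then have "i < n" using Par_zero[OF assms, of i] by (cases "i < n") auto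
    then show "c \<in> (\<lambda>(i, j). (Suc i, Suc j)) ` (SIGMA i:{..<n}. {..<p i})"
      using c by (intro image_eqI[of _ _ "(i, j - 1)"]) auto
  qed auto
  then have "card (cells p) = card (SIGMA i:{..<n}. {..<p i})"
    by (simp add: card_image inj_on_def)
  then show ?thesis by simp
qed

lemma cells_mono: "cells p \<subseteq> cells q \<longleftrightarrow> (\<forall>i. p i \<le> q i)"
proof
  assume s: "cells p \<subseteq> cells q"
  show "\<forall>i. p i \<le> q i"
  proof
    fix i
    have "p i = 0 \<or> (Suc i, p i) \<in> cells p" by auto
    then have "p i = 0 \<or> (Suc i, p i) \<in> cells q" using s by blast
    then show "p i \<le> q i" by auto
  qed
qed (force simp: cells_def intro: order.trans)

section \<open>Set-valued tableaux and Grothendieck polynomials\<close>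

text \<open>
  Set-valued tableaux as total functions that are empty outside the shape, with both conditions stated for
  single letters. A letter can then be removed from all cells at once.
\<close>

definition total_svt :: "nat \<Rightarrow> (nat \<Rightarrow> nat) \<Rightarrow> (nat \<times> nat \<Rightarrow> nat set) set" where
  "total_svt n p = {T. (\<forall>c. T c \<noteq> {} \<longleftrightarrow> c \<in> cells p) \<and> (\<forall>c. T c \<subseteq> {1..n}) \<and>
     (\<forall>i j. \<forall>a\<in>T (i, j). \<forall>b\<in>T (i, Suc j). a \<le> b) \<and>
     (\<forall>i j. \<forall>a\<in>T (i, j). \<forall>b\<in>T (Suc i, j). a < b)}"

definition multiplicity_of :: "(nat \<times> nat \<Rightarrow> nat set) \<Rightarrow> nat \<Rightarrow> nat" where
  "multiplicity_of T k = card {c. k \<in> T c}"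

definition svt_of_content :: "nat \<Rightarrow> (nat \<Rightarrow> nat) \<Rightarrow> (nat \<Rightarrow> nat) \<Rightarrow> (nat \<times> nat \<Rightarrow> nat set) set" where
  "svt_of_content n p \<gamma> = {T \<in> total_svt n p. \<forall>i<n. multiplicity_of T (Suc i) = \<gamma> i}"

lemma total_svtD:
  assumes "T \<in> total_svt n p"
  shows "T c \<noteq> {} \<longleftrightarrow> c \<in> cells p" "T c \<subseteq> {1..n}"
    "a \<in> T (i, j) \<Longrightarrow> b \<in> T (i, Suc j) \<Longrightarrow> a \<le> b"
    "a \<in> T (i, j) \<Longrightarrow> b \<in> T (Suc i, j) \<Longrightarrow> a < b"
  using assms unfolding total_svt_def by blast+

lemma total_svtI:
  assumes "\<And>c. T c \<noteq> {} \<longleftrightarrow> c \<in> cells p" "\<And>c. T c \<subseteq> {1..n}"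
    "\<And>i j a b. a \<in> T (i, j) \<Longrightarrow> b \<in> T (i, Suc j) \<Longrightarrow> a \<le> b"
    "\<And>i j a b. a \<in> T (i, j) \<Longrightarrow> b \<in> T (Suc i, j) \<Longrightarrow> a < b"
  shows "T \<in> total_svt n p"
  unfolding total_svt_def mem_Collect_eq using assms by (intro conjI allI ballI)

text \<open>
  Letters are positive and increase strictly down each column.
\<close>

lemma total_svt_entry_ge_row:
  assumes "T \<in> total_svt n p" "\<And>i. p (Suc i) \<le> p i" "a \<in> T (i, j)"
  shows "i \<le> a"
  using assms(3)
proof (induction i arbitrary: a)
  case (Suc i)
  have T: "T c \<noteq> {} \<longleftrightarrow> c \<in> cells p" "T c \<subseteq> {1..n}"
    "a \<in> T (i, j) \<Longrightarrow> b \<in> T (Suc i, j) \<Longrightarrow> a < b" for c a b i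
    using total_svtD[OF assms(1)] by blast+
  show ?case
  proof (cases i)
    case 0
    have "a \<in> {1..n}" using Suc.prems T(2) by blast
    then show ?thesis using 0 by simp
  next
    case k: (Suc k)
    have "(Suc i, j) \<in> cells p" using Suc.prems T(1) by blast
    then have "(i, j) \<in> cells p" using assms(2)[of k] by (simp add: k)
    then obtain b where b: "b \<in> T (i, j)" using T(1) by blast
    then have "b < a" using Suc.prems T(3) by blast
    then show ?thesis using Suc.IH[OF b] by simp
  qed
qed simp

text \<open>
  The rows of \<open>\<nu>\<close> whose last cell has no cell of \<open>p\<close> below it. Only such a cell can contain the
  largest letter next to smaller ones.
\<close>

definition corners :: "nat \<Rightarrow> (nat \<Rightarrow> nat) \<Rightarrow> (nat \<Rightarrow> nat) \<Rightarrow> nat set" where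
  "corners n p \<nu> = {i. i < n \<and> p (Suc i) < \<nu> i}"

definition add_largest :: "nat \<Rightarrow> (nat \<Rightarrow> nat) \<Rightarrow> (nat \<Rightarrow> nat) \<Rightarrow> (nat \<times> nat \<Rightarrow> nat set) \<Rightarrow> nat set \<Rightarrow>
    nat \<times> nat \<Rightarrow> nat set" where
  "add_largest m p \<nu> T Q c = T c \<union>
     (if c \<in> cells p - cells \<nu> \<or> c \<in> (\<lambda>i. (Suc i, \<nu> i)) ` Q then {m} else {})"

definition rows_below :: "nat \<Rightarrow> (nat \<times> nat \<Rightarrow> nat set) \<Rightarrow> nat \<Rightarrow> nat" where
  "rows_below m T i = card {j. T (Suc i, j) - {m} \<noteq> {}}"

lemma initial_segment:
  fixes S :: "nat set"
  assumes "finite S" "0 \<notin> S" "\<And>j. 1 \<le> j \<Longrightarrow> Suc j \<in> S \<Longrightarrow> j \<in> S"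
  shows "S = {1..card S}"
proof (cases "S = {}")
  case False
  have down: "1 \<le> j \<Longrightarrow> j \<le> k \<Longrightarrow> k \<in> S \<Longrightarrow> j \<in> S" for j k
  proof (induction k)
    case (Suc k)
    then show ?case using assms(3)[of k] by (cases "j = Suc k") auto
  qed simp
  have "S = {1..Max S}"
  proof (intro equalityI subsetI)
    fix x assume "x \<in> S"
    then show "x \<in> {1..Max S}" using assms(1,2) by (cases x) auto
  next
    fix x assume "x \<in> {1..Max S}"
    then show "x \<in> S" using down[of x "Max S"] Max_in[OF assms(1) False] by auto
  qed
  then show ?thesis by (metis card_atLeastAtMost diff_Suc_1)
qed simp

text \<open>
  The cells that contain a smaller letter form a shape \<open>\<nu>\<close>, since the largest letter occurs neither to
  the left of a smaller letter nor above any letter. In a cell of \<open>\<nu>\<close> the largest letter has no other cell of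
  \<open>\<nu>\<close> to its right and no cell of \<open>p\<close> below it.
\<close>

lemma remove_largest:
  assumes p: "p \<in> Par (Suc n)" and T: "T \<in> total_svt (Suc n) p"
  defines "\<nu> \<equiv> rows_below (Suc n) T" and "T' \<equiv> (\<lambda>c. T c - {Suc n})"
    and "Q \<equiv> {i \<in> corners n p (rows_below (Suc n) T). Suc n \<in> T (Suc i, rows_below (Suc n) T i)}"
  shows "\<nu> \<in> interlacing n p" "T' \<in> total_svt n \<nu>" "T = add_largest (Suc n) p \<nu> T' Q"
proof -
  have T1: "T c \<noteq> {} \<longleftrightarrow> c \<in> cells p" and T2: "T c \<subseteq> {1..Suc n}"
    and T3: "a \<in> T (i, j) \<Longrightarrow> b \<in> T (i, Suc j) \<Longrightarrow> a \<le> b"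
    and T4: "a \<in> T (i, j) \<Longrightarrow> b \<in> T (Suc i, j) \<Longrightarrow> a < b" for c i j a b
    using total_svtD[OF T] by blast+
  have small: "a \<le> n" if "a \<in> T c" "a \<noteq> Suc n" for a c using T2[of c] that by force
  have cell: "c \<in> cells \<nu> \<longleftrightarrow> T' c \<noteq> {}" for c
  proof -
    have seg: "{j. T' (Suc i, j) \<noteq> {}} = {1..\<nu> i}" for i
      unfolding \<nu>_def rows_below_def T'_def
    proof (rule initial_segment)
      have "{j. T (Suc i, j) - {Suc n} \<noteq> {}} \<subseteq> {1..p i}"
      proof
        fix j assume "j \<in> {j. T (Suc i, j) - {Suc n} \<noteq> {}}"
        then have "(Suc i, j) \<in> cells p" using T1[of "(Suc i, j)"] by blast
        then show "j \<in> {1..p i}" by simp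
      qed
      then show "finite {j. T (Suc i, j) - {Suc n} \<noteq> {}}" "0 \<notin> {j. T (Suc i, j) - {Suc n} \<noteq> {}}"
        by (auto intro: finite_subset)
      fix j :: nat assume j: "1 \<le> j" "Suc j \<in> {j. T (Suc i, j) - {Suc n} \<noteq> {}}"
      then obtain b where b: "b \<in> T (Suc i, Suc j)" "b \<noteq> Suc n" by blast
      then have "(Suc i, Suc j) \<in> cells p" using T1[of "(Suc i, Suc j)"] by blast
      then have "(Suc i, j) \<in> cells p" using j by simp
      then obtain a where a: "a \<in> T (Suc i, j)" using T1[of "(Suc i, j)"] by blast
      then have "a \<le> n" using T3[OF a b(1)] small[OF b] by simp
      then show "j \<in> {j. T (Suc i, j) - {Suc n} \<noteq> {}}" using a by auto
    qed
    show ?thesis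
    proof (cases c)
      case (Pair a j)
      show ?thesis
      proof (cases a)
        case 0
        then have "c \<notin> cells p" "c \<notin> cells \<nu>" using Pair by (auto simp: cells_def)
        then show ?thesis using T1[of c] by (auto simp: T'_def)
      next
        case (Suc i)
        have "j \<in> {j. T' (Suc i, j) \<noteq> {}} \<longleftrightarrow> j \<in> {1..\<nu> i}" using seg[of i] by simp
        then show ?thesis using Pair Suc by simp
      qed
    qed
  qed
  have le: "\<nu> i \<le> p i" for i
  proof -
    have "cells \<nu> \<subseteq> cells p" using cell T1 unfolding T'_def by blast
    then show ?thesis by (simp add: cells_mono)
  qed
  have ge: "p (Suc i) \<le> \<nu> i" if "i < n" for i
  proof (cases "p (Suc i) = 0")
    case False
    let ?j = "p (Suc i)"
    have "(Suc (Suc i), ?j) \<in> cells p" "(Suc i, ?j) \<in> cells p"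
      using False Par_mono[OF p, of i "Suc i"] by auto
    then obtain a b where ab: "a \<in> T (Suc i, ?j)" "b \<in> T (Suc (Suc i), ?j)" using T1 by blast
    then have "a < b" "b \<le> Suc n" using T4 T2[of "(Suc (Suc i), ?j)"] by auto
    then have "(Suc i, ?j) \<in> cells \<nu>" using ab cell[of "(Suc i, ?j)"] by (auto simp: T'_def)
    then show ?thesis by simp
  qed simp
  have zero: "\<nu> i = 0" if "n \<le> i" for i
  proof (rule ccontr)
    assume "\<nu> i \<noteq> 0"
    then have "(Suc i, 1) \<in> cells \<nu>" by simp
    then obtain a where "a \<in> T (Suc i, 1)" "a \<noteq> Suc n" using cell[of "(Suc i, 1)"] by (auto simp: T'_def)
    then show False using total_svt_entry_ge_row[OF T, of a "Suc i" 1] Par_mono[OF p] small[of a "(Suc i, 1)"] that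
      by auto
  qed
  show int: "\<nu> \<in> interlacing n p" using le ge zero by (auto simp: interlacing_def)
  have "T' c \<subseteq> {1..n}" for c using T2[of c] small[of _ c] by (auto simp: T'_def)
  then show "T' \<in> total_svt n \<nu>"
    by (intro total_svtI) (use cell T3 T4 in \<open>auto simp: T'_def\<close>)
  show "T = add_largest (Suc n) p \<nu> T' Q"
  proof
    fix c
    have "Suc n \<in> T c \<longleftrightarrow> c \<in> cells p - cells \<nu> \<or> c \<in> (\<lambda>i. (Suc i, \<nu> i)) ` Q"
    proof (cases "c \<in> cells \<nu>")
      case True
      then obtain i j where c: "c = (Suc i, j)" "1 \<le> j" "j \<le> \<nu> i" by (rule cellsE)
      have "i < n" using zero[of i] c by (cases "i < n") auto
      have "j = \<nu> i \<and> i \<in> Q" if m: "Suc n \<in> T c"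
      proof -
        have j: "j = \<nu> i"
        proof (rule ccontr)
          assume "j \<noteq> \<nu> i"
          then have "(Suc i, Suc j) \<in> cells \<nu>" using c by simp
          then obtain b where "b \<in> T (Suc i, Suc j)" "b \<noteq> Suc n"
            using cell[of "(Suc i, Suc j)"] by (auto simp: T'_def)
          then show False using T3[of "Suc n" "Suc i" j b] m c small[of b "(Suc i, Suc j)"] by auto
        qed
        have "p (Suc i) < \<nu> i"
        proof (rule ccontr)
          assume "\<not> p (Suc i) < \<nu> i"
          then have "(Suc (Suc i), j) \<in> cells p" using c j by simp
          then obtain b where "b \<in> T (Suc (Suc i), j)" using T1 by blast
          then show False using T4[of "Suc n" "Suc i" j b] m c T2[of "(Suc (Suc i), j)"] by auto
        qed
        then show ?thesis using m j c \<open>i < n\<close> by (simp add: Q_def corners_def \<nu>_def)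
      qed
      moreover have "Suc n \<in> T c" if "c \<in> (\<lambda>i. (Suc i, \<nu> i)) ` Q"
        using that by (auto simp: Q_def \<nu>_def)
      ultimately show ?thesis using True c by auto
    next
      case False
      then have "T c \<subseteq> {Suc n}" using cell by (auto simp: T'_def)
      then have "Suc n \<in> T c \<longleftrightarrow> T c \<noteq> {}" by blast
      moreover have "c \<notin> (\<lambda>i. (Suc i, \<nu> i)) ` Q"
      proof
        assume "c \<in> (\<lambda>i. (Suc i, \<nu> i)) ` Q"
        then obtain i where "c = (Suc i, \<nu> i)" "p (Suc i) < \<nu> i" by (auto simp: Q_def corners_def \<nu>_def)
        then show False using False by simp
      qed
      ultimately show ?thesis using T1 False by blast
    qed
    then show "T c = add_largest (Suc n) p \<nu> T' Q c" by (auto simp: add_largest_def T'_def)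
  qed
qed

lemma add_largest:
  assumes p: "p \<in> Par (Suc n)" and \<nu>: "\<nu> \<in> interlacing n p" and T: "T \<in> total_svt n \<nu>"
    and Q: "Q \<subseteq> corners n p \<nu>"
  defines "T' \<equiv> add_largest (Suc n) p \<nu> T Q"
  shows "T' \<in> total_svt (Suc n) p" "rows_below (Suc n) T' = \<nu>" "(\<lambda>c. T' c - {Suc n}) = T"
    "{i \<in> corners n p \<nu>. Suc n \<in> T' (Suc i, \<nu> i)} = Q"
    "i < n \<Longrightarrow> multiplicity_of T' (Suc i) = multiplicity_of T (Suc i)"
    "multiplicity_of T' (Suc n) = sum p {..n} - sum \<nu> {..<n} + card Q"
proof -
  have T1: "T c \<noteq> {} \<longleftrightarrow> c \<in> cells \<nu>" and T2: "T c \<subseteq> {1..n}"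
    and T3: "a \<in> T (i, j) \<Longrightarrow> b \<in> T (i, Suc j) \<Longrightarrow> a \<le> b"
    and T4: "a \<in> T (i, j) \<Longrightarrow> b \<in> T (Suc i, j) \<Longrightarrow> a < b" for c i j a b
    using total_svtD[OF T] by blast+
  have \<nu>': "\<nu> \<in> Par n" by (rule interlacing_Par[OF p \<nu>])
  have "\<nu> i \<le> p i" for i using \<nu> by (cases "i < n") (auto simp: interlacing_def)
  then have sub: "cells \<nu> \<subseteq> cells p" by (simp add: cells_mono)
  have Qcells: "(\<lambda>i. (Suc i, \<nu> i)) ` Q \<subseteq> cells \<nu>" using Q by (auto simp: corners_def)
  let ?N = "(cells p - cells \<nu>) \<union> (\<lambda>i. (Suc i, \<nu> i)) ` Q"
  have notin: "Suc n \<notin> T c" for c using T2[of c] by auto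
  have T': "T' c = T c \<union> (if c \<in> ?N then {Suc n} else {})" for c by (simp add: T'_def add_largest_def)
  have N: "Suc n \<in> T' c \<longleftrightarrow> c \<in> ?N" for c using notin T' by auto
  have small: "a \<in> T' c \<longleftrightarrow> a \<in> T c" if "a \<noteq> Suc n" for a c using T' that by auto
  show minus: "(\<lambda>c. T' c - {Suc n}) = T" using notin T' by (auto simp: fun_eq_iff)
  have "{j. T' (Suc i, j) - {Suc n} \<noteq> {}} = {1..\<nu> i}" for i
  proof -
    have "T' (Suc i, j) - {Suc n} = T (Suc i, j)" for j using minus by (rule fun_cong)
    then show ?thesis using T1 by auto
  qed
  then show "rows_below (Suc n) T' = \<nu>" by (auto simp: rows_below_def fun_eq_iff)
  show "{i \<in> corners n p \<nu>. Suc n \<in> T' (Suc i, \<nu> i)} = Q"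
    unfolding N using Q by (auto simp: corners_def)
  show "multiplicity_of T' (Suc i) = multiplicity_of T (Suc i)" if "i < n"
    using small that by (simp add: multiplicity_of_def)
  have "multiplicity_of T' (Suc n) = card ?N" by (simp only: multiplicity_of_def N Collect_mem_eq)
  also have "\<dots> = card (cells p - cells \<nu>) + card ((\<lambda>i. (Suc i, \<nu> i)) ` Q)"
  proof (rule card_Un_disjoint)
    have "finite Q" using Q by (rule finite_subset) (simp add: corners_def)
    then show "finite ((\<lambda>i. (Suc i, \<nu> i)) ` Q)" by simp
  qed (use Qcells finite_cells[OF p] in auto)
  also have "card (cells p - cells \<nu>) = card (cells p) - card (cells \<nu>)"
    by (rule card_Diff_subset[OF finite_cells[OF \<nu>'] sub])
  also have "\<dots> = sum p {..n} - sum \<nu> {..<n}"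
    by (simp add: card_cells[OF p] card_cells[OF \<nu>'] lessThan_Suc_atMost del: sum.lessThan_Suc)
  also have "card ((\<lambda>i. (Suc i, \<nu> i)) ` Q) = card Q" by (rule card_image) (simp add: inj_on_def)
  finally show "multiplicity_of T' (Suc n) = sum p {..n} - sum \<nu> {..<n} + card Q" .
  have "T' c \<noteq> {} \<longleftrightarrow> c \<in> cells p" for c
    using T1[of c] T'[of c] sub Qcells by auto
  moreover have "T' c \<subseteq> {1..Suc n}" for c using T2[of c] T'[of c] by auto
  moreover have "a \<le> b" if "a \<in> T' (i, j)" "b \<in> T' (i, Suc j)" for i j a b
  proof (cases "b = Suc n")
    case True
    then show ?thesis using \<open>T' (i, j) \<subseteq> {1..Suc n}\<close> that(1) by auto
  next
    case False
    then have b: "b \<in> T (i, Suc j)" using small that by blast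
    then have c: "(i, Suc j) \<in> cells \<nu>" using T1 by blast
    have "a \<noteq> Suc n"
    proof
      assume "a = Suc n"
      then have "(i, j) \<in> ?N" using that(1) N by blast
      moreover from this have "1 \<le> j" using Qcells by (auto simp: cells_def)
      ultimately show False using c Qcells by (auto simp: cells_def)
    qed
    then show ?thesis using small that(1) T3 b by blast
  qed
  moreover have "a < b" if "a \<in> T' (i, j)" "b \<in> T' (Suc i, j)" for i j a b
  proof -
    have ci: "(i, j) \<in> cells p" using that(1) \<open>T' (i, j) \<noteq> {} \<longleftrightarrow> (i, j) \<in> cells p\<close> by blast
    have cSi: "(Suc i, j) \<in> cells p" using that(2) \<open>T' (Suc i, j) \<noteq> {} \<longleftrightarrow> (Suc i, j) \<in> cells p\<close> by blast
    obtain k where k: "i = Suc k" using ci by (cases i) (auto simp: cells_def)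
    have jk: "j \<le> p (Suc k)" "1 \<le> j" using cSi k by auto
    have "p (Suc k) \<le> \<nu> k"
      using \<nu> Par_zero[OF p, of "Suc k"] by (cases "k < n") (auto simp: interlacing_def)
    then have "(i, j) \<in> cells \<nu>" using k jk by simp
    moreover have "(i, j) \<notin> (\<lambda>i. (Suc i, \<nu> i)) ` Q" using Q jk k by (auto simp: corners_def)
    ultimately have "a \<noteq> Suc n" using N that(1) by blast
    then have a: "a \<in> T (i, j)" using small that(1) by blast
    then have "a \<le> n" using T2[of "(i, j)"] by auto
    then show ?thesis using small[of b "(Suc i, j)"] that(2) T4[OF a] by (cases "b = Suc n") auto
  qed
  ultimately show "T' \<in> total_svt (Suc n) p" by (rule total_svtI)
qed

lemma svt_of_content_Suc:
  assumes p: "p \<in> Par (Suc n)"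
  shows "bij_betw (\<lambda>T. (rows_below (Suc n) T, \<lambda>c. T c - {Suc n},
            {i \<in> corners n p (rows_below (Suc n) T). Suc n \<in> T (Suc i, rows_below (Suc n) T i)}))
    (svt_of_content (Suc n) p \<gamma>)
    (SIGMA \<nu>:interlacing n p. svt_of_content n \<nu> \<gamma> \<times>
       {Q. Q \<subseteq> corners n p \<nu> \<and> sum p {..n} - sum \<nu> {..<n} + card Q = \<gamma> n})"
    (is "bij_betw ?f _ ?R")
proof (rule bij_betw_byWitness[where f' = "\<lambda>(\<nu>, T, Q). add_largest (Suc n) p \<nu> T Q"])
  show "\<forall>T\<in>svt_of_content (Suc n) p \<gamma>. (\<lambda>(\<nu>, T, Q). add_largest (Suc n) p \<nu> T Q) (?f T) = T"
    using remove_largest(3)[OF p] by (simp add: svt_of_content_def)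
  show "\<forall>x\<in>?R. ?f ((\<lambda>(\<nu>, T, Q). add_largest (Suc n) p \<nu> T Q) x) = x"
    using add_largest(2-4)[OF p] by (auto simp: svt_of_content_def)
  show "?f ` svt_of_content (Suc n) p \<gamma> \<subseteq> ?R"
  proof
    fix x assume "x \<in> ?f ` svt_of_content (Suc n) p \<gamma>"
    then obtain T where T: "T \<in> total_svt (Suc n) p" "\<And>i. i < Suc n \<Longrightarrow> multiplicity_of T (Suc i) = \<gamma> i"
      and x: "x = ?f T" by (auto simp: svt_of_content_def)
    let ?\<nu> = "rows_below (Suc n) T" and ?T = "\<lambda>c. T c - {Suc n}"
    let ?Q = "{i \<in> corners n p ?\<nu>. Suc n \<in> T (Suc i, ?\<nu> i)}"
    note rem = remove_largest[OF p T(1)]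
    have Q: "?Q \<subseteq> corners n p ?\<nu>" by blast
    note add = add_largest[OF p rem(1,2) Q, folded rem(3)]
    have "?T \<in> svt_of_content n ?\<nu> \<gamma>"
      using rem(2) add(5) T(2) by (auto simp: svt_of_content_def less_Suc_eq)
    moreover have "sum p {..n} - sum ?\<nu> {..<n} + card ?Q = \<gamma> n" using add(6) T(2)[of n] by simp
    ultimately show "x \<in> ?R" unfolding x using rem(1) by auto
  qed
  show "(\<lambda>(\<nu>, T, Q). add_largest (Suc n) p \<nu> T Q) ` ?R \<subseteq> svt_of_content (Suc n) p \<gamma>"
  proof
    fix T' assume "T' \<in> (\<lambda>(\<nu>, T, Q). add_largest (Suc n) p \<nu> T Q) ` ?R"
    then obtain \<nu> T Q where h: "\<nu> \<in> interlacing n p" "T \<in> svt_of_content n \<nu> \<gamma>" "Q \<subseteq> corners n p \<nu>"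
      "sum p {..n} - sum \<nu> {..<n} + card Q = \<gamma> n" and T': "T' = add_largest (Suc n) p \<nu> T Q" by auto
    have T: "T \<in> total_svt n \<nu>" "\<And>i. i < n \<Longrightarrow> multiplicity_of T (Suc i) = \<gamma> i"
      using h(2) by (auto simp: svt_of_content_def)
    note add = add_largest[OF p h(1) T(1) h(3)]
    show "T' \<in> svt_of_content (Suc n) p \<gamma>"
      unfolding svt_of_content_def T' using add(1,5,6) T(2) h(4) by (auto simp: less_Suc_eq)
  qed
qed

text \<open>
  The coefficients of a power of \<open>1 - x\<close> are the binomial coefficients with alternating signs, and these count
  the sets of corners that receive the largest letter.
\<close>

lemma coeff_branching_weight:
  assumes "n \<le> k"
  shows "coeff (branching_weight [:0, 1:] k n p \<nu>) g =
    ((-1) ^ (g + (sum p {..n} - sum \<nu> {..<n})) *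
    of_nat (card {Q. Q \<subseteq> corners n p \<nu> \<and> sum p {..n} - sum \<nu> {..<n} + card Q = g}) :: int poly)"
proof -
  define d where "d = sum p {..n} - sum \<nu> {..<n}"
  let ?M = "corners n p \<nu>"
  have fin: "finite ?M" by (simp add: corners_def)
  have M: "{i. i < n \<and> i < k \<and> p (Suc i) < \<nu> i} = ?M" using assms by (auto simp: corners_def)
  have "branching_weight [:0, 1:] k n p \<nu> = (monom 1 d * [:1, -1:] ^ card ?M :: int poly poly)"
  proof -
    have "1 - [:0, 1:] = [:1, -1 :: int poly:]" by (simp add: one_pCons)
    then show ?thesis by (simp only: branching_weight_def d_def M monom_altdef smult_1_left)
  qed
  then have c: "coeff (branching_weight [:0, 1:] k n p \<nu>) g =
      (if g < d then 0 else coeff ([:1, -1:] ^ card ?M :: int poly poly) (g - d))"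
    by (simp add: coeff_monom_mult)
  have "coeff (branching_weight [:0, 1:] k n p \<nu>) g =
    ((-1) ^ (g + d) * of_nat (card {Q. Q \<subseteq> ?M \<and> d + card Q = g}) :: int poly)"
  proof (cases "g < d")
    case True
    then have "{Q. Q \<subseteq> ?M \<and> d + card Q = g} = {}" by auto
    then show ?thesis using c True by simp
  next
    case False
    then have "{Q. Q \<subseteq> ?M \<and> d + card Q = g} = {Q. Q \<subseteq> ?M \<and> card Q = g - d}" by auto
    then have card: "card {Q. Q \<subseteq> ?M \<and> d + card Q = g} = card ?M choose (g - d)"
      using n_subsets[OF fin] by simp
    have sign: "(-1 :: int poly) ^ (g + d) = (-1) ^ (g - d)" using False
      by (metis even_add even_diff_nat linorder_not_less minus_one_power_iff)
    show ?thesis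
    proof (cases "g - d \<le> card ?M")
      case True
      then show ?thesis unfolding c card sign using False
        by (simp add: coeff_linear_poly_power mult.commute)
    next
      case False': False
      have "degree ([:1, -1:] ^ card ?M :: int poly poly) \<le> card ?M"
        using degree_power_le[of "[:1, -1:] :: int poly poly" "card ?M"] by simp
      then have "coeff ([:1, -1:] ^ card ?M :: int poly poly) (g - d) = 0"
        using False' by (intro coeff_eq_0) simp
      then show ?thesis unfolding c card using False False' by (simp add: binomial_eq_0)
    qed
  qed
  then show ?thesis by (simp only: d_def)
qed

text \<open>
  The sign of a set-valued tableau depends only on its shape and its content, so a signed sum over the tableaux
  with a given content is a signed number of tableaux.
\<close>

lemma groth_eq_signed_svt_count:
  assumes "p \<in> Par n" "n \<le> k"
  shows "groth k n p \<gamma> = (-1) ^ (sum \<gamma> {..<n} + sum p {..<n}) * of_nat (card (svt_of_content n p \<gamma>)) \<and>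
    finite (svt_of_content n p \<gamma>)"
  using assms
proof (induction n arbitrary: p)
  case 0
  have "cells p = {}" using Par_zero[OF 0(1)] by (auto simp: cells_def)
  then have "svt_of_content 0 p \<gamma> = {\<lambda>_. {}}" by (auto simp: svt_of_content_def total_svt_def)
  then show ?case by simp
next
  case (Suc n)
  note p = Suc.prems(1)
  let ?B = "\<lambda>\<nu>. {Q. Q \<subseteq> corners n p \<nu> \<and> sum p {..n} - sum \<nu> {..<n} + card Q = \<gamma> n}"
  let ?R = "SIGMA \<nu>:interlacing n p. svt_of_content n \<nu> \<gamma> \<times> ?B \<nu>"
  have fin: "finite (svt_of_content n \<nu> \<gamma>)" if "\<nu> \<in> interlacing n p" for \<nu>
    using Suc.IH[OF interlacing_Par[OF p that]] Suc.prems(2) by simp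
  have finB: "finite (?B \<nu>)" for \<nu>
    by (rule finite_subset[of _ "Pow (corners n p \<nu>)"]) (auto simp: corners_def)
  have finR: "finite ?R" using fin finB finite_interlacing by (intro finite_SigmaI finite_cartesian_product) auto
  have bij: "card (svt_of_content (Suc n) p \<gamma>) = card ?R"
    by (rule bij_betw_same_card[OF svt_of_content_Suc[OF p]])
  have "card ?R = (\<Sum>\<nu>\<in>interlacing n p. card (svt_of_content n \<nu> \<gamma>) * card (?B \<nu>))"
    using fin finB finite_interlacing by (subst card_SigmaI) (auto simp: card_cartesian_product)
  then have "(-1) ^ (sum \<gamma> {..<Suc n} + sum p {..<Suc n}) * of_nat (card (svt_of_content (Suc n) p \<gamma>)) =
      (\<Sum>\<nu>\<in>interlacing n p. (-1) ^ (sum \<gamma> {..<Suc n} + sum p {..<Suc n}) *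
        (of_nat (card (svt_of_content n \<nu> \<gamma>)) * of_nat (card (?B \<nu>)) :: int poly))"
    unfolding bij by (simp add: sum_distrib_left)
  also have "\<dots> = (\<Sum>\<nu>\<in>interlacing n p. groth k n \<nu> \<gamma> * coeff (branching_weight [:0, 1:] k n p \<nu>) (\<gamma> n))"
  proof (rule sum.cong[OF refl])
    fix \<nu> assume \<nu>: "\<nu> \<in> interlacing n p"
    let ?d = "sum p {..n} - sum \<nu> {..<n}"
    have g: "groth k n \<nu> \<gamma> = (-1) ^ (sum \<gamma> {..<n} + sum \<nu> {..<n}) * of_nat (card (svt_of_content n \<nu> \<gamma>))"
      using Suc.IH[OF interlacing_Par[OF p \<nu>]] Suc.prems(2) by simp
    have "sum \<gamma> {..<Suc n} + sum p {..<Suc n} = (sum \<gamma> {..<n} + sum \<nu> {..<n}) + (\<gamma> n + ?d)"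
      using interlacing_size[OF \<nu>] by (simp add: lessThan_Suc_atMost[symmetric])
    then have "(-1 :: int poly) ^ (sum \<gamma> {..<Suc n} + sum p {..<Suc n}) =
        (-1) ^ (sum \<gamma> {..<n} + sum \<nu> {..<n}) * (-1) ^ (\<gamma> n + ?d)" by (simp only: power_add)
    then show "(-1) ^ (sum \<gamma> {..<Suc n} + sum p {..<Suc n}) *
        (of_nat (card (svt_of_content n \<nu> \<gamma>)) * of_nat (card (?B \<nu>)) :: int poly) =
        groth k n \<nu> \<gamma> * coeff (branching_weight [:0, 1:] k n p \<nu>) (\<gamma> n)"
      unfolding g coeff_branching_weight[OF Suc_leD[OF Suc.prems(2)]] by (simp only: mult_ac)
  qed
  finally have "groth k (Suc n) p \<gamma> =
      (-1) ^ (sum \<gamma> {..<Suc n} + sum p {..<Suc n}) * of_nat (card (svt_of_content (Suc n) p \<gamma>))"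
    by (simp only: groth.simps)
  moreover have "finite (svt_of_content (Suc n) p \<gamma>)"
    using bij_betw_finite[OF svt_of_content_Suc[OF p]] finR by blast
  ultimately show ?case by blast
qed

definition total_filling :: "nat set filling \<Rightarrow> nat \<times> nat \<Rightarrow> nat set" where
  "total_filling F c = (case F c of None \<Rightarrow> {} | Some S \<Rightarrow> S)"

definition partial_filling :: "(nat \<times> nat \<Rightarrow> nat set) \<Rightarrow> nat set filling" where
  "partial_filling T c = (if T c = {} then None else Some (T c))"

lemma set_order_iff:
  assumes "finite S" "S \<noteq> {}" "finite T" "T \<noteq> {}"
  shows "S \<preceq> T \<longleftrightarrow> (\<forall>a\<in>S. \<forall>b\<in>T. a \<le> b)" "S \<prec> T \<longleftrightarrow> (\<forall>a\<in>S. \<forall>b\<in>T. a < b)"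
  using assms by (auto simp: set_less_eq_def set_less_def)

lemma SetP_entry:
  assumes "ran F \<subseteq> SetP" "F c = Some S"
  shows "finite S" "S \<noteq> {}" "0 \<notin> S"
proof -
  have "S \<in> SetP" using assms ranI[of F c S] by blast
  then show "finite S" "S \<noteq> {}" "0 \<notin> S" by (auto simp: SetP_def)
qed

lemma count_tableau_weight:
  assumes "finite (dom F)" "ran F \<subseteq> SetP"
  shows "count (tableau_weight F) k = multiplicity_of (total_filling F) k"
proof -
  have fin: "finite (the (F c))" if "c \<in> dom F" for c
    using SetP_entry(1)[OF assms(2), of c] that by auto
  have "count (tableau_weight F) k = (\<Sum>c\<in>dom F. if k \<in> the (F c) then 1 else 0)"
    unfolding tableau_weight_def count_sum case_prod_unfold prod.collapse
    using fin by (intro sum.cong refl) (simp add: count_mset_set')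
  also have "\<dots> = card {c \<in> dom F. k \<in> the (F c)}" using assms(1) by (simp add: sum.inter_filter[symmetric])
  also have "{c \<in> dom F. k \<in> the (F c)} = {c. k \<in> total_filling F c}"
    by (auto simp: total_filling_def split: option.splits)
  finally show ?thesis by (simp add: multiplicity_of_def)
qed

lemma tableau_size_eq: "tableau_size F = size (tableau_weight F)"
  by (simp add: tableau_size_def tableau_weight_def case_prod_unfold)

lemma set_valued_tableau_sizes:
  assumes "F \<in> set_valued_tableaux lam"
  shows "sum_list lam \<le> tableau_size F"
proof -
  have dom: "dom F = diagram lam" and ran: "ran F \<subseteq> SetP"
    using assms by (auto simp: set_valued_tableaux_def fillings_def)
  have "1 \<le> card (the (F c))" if "c \<in> dom F" for c
    using SetP_entry(1,2)[OF ran, of c] that by (auto simp: Suc_le_eq card_gt_0_iff)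
  then have "(\<Sum>c\<in>dom F. 1) \<le> (\<Sum>c\<in>dom F. card (the (F c)))" by (intro sum_mono) auto
  then have "card (diagram lam) \<le> tableau_size F"
    by (simp add: tableau_size_def dom case_prod_unfold)
  moreover have "card (diagram lam) = sum_list lam"
  proof -
    have "diagram lam = (\<lambda>(i, j). (Suc i, Suc j)) ` (SIGMA i:{..<length lam}. {..<lam ! i})"
    proof (intro equalityI subsetI)
      fix c assume "c \<in> diagram lam"
      then show "c \<in> (\<lambda>(i, j). (Suc i, Suc j)) ` (SIGMA i:{..<length lam}. {..<lam ! i})"
        by (intro image_eqI[of _ _ "(fst c - 1, snd c - 1)"]) (auto simp: diagram_def)
    qed (auto simp: diagram_def)
    then have "card (diagram lam) = card (SIGMA i:{..<length lam}. {..<lam ! i})"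
      by (simp add: card_image inj_on_def)
    then show ?thesis by (simp add: sum_list_sum_nth lessThan_atLeast0)
  qed
  ultimately show ?thesis by simp
qed

lemma total_filling_bij:
  assumes m: "set_mset m \<subseteq> {1..n}"
  shows "bij_betw total_filling {F \<in> set_valued_tableaux lam. tableau_weight F = m}
    (svt_of_content n (part lam) (\<lambda>i. count m (Suc i)))"
    (is "bij_betw _ ?A ?B")
proof (rule bij_betw_byWitness[where f' = partial_filling])
  have A: "dom F = diagram lam" "ran F \<subseteq> SetP" "finite (dom F)" "tableau_weight F = m" if "F \<in> ?A" for F
    using that finite_diagram by (auto simp: set_valued_tableaux_def fillings_def)
  have ne: "S \<noteq> {} \<and> finite S \<and> 0 \<notin> S" if "F \<in> ?A" "F c = Some S" for F c S
    using SetP_entry[OF A(2)[OF that(1)] that(2)] by simp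
  show "\<forall>F\<in>?A. partial_filling (total_filling F) = F"
  proof (intro ballI ext)
    fix F c assume "F \<in> ?A"
    then show "partial_filling (total_filling F) c = F c"
      using ne[of F c] by (cases "F c") (auto simp: partial_filling_def total_filling_def)
  qed
  show "\<forall>T\<in>?B. total_filling (partial_filling T) = T"
    by (auto simp: partial_filling_def total_filling_def fun_eq_iff)
  show "total_filling ` ?A \<subseteq> ?B"
  proof
    fix T assume "T \<in> total_filling ` ?A"
    then obtain F where F: "F \<in> ?A" and T: "T = total_filling F" by blast
    have Tc: "T c = the (F c)" if "c \<in> diagram lam" for c
      using that A(1)[OF F] by (auto simp: T total_filling_def split: option.splits)
    have cell: "T c \<noteq> {} \<longleftrightarrow> c \<in> diagram lam" for c
      using A(1)[OF F] ne[OF F, of c] by (cases "F c") (auto simp: T total_filling_def)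
    have fin_ne: "finite (T c) \<and> T c \<noteq> {}" if "c \<in> diagram lam" for c
      using that A(1)[OF F] ne[OF F, of c] by (cases "F c") (auto simp: T total_filling_def)
    have cnt: "multiplicity_of T k = count m k" for k
      using count_tableau_weight[OF A(3)[OF F] A(2)[OF F], of k] A(4)[OF F] by (simp add: T)
    have "T \<in> total_svt n (part lam)"
    proof (rule total_svtI)
      show "T c \<noteq> {} \<longleftrightarrow> c \<in> cells (part lam)" for c using cell by (simp add: diagram_eq_cells)
      show "T c \<subseteq> {1..n}" for c
      proof
        fix k assume k: "k \<in> T c"
        have "{c. k \<in> T c} \<subseteq> diagram lam" using cell by blast
        then have "finite {c. k \<in> T c}" by (rule finite_subset) (rule finite_diagram)
        moreover have "{c. k \<in> T c} \<noteq> {}" using k by blast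
        ultimately have "multiplicity_of T k \<noteq> 0" by (simp only: multiplicity_of_def card_eq_0_iff simp_thms)
        then have "k \<in># m" by (simp add: cnt)
        then show "k \<in> {1..n}" using m by blast
      qed
      fix i j a b
      {
        assume ab: "a \<in> T (i, j)" "b \<in> T (i, Suc j)"
        then have c: "(i, j) \<in> diagram lam" "(i, Suc j) \<in> diagram lam" using cell by blast+
        then have "entry F i j \<preceq> entry F i (j + 1)" using F by (auto simp: set_valued_tableaux_def)
        then have "T (i, j) \<preceq> T (i, Suc j)" using Tc c by simp
        then show "a \<le> b" using set_order_iff(1)[of "T (i, j)" "T (i, Suc j)"] fin_ne c ab by blast
      }
      {
        assume ab: "a \<in> T (i, j)" "b \<in> T (Suc i, j)"
        then have c: "(i, j) \<in> diagram lam" "(Suc i, j) \<in> diagram lam" using cell by blast+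
        then have "entry F i j \<prec> entry F (i + 1) j" using F by (auto simp: set_valued_tableaux_def)
        then have "T (i, j) \<prec> T (Suc i, j)" using Tc c by simp
        then show "a < b" using set_order_iff(2)[of "T (i, j)" "T (Suc i, j)"] fin_ne c ab by blast
      }
    qed
    then show "T \<in> ?B" by (simp add: svt_of_content_def cnt)
  qed
  show "partial_filling ` ?B \<subseteq> ?A"
  proof
    fix F assume "F \<in> partial_filling ` ?B"
    then obtain T where T: "T \<in> total_svt n (part lam)"
      and cnt: "\<And>i. i < n \<Longrightarrow> multiplicity_of T (Suc i) = count m (Suc i)"
      and F: "F = partial_filling T" by (auto simp: svt_of_content_def)
    note T1 = total_svtD(1)[OF T] and T2 = total_svtD(2)[OF T]
    have dom: "dom F = diagram lam"
      using T1 by (auto simp: F partial_filling_def dom_def diagram_eq_cells split: if_splits)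
    have fin: "finite (T c)" for c using T2[of c] by (rule finite_subset) simp
    have ran: "ran F \<subseteq> SetP"
    proof
      fix S assume "S \<in> ran F"
      then obtain c where "S = T c" "T c \<noteq> {}" by (auto simp: F partial_filling_def ran_def split: if_splits)
      then show "S \<in> SetP" using T2[of c] fin[of c] by (auto simp: SetP_def)
    qed
    have e: "the (F c) = T c" if "c \<in> diagram lam" for c
      using that T1[of c] by (auto simp: F partial_filling_def diagram_eq_cells)
    have tot: "total_filling F = T"
      by (auto simp: F partial_filling_def total_filling_def fun_eq_iff)
    have "tableau_weight F = m"
    proof (rule multiset_eqI)
      fix k
      have "count (tableau_weight F) k = multiplicity_of T k"
        using count_tableau_weight[of F k] dom ran finite_diagram tot by simp
      also have "\<dots> = count m k"
      proof (cases "k \<in> {1..n}")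
        case True
        then obtain i where "k = Suc i" "i < n" by (cases k) auto
        then show ?thesis using cnt[of i] by simp
      next
        case False
        then have "{c. k \<in> T c} = {}" using T2 by blast
        moreover have "count m k = 0" using m False by (simp add: not_in_iff[symmetric] subset_iff) blast
        ultimately show ?thesis by (simp only: multiplicity_of_def card.empty)
      qed
      finally show "count (tableau_weight F) k = count m k" .
    qed
    moreover have "F \<in> set_valued_tableaux lam"
      unfolding set_valued_tableaux_def fillings_def
    proof (intro CollectI conjI allI impI)
      fix i j assume c: "(i, j) \<in> diagram lam \<and> (i, j + 1) \<in> diagram lam"
      then have "T (i, j) \<noteq> {}" "T (i, Suc j) \<noteq> {}" using T1 by (simp_all add: diagram_eq_cells)
      then have "T (i, j) \<preceq> T (i, Suc j)"
        using set_order_iff(1)[OF fin _ fin] total_svtD(3)[OF T] by blast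
      then show "entry F i j \<preceq> entry F i (j + 1)" using e c by simp
    next
      fix i j assume c: "(i, j) \<in> diagram lam \<and> (i + 1, j) \<in> diagram lam"
      then have "T (i, j) \<noteq> {}" "T (Suc i, j) \<noteq> {}" using T1 by (simp_all add: diagram_eq_cells)
      then have "T (i, j) \<prec> T (Suc i, j)"
        using set_order_iff(2)[OF fin _ fin] total_svtD(4)[OF T] by blast
      then show "entry F i j \<prec> entry F (i + 1) j" using e c by simp
    qed (use dom ran in auto)
    ultimately show "F \<in> ?A" by simp
  qed
qed

lemma size_mset_in_interval:
  assumes "set_mset m \<subseteq> {1..n}"
  shows "size m = (\<Sum>i<n. count m (Suc i))"
proof -
  have "size m = sum (count m) {1..n}"
    unfolding size_multiset_overloaded_eq using assms
    by (intro sum.mono_neutral_left) (auto simp: not_in_iff)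
  also have "{1..n} = Suc ` {..<n}" by (simp add: image_Suc_lessThan)
  finally show ?thesis by (simp add: sum.reindex)
qed

lemma s_bar_eq_card:
  assumes m: "set_mset m \<subseteq> {1..n}"
  shows "s_bar lam m = (-1) ^ ((\<Sum>i<n. count m (Suc i)) + sum_list lam) *
    of_nat (card (svt_of_content n (part lam) (\<lambda>i. count m (Suc i))))"
proof -
  let ?A = "{F \<in> set_valued_tableaux lam. tableau_weight F = m}"
  let ?f = "\<lambda>T. single_term ((- 1) ^ (tableau_size T - sum_list lam)) (tableau_weight T)"
  have "{T \<in> set_valued_tableaux lam. ?f T m \<noteq> 0} = ?A" by (auto simp: single_term_def)
  then have "s_bar lam m = (\<Sum>T\<in>?A. ?f T m)" by (simp add: s_bar_def formal_sum_def)
  also have "\<dots> = (\<Sum>T\<in>?A. (-1) ^ (size m + sum_list lam))"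
  proof (rule sum.cong[OF refl])
    fix T assume T: "T \<in> ?A"
    then have "sum_list lam \<le> size m" using set_valued_tableau_sizes[of T lam] by (simp add: tableau_size_eq)
    then have "(-1 :: int poly) ^ (size m - sum_list lam) = (-1) ^ (size m + sum_list lam)"
      by (metis even_add even_diff_nat linorder_not_less minus_one_power_iff)
    then show "?f T m = (-1) ^ (size m + sum_list lam)"
      using T by (simp add: single_term_def tableau_size_eq)
  qed
  also have "\<dots> = (-1) ^ (size m + sum_list lam) * of_nat (card ?A)" by simp
  also have "card ?A = card (svt_of_content n (part lam) (\<lambda>i. count m (Suc i)))"
    by (rule bij_betw_same_card[OF total_filling_bij[OF m]])
  finally show ?thesis by (simp only: size_mset_in_interval[OF m])
qed

lemma s_bar_eq_groth:
  assumes "is_partition lam" "length lam \<le> n" "set_mset m \<subseteq> {1..n}"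
  shows "s_bar lam m = groth n n (part lam) (\<lambda>i. count m (Suc i))"
  using groth_eq_signed_svt_count[OF part_Par[OF assms(1,2)] order_refl, of "\<lambda>i. count m (Suc i)"]
  by (simp add: s_bar_eq_card[OF assms(3)] sum_part[OF assms(2)])

text \<open>
  A tableau with more than \<open>n\<close> rows contains a letter larger than \<open>n\<close>.
\<close>

lemma s_bar_eq_0:
  assumes "is_partition lam" "n < length lam" "set_mset m \<subseteq> {1..n}"
  shows "s_bar lam m = 0"
proof -
  have "T \<notin> total_svt n (part lam)" for T
  proof
    assume T: "T \<in> total_svt n (part lam)"
    have "lam ! n \<noteq> 0" using assms(1,2) nth_mem[OF assms(2)] by (metis is_partition_def)
    then have "(Suc n, 1) \<in> cells (part lam)" using assms(2) by (simp add: part_def)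
    then obtain a where a: "a \<in> T (Suc n, 1)" using total_svtD(1)[OF T] by blast
    have "part lam (Suc i) \<le> part lam i" for i
      using Par_mono[OF part_Par[OF assms(1) order_refl], of i "Suc i"] by simp
    then have "Suc n \<le> a" using total_svt_entry_ge_row[OF T _ a] by blast
    moreover have "a \<le> n" using total_svtD(2)[OF T, of "(Suc n, 1)"] a by auto
    ultimately show False by simp
  qed
  then have "svt_of_content n (part lam) (\<lambda>i. count m (Suc i)) = {}" by (auto simp: svt_of_content_def)
  then show ?thesis by (simp add: s_bar_eq_card[OF assms(3)])
qed

section \<open>Fillings with entries bounded by the row\<close>

text \<open>
  The fillings \<open>V\<close> of the theorem for the inner shape \<open>\<mu>\<close>, with entries at most \<open>k\<close>, each one paired with the
  outer shape \<open>\<kappa>\<close>.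
\<close>

definition elegant :: "nat \<Rightarrow> nat \<Rightarrow> (nat \<Rightarrow> nat) \<Rightarrow> ((nat \<Rightarrow> nat) \<times> nat filling) set" where
  "elegant k n \<mu> = {(\<kappa>, V). \<kappa> \<in> Par n \<and> cells \<mu> \<subseteq> cells \<kappa> \<and> dom V = cells \<kappa> - cells \<mu> \<and>
     (\<forall>i j v. V (i, j) = Some v \<longrightarrow> 1 \<le> v \<and> v \<le> k \<and> v < i) \<and>
     (\<forall>i j j' v v'. V (i, j) = Some v \<and> V (i, j') = Some v' \<and> j < j' \<longrightarrow> v \<le> v') \<and>
     (\<forall>i i' j v v'. V (i, j) = Some v \<and> V (i', j) = Some v' \<and> i < i' \<longrightarrow> v < v')}"

lemma elegantD:
  assumes "(\<kappa>, V) \<in> elegant k n \<mu>"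
  shows "\<kappa> \<in> Par n" "cells \<mu> \<subseteq> cells \<kappa>" "dom V = cells \<kappa> - cells \<mu>"
    "V (i, j) = Some v \<Longrightarrow> 1 \<le> v \<and> v \<le> k \<and> v < i"
    "V (i, j) = Some v \<Longrightarrow> V (i, j') = Some v' \<Longrightarrow> j < j' \<Longrightarrow> v \<le> v'"
    "V (i, j) = Some v \<Longrightarrow> V (i', j) = Some v' \<Longrightarrow> i < i' \<Longrightarrow> v < v'"
  using assms unfolding elegant_def by blast+

lemma elegantI:
  assumes "\<kappa> \<in> Par n" "cells \<mu> \<subseteq> cells \<kappa>" "dom V = cells \<kappa> - cells \<mu>"
    "\<And>i j v. V (i, j) = Some v \<Longrightarrow> 1 \<le> v \<and> v \<le> k \<and> v < i"
    "\<And>i j j' v v'. V (i, j) = Some v \<Longrightarrow> V (i, j') = Some v' \<Longrightarrow> j < j' \<Longrightarrow> v \<le> v'"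
    "\<And>i i' j v v'. V (i, j) = Some v \<Longrightarrow> V (i', j) = Some v' \<Longrightarrow> i < i' \<Longrightarrow> v < v'"
  shows "(\<kappa>, V) \<in> elegant k n \<mu>"
  unfolding elegant_def mem_Collect_eq prod.case using assms by (intro conjI allI impI) blast+

definition shape_below :: "nat \<Rightarrow> (nat \<Rightarrow> nat) \<Rightarrow> nat filling \<Rightarrow> nat \<Rightarrow> nat" where
  "shape_below v \<kappa> V i = card {j. (Suc i, j) \<in> cells \<kappa> \<and> V (Suc i, j) \<noteq> Some v}"

definition fill_strip :: "nat \<Rightarrow> (nat \<Rightarrow> nat) \<Rightarrow> (nat \<Rightarrow> nat) \<Rightarrow> nat filling \<Rightarrow> nat filling" where
  "fill_strip v \<kappa> \<rho> V c = (if c \<in> cells \<kappa> - cells \<rho> then Some v else V c)"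

lemma cells_0 [simp]: "(0, j) \<notin> cells p"
  by (simp add: cells_def)

lemma cells_left: "(i, j') \<in> cells p \<Longrightarrow> 1 \<le> j \<Longrightarrow> j \<le> j' \<Longrightarrow> (i, j) \<in> cells p"
  by (auto simp: cells_def)

lemma cells_up: "p \<in> Par n \<Longrightarrow> (Suc i', j) \<in> cells p \<Longrightarrow> i \<le> i' \<Longrightarrow> (Suc i, j) \<in> cells p"
  using Par_mono[of p n i i'] by (auto)

text \<open>
  The cells with entry \<open>k + 1\<close> are at the ends of their rows, at most one in each column, and lie in rows
  after the first \<open>k + 1\<close>, so they form one of the strips in \<open>strips k\<close>.
\<close>

lemma remove_strip:
  assumes \<mu>: "\<mu> \<in> Par n" and V: "(\<kappa>, V) \<in> elegant (Suc k) n \<mu>"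
  defines "\<rho> \<equiv> shape_below (Suc k) \<kappa> V" and "V' \<equiv> V |` {c. V c \<noteq> Some (Suc k)}"
  shows "(\<rho>, V') \<in> elegant k n \<mu>" "\<kappa> \<in> strips k n \<rho>" "fill_strip (Suc k) \<kappa> \<rho> V' = V"
proof -
  note D = elegantD[OF V]
  have new: "c \<in> cells \<kappa> \<and> c \<notin> cells \<mu>" if "V c = Some v" for c v using D(3) that by blast
  have some: "\<exists>v. V c = Some v" if "c \<in> cells \<kappa>" "c \<notin> cells \<mu>" for c using D(3) that by blast
  have seg: "{j. (Suc i, j) \<in> cells \<kappa> \<and> V (Suc i, j) \<noteq> Some (Suc k)} = {1..\<rho> i}" for i
    unfolding \<rho>_def shape_below_def
  proof (rule initial_segment)
    show "finite {j. (Suc i, j) \<in> cells \<kappa> \<and> V (Suc i, j) \<noteq> Some (Suc k)}"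
      by (rule finite_subset[of _ "{1..\<kappa> i}"]) auto
    fix j :: nat assume j: "1 \<le> j" "Suc j \<in> {j. (Suc i, j) \<in> cells \<kappa> \<and> V (Suc i, j) \<noteq> Some (Suc k)}"
    then have c: "(Suc i, j) \<in> cells \<kappa>" by simp
    moreover have "V (Suc i, j) \<noteq> Some (Suc k)"
    proof
      assume v: "V (Suc i, j) = Some (Suc k)"
      then have "(Suc i, j) \<notin> cells \<mu>" using new by blast
      then have "(Suc i, Suc j) \<notin> cells \<mu>" using j by simp
      then obtain v' where v': "V (Suc i, Suc j) = Some v'" using some j by blast
      then have "Suc k \<le> v'" "v' \<le> Suc k" using D(5)[OF v v'] D(4)[OF v'] by auto
      then show False using v' j by simp
    qed
    ultimately show "j \<in> {j. (Suc i, j) \<in> cells \<kappa> \<and> V (Suc i, j) \<noteq> Some (Suc k)}" by simp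
  qed simp
  have cell: "c \<in> cells \<rho> \<longleftrightarrow> c \<in> cells \<kappa> \<and> V c \<noteq> Some (Suc k)" for c
  proof (cases c)
    case (Pair a j)
    show ?thesis
    proof (cases a)
      case (Suc i)
      have "j \<in> {j. (Suc i, j) \<in> cells \<kappa> \<and> V (Suc i, j) \<noteq> Some (Suc k)} \<longleftrightarrow> j \<in> {1..\<rho> i}"
        using seg[of i] by simp
      then show ?thesis using Pair Suc by simp
    qed (use Pair in simp)
  qed
  have up: "V (Suc i, j) \<noteq> Some (Suc k)" if c: "(Suc (Suc i), j) \<in> cells \<kappa>" for i j
  proof
    assume v: "V (Suc i, j) = Some (Suc k)"
    then have "(Suc i, j) \<notin> cells \<mu>" using new by blast
    then have "(Suc (Suc i), j) \<notin> cells \<mu>" using cells_up[OF \<mu>, of "Suc i" j i] by auto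
    then obtain v' where v': "V (Suc (Suc i), j) = Some v'" using some c by blast
    then show False using D(6)[OF v v'] D(4)[OF v'] by simp
  qed
  have le: "\<rho> i \<le> \<kappa> i" for i
    using cell cells_mono[of \<rho> \<kappa>] by blast
  have prev: "\<kappa> (Suc i) \<le> \<rho> i" for i
  proof (cases "\<kappa> (Suc i) = 0")
    case False
    then have c: "(Suc (Suc i), \<kappa> (Suc i)) \<in> cells \<kappa>" by simp
    then have "(Suc i, \<kappa> (Suc i)) \<in> cells \<kappa>" using cells_up[OF D(1), of "Suc i"] by auto
    then have "(Suc i, \<kappa> (Suc i)) \<in> cells \<rho>" using up[OF c] cell by blast
    then show ?thesis by simp
  qed simp
  have \<rho>: "\<rho> \<in> Par n"
  proof (rule ParI)
    show "\<rho> (Suc i) \<le> \<rho> i" for i using le[of "Suc i"] prev[of i] by simp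
    show "\<rho> i = 0" if "n \<le> i" for i using le[of i] Par_zero[OF D(1) that] by simp
  qed
  have "\<kappa> i = \<rho> i" if "i \<le> k" for i
  proof -
    have "V (Suc i, j) \<noteq> Some (Suc k)" for j using D(4)[of "Suc i" j "Suc k"] that by auto
    then have "{j. (Suc i, j) \<in> cells \<kappa> \<and> V (Suc i, j) \<noteq> Some (Suc k)} = {1..\<kappa> i}" by auto
    then have "{1..\<rho> i} = {1..\<kappa> i}" by (rule trans[OF seg[symmetric]])
    then show ?thesis by (metis card_atLeastAtMost diff_Suc_1)
  qed
  then show "\<kappa> \<in> strips k n \<rho>"
    unfolding strips_def
  proof (intro CollectI conjI allI impI)
    fix i assume "k < i \<and> i < n"
    then obtain i' where "i = Suc i'" by (cases i) auto
    then show "\<kappa> i \<le> \<rho> (i - 1)" using prev by simp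
  qed (use le Par_zero[OF D(1)] in auto)
  show "(\<rho>, V') \<in> elegant k n \<mu>"
  proof (rule elegantI[OF \<rho>])
    show "cells \<mu> \<subseteq> cells \<rho>" using D(2) new cell by blast
    show "dom V' = cells \<rho> - cells \<mu>" using D(3) cell by (auto simp: V'_def)
    have V': "V c = Some v \<and> v \<noteq> Suc k" if "V' c = Some v" for c v
      using that by (auto simp: V'_def restrict_map_def split: if_splits)
    show "1 \<le> v \<and> v \<le> k \<and> v < i" if "V' (i, j) = Some v" for i j v using V'[OF that] D(4)[of i j v] by auto
    show "v \<le> v'" if "V' (i, j) = Some v" "V' (i, j') = Some v'" "j < j'" for i j j' v v'
      using D(5) V' that by blast
    show "v < v'" if "V' (i, j) = Some v" "V' (i', j) = Some v'" "i < i'" for i i' j v v'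
      using D(6) V' that by blast
  qed
  show "fill_strip (Suc k) \<kappa> \<rho> V' = V"
  proof
    fix c
    have "V c = Some (Suc k)" if "c \<in> cells \<kappa> - cells \<rho>" using that cell by blast
    moreover have "V' c = V c" if "c \<notin> cells \<kappa> - cells \<rho>"
    proof -
      have "V c \<noteq> Some (Suc k)" using that cell new by blast
      then show ?thesis by (simp add: V'_def)
    qed
    ultimately show "fill_strip (Suc k) \<kappa> \<rho> V' c = V c" by (simp add: fill_strip_def)
  qed
qed

lemma fill_strip:
  assumes V: "(\<rho>, V) \<in> elegant k n \<mu>" and \<kappa>: "\<kappa> \<in> strips k n \<rho>"
  defines "V' \<equiv> fill_strip (Suc k) \<kappa> \<rho> V"
  shows "(\<kappa>, V') \<in> elegant (Suc k) n \<mu>" "shape_below (Suc k) \<kappa> V' = \<rho>"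
    "V' |` {c. V' c \<noteq> Some (Suc k)} = V"
proof -
  note D = elegantD[OF V]
  have \<kappa>P: "\<kappa> \<in> Par n" by (rule strips_Par[OF D(1) \<kappa>])
  have "\<rho> i \<le> \<kappa> i" for i
    using \<kappa> Par_zero[OF D(1), of i] unfolding strips_def mem_Collect_eq
    by (cases "i \<le> k"; cases "i < n") auto
  then have sub: "cells \<rho> \<subseteq> cells \<kappa>" by (simp add: cells_mono)
  have old: "c \<in> cells \<rho>" "c \<notin> cells \<mu>" if "V c = Some v" for c v using D(3) that by blast+
  have V': "V' c = (if c \<in> cells \<kappa> - cells \<rho> then Some (Suc k) else V c)" for c
    by (simp add: V'_def fill_strip_def)
  have Vk: "V c \<noteq> Some (Suc k)" for c using D(4)[of "fst c" "snd c" "Suc k"] by auto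
  have eq: "V' c = Some (Suc k) \<longleftrightarrow> c \<in> cells \<kappa> - cells \<rho>" for c using V' Vk by auto
  have row: "k < i" if c: "(Suc i, j) \<in> cells \<kappa> - cells \<rho>" for i j
  proof (rule ccontr)
    assume "\<not> k < i"
    then have "\<kappa> i = \<rho> i" using \<kappa> by (auto simp: strips_def)
    then show False using c by auto
  qed
  \<comment> \<open>Two new cells in one column would lie in adjacent rows of a horizontal strip.\<close>
  have strip: False
    if c: "(Suc a, j) \<in> cells \<kappa> - cells \<rho>" "(Suc b, j) \<in> cells \<kappa> - cells \<rho>" "a < b" for a b j
  proof -
    have "k < b" by (rule row[OF c(2)])
    moreover have "b < n" using c(2) Par_zero[OF \<kappa>P, of b] by (cases "b < n") auto
    ultimately have "\<kappa> b \<le> \<rho> (b - 1)" using \<kappa> by (auto simp: strips_def)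
    also have "\<dots> \<le> \<rho> a" using Par_mono[OF D(1), of a "b - 1"] c(3) by simp
    finally show False using c(1,2) by auto
  qed
  show "(\<kappa>, V') \<in> elegant (Suc k) n \<mu>"
  proof (rule elegantI[OF \<kappa>P])
    show "cells \<mu> \<subseteq> cells \<kappa>" using D(2) sub by blast
    have "c \<in> dom V' \<longleftrightarrow> c \<in> cells \<kappa> - cells \<rho> \<or> c \<in> dom V" for c
      using V'[of c] by (cases "c \<in> cells \<kappa> - cells \<rho>") (auto simp only: domIff if_True if_False)
    then show "dom V' = cells \<kappa> - cells \<mu>" using D(2,3) sub by blast
    show "1 \<le> v \<and> v \<le> Suc k \<and> v < i" if v: "V' (i, j) = Some v" for i j v
    proof (cases "(i, j) \<in> cells \<kappa> - cells \<rho>")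
      case True
      then obtain i' where "i = Suc i'" by (cases i) auto
      then show ?thesis using row[of i' j] True v V'[of "(i, j)"] by auto
    next
      case False
      then show ?thesis using v V'[of "(i, j)"] D(4)[of i j v] by auto
    qed
    then have bound: "v \<le> Suc k" if "V' (i, j) = Some v" for i j v using that by blast
    show "v \<le> v'" if v: "V' (i, j) = Some v" "V' (i, j') = Some v'" "j < j'" for i j j' v v'
    proof (cases "(i, j') \<in> cells \<kappa> - cells \<rho>")
      case True
      then show ?thesis using v(2) V'[of "(i, j')"] bound[OF v(1)] by simp
    next
      case False
      then have old': "V (i, j') = Some v'" using v(2) V'[of "(i, j')"] by auto
      then have "(i, j') \<in> cells \<rho>" using old(1) by blast
      have "(i, j) \<notin> cells \<kappa> - cells \<rho>"
      proof
        assume c: "(i, j) \<in> cells \<kappa> - cells \<rho>"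
        then have "1 \<le> j" by (auto simp: cells_def)
        then show False using cells_left[OF \<open>(i, j') \<in> cells \<rho>\<close>] c v(3) by auto
      qed
      then show ?thesis using D(5)[OF _ old' v(3)] v(1) V'[of "(i, j)"] by auto
    qed
    show "v < v'" if v: "V' (i, j) = Some v" "V' (i', j) = Some v'" "i < i'" for i i' j v v'
    proof (cases "(i', j) \<in> cells \<kappa> - cells \<rho>")
      case True
      then have v': "v' = Suc k" using v(2) V'[of "(i', j)"] by simp
      have "(i, j) \<notin> cells \<kappa> - cells \<rho>"
      proof
        assume c: "(i, j) \<in> cells \<kappa> - cells \<rho>"
        obtain a b where "i = Suc a" "i' = Suc b" using c True by (cases i; cases i') auto
        then show False using strip[of a j b] c True v(3) by auto
      qed
      then have "V (i, j) = Some v" using v(1) V'[of "(i, j)"] by auto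
      then show ?thesis using D(4)[of i j v] v' by simp
    next
      case False
      then have old': "V (i', j) = Some v'" using v(2) V'[of "(i', j)"] by auto
      then have c': "(i', j) \<in> cells \<rho>" using old(1) by blast
      have "(i, j) \<notin> cells \<kappa> - cells \<rho>"
      proof
        assume c: "(i, j) \<in> cells \<kappa> - cells \<rho>"
        obtain a b where "i = Suc a" "i' = Suc b" using c c' by (cases i; cases i') auto
        then show False using cells_up[OF D(1), of b j a] c c' v(3) by auto
      qed
      then show ?thesis using D(6)[OF _ old' v(3)] v(1) V'[of "(i, j)"] by auto
    qed
  qed
  show "shape_below (Suc k) \<kappa> V' = \<rho>"
  proof
    fix i
    have "{j. (Suc i, j) \<in> cells \<kappa> \<and> V' (Suc i, j) \<noteq> Some (Suc k)} = {j. (Suc i, j) \<in> cells \<rho>}"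
      using eq sub by blast
    also have "\<dots> = {1..\<rho> i}" by auto
    finally show "shape_below (Suc k) \<kappa> V' i = \<rho> i" by (simp only: shape_below_def card_atLeastAtMost diff_Suc_1)
  qed
  show "V' |` {c. V' c \<noteq> Some (Suc k)} = V"
  proof
    fix c
    have "V c = None" if "c \<in> cells \<kappa> - cells \<rho>" using that old(1)[of c] by (cases "V c") auto
    then show "(V' |` {c. V' c \<noteq> Some (Suc k)}) c = V c"
      using V'[of c] eq[of c] by (auto simp: restrict_map_def)
  qed
qed

lemma elegant_Suc:
  assumes "\<mu> \<in> Par n"
  shows "bij_betw (\<lambda>((\<rho>, V), \<kappa>). (\<kappa>, fill_strip (Suc k) \<kappa> \<rho> V))
    (SIGMA (\<rho>, V):elegant k n \<mu>. strips k n \<rho>) (elegant (Suc k) n \<mu>)"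
proof (rule bij_betw_byWitness[where
    f' = "\<lambda>(\<kappa>, V). ((shape_below (Suc k) \<kappa> V, V |` {c. V c \<noteq> Some (Suc k)}), \<kappa>)"])
qed (use remove_strip[OF assms] fill_strip in auto)

lemma elegant_0: "\<mu> \<in> Par n \<Longrightarrow> elegant 0 n \<mu> = {(\<mu>, Map.empty)}"
proof (intro equalityI subsetI)
  fix x assume \<mu>: "\<mu> \<in> Par n" and x: "x \<in> elegant 0 n \<mu>"
  obtain \<kappa> V where xV: "x = (\<kappa>, V)" by (cases x)
  note D = elegantD[OF x[unfolded xV]]
  have "V c = None" for c using D(4)[of "fst c" "snd c"] by (cases "V c") auto
  then have "V = Map.empty" by auto
  then have "cells \<kappa> = cells \<mu>" using D(2,3) by auto
  then have "\<kappa> i = \<mu> i" for i using cells_mono[of \<kappa> \<mu>] cells_mono[of \<mu> \<kappa>] by (simp add: le_antisym)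
  then show "x \<in> {(\<mu>, Map.empty)}" using xV \<open>V = Map.empty\<close> by auto
next
  fix x assume "\<mu> \<in> Par n" "x \<in> {(\<mu>, Map.empty :: nat filling)}"
  then show "x \<in> elegant 0 n \<mu>" by (auto intro!: elegantI)
qed

text \<open>
  Each additional letter accounts for one application of \<open>groth_strips\<close>.
\<close>

lemma sum_elegant:
  assumes "\<mu> \<in> Par n"
  shows "finite (elegant k n \<mu>) \<and> groth 0 n \<mu> \<gamma> = (\<Sum>(\<kappa>, V)\<in>elegant k n \<mu>. groth k n \<kappa> \<gamma>)"
proof (induction k)
  case 0
  then show ?case by (simp add: elegant_0[OF assms])
next
  case (Suc k)
  let ?S = "SIGMA x:elegant k n \<mu>. strips k n (fst x)"
  have S: "(SIGMA (\<rho>, V):elegant k n \<mu>. strips k n \<rho>) = ?S" by auto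
  note bij = elegant_Suc[OF assms, of k, unfolded S]
  have "finite ?S" using Suc finite_strips by (intro finite_SigmaI) auto
  then have fin: "finite (elegant (Suc k) n \<mu>)" using bij_betw_finite[OF bij] by blast
  have "groth 0 n \<mu> \<gamma> = (\<Sum>x\<in>elegant k n \<mu>. groth k n (fst x) \<gamma>)"
    using Suc by (simp add: case_prod_unfold)
  also have "\<dots> = (\<Sum>x\<in>elegant k n \<mu>. \<Sum>\<kappa>\<in>strips k n (fst x). groth (Suc k) n \<kappa> \<gamma>)"
  proof (rule sum.cong[OF refl])
    fix x assume "x \<in> elegant k n \<mu>"
    then have "fst x \<in> Par n" using elegantD(1)[of "fst x" "snd x"] by simp
    then show "groth k n (fst x) \<gamma> = (\<Sum>\<kappa>\<in>strips k n (fst x). groth (Suc k) n \<kappa> \<gamma>)"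
      by (rule groth_strips)
  qed
  also have "\<dots> = (\<Sum>y\<in>?S. groth (Suc k) n (snd y) \<gamma>)"
    using Suc finite_strips by (subst sum.Sigma) (auto simp: case_prod_unfold)
  also have "\<dots> = (\<Sum>y\<in>?S. groth (Suc k) n
      (fst ((\<lambda>((\<rho>, V), \<kappa>). (\<kappa>, fill_strip (Suc k) \<kappa> \<rho> V)) y)) \<gamma>)"
    by (simp add: case_prod_unfold)
  also have "\<dots> = (\<Sum>x\<in>elegant (Suc k) n \<mu>. groth (Suc k) n (fst x) \<gamma>)"
    by (rule sum.reindex_bij_betw[OF bij])
  finally show ?case using fin by (simp add: case_prod_unfold)
qed

section \<open>Set colorings as arrays\<close>

text \<open>
  As long as the permutation has a descent, an adjacent transposition removes one and does not change the
  value of \<open>c\<close>.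
\<close>

lemma symmetric_permute:
  fixes c :: "(nat \<Rightarrow> int) \<Rightarrow> 'a"
  assumes sym: "\<And>\<gamma> i. Suc i < n \<Longrightarrow> c (\<gamma> \<circ> transpose i (Suc i)) = c \<gamma>"
    and \<sigma>: "\<sigma> permutes {..<n}"
  shows "c (\<gamma> \<circ> \<sigma>) = c \<gamma>"
  using \<sigma>
\<comment> \<open>This sum decreases whenever a descent is removed.\<close>
proof (induction "\<Sum>i<n. (n - i) * \<sigma> i" arbitrary: \<sigma> rule: less_induct)
  case less
  show ?case
  proof (cases "\<sigma> = id")
    case False
    then obtain i where i: "Suc i < n" "\<sigma> (Suc i) < \<sigma> i" using permutes_descent[OF less.prems] by blast
    let ?\<sigma> = "\<sigma> \<circ> transpose i (Suc i)"
    have a: "(\<Sum>k<n. (n - k) * ?\<sigma> k) =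
        (n - i) * \<sigma> (Suc i) + (n - Suc i) * \<sigma> i + (\<Sum>k\<in>{..<n} - {i, Suc i}. (n - k) * \<sigma> k)"
      using i by (subst sum_remove_two[of _ i "Suc i"]) (auto simp: transpose_apply_other intro!: sum.cong)
    have b: "(\<Sum>k<n. (n - k) * \<sigma> k) =
        (n - i) * \<sigma> i + (n - Suc i) * \<sigma> (Suc i) + (\<Sum>k\<in>{..<n} - {i, Suc i}. (n - k) * \<sigma> k)"
      using i by (subst sum_remove_two[of _ i "Suc i"]) auto
    have "n - i = Suc (n - Suc i)" using i by simp
    then have lt: "(\<Sum>k<n. (n - k) * ?\<sigma> k) < (\<Sum>k<n. (n - k) * \<sigma> k)" unfolding a b using i by simp
    have "?\<sigma> permutes {..<n}" using permutes_compose_transpose[OF less.prems] i by simp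
    then have "c (\<gamma> \<circ> ?\<sigma>) = c \<gamma>" using less.hyps lt by blast
    moreover have "c (\<gamma> \<circ> ?\<sigma>) = c (\<gamma> \<circ> \<sigma>)" using sym[OF i(1), of "\<gamma> \<circ> \<sigma>"] by (simp only: comp_assoc)
    ultimately show ?thesis by simp
  qed simp
qed

context unit_interval_poset
begin

lemma array_count_reverse:
  "array_count n (\<lambda>i. \<gamma> (n - Suc i)) = array_count n \<gamma>"
proof -
  define \<sigma> where "\<sigma> i = (if i < n then n - Suc i else i)" for i
  have "\<sigma> permutes {..<n}"
  proof (rule bij_imp_permutes)
    show "bij_betw \<sigma> {..<n} {..<n}"
      by (rule bij_betw_byWitness[where f' = \<sigma>]) (auto simp: \<sigma>_def)
  qed (simp add: \<sigma>_def)
  then have "array_count n (\<gamma> \<circ> \<sigma>) = array_count n \<gamma>"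
    by (rule symmetric_permute[rotated]) (rule array_count_symmetric)
  moreover have "array_count n (\<gamma> \<circ> \<sigma>) = array_count n (\<lambda>i. \<gamma> (n - Suc i))"
    by (rule array_count_cong) (simp add: \<sigma>_def)
  ultimately show ?thesis by simp
qed

lemma edge_iff: "{u, v} \<in> snd (inc P r) \<longleftrightarrow> incomp u v"
  using incomp_sym by (auto simp: inc_def doubleton_eq_iff)

text \<open>
  Row \<open>i\<close> is the class of color \<open>n - i\<close>. Listing the colors from the largest to the smallest turns ascents of
  the coloring into inversions of the array.
\<close>

definition array_of_coloring :: "nat \<Rightarrow> (nat \<Rightarrow> nat set) \<Rightarrow> nat \<Rightarrow> nat set" where
  "array_of_coloring n \<kappa> i = (if i < n then {v \<in> P. n - i \<in> \<kappa> v} else {})"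

definition coloring_of_array :: "nat \<Rightarrow> (nat \<Rightarrow> nat set) \<Rightarrow> nat \<Rightarrow> nat set" where
  "coloring_of_array n C = restrict (\<lambda>v. {k \<in> {1..n}. v \<in> C (n - k)}) P"

lemma count_coloring_weight:
  assumes "\<kappa> \<in> P \<rightarrow>\<^sub>E SetP"
  shows "count (\<Sum>v\<in>P. mset_set (\<kappa> v)) k = card {v \<in> P. k \<in> \<kappa> v}"
proof -
  have "finite (\<kappa> v)" if "v \<in> P" for v using assms that by (auto simp: SetP_def PiE_iff)
  then have "count (\<Sum>v\<in>P. mset_set (\<kappa> v)) k = (\<Sum>v\<in>P. if k \<in> \<kappa> v then 1 else 0)"
    unfolding count_sum by (intro sum.cong refl) (simp add: count_mset_set')
  then show ?thesis using finite_P by (simp add: sum.inter_filter[symmetric])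
qed

lemma coloring_bij:
  assumes m: "set_mset m \<subseteq> {1..n}"
  shows "bij_betw (array_of_coloring n)
    {\<kappa> \<in> proper_set_colorings (inc P r). (\<Sum>v\<in>P. mset_set (\<kappa> v)) = m}
    {C \<in> arrays n. \<forall>i<n. card (C i) = count m (n - i)}"
    (is "bij_betw _ ?A ?B")
proof (rule bij_betw_byWitness[where f' = "coloring_of_array n"])
  have A: "\<kappa> \<in> P \<rightarrow>\<^sub>E SetP" "\<And>u v. incomp u v \<Longrightarrow> \<kappa> u \<inter> \<kappa> v = {}"
      "\<And>k. card {v \<in> P. k \<in> \<kappa> v} = count m k" if "\<kappa> \<in> ?A" for \<kappa>
  proof -
    show \<kappa>: "\<kappa> \<in> P \<rightarrow>\<^sub>E SetP" using that by (simp add: proper_set_colorings_def inc_def)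
    show "\<kappa> u \<inter> \<kappa> v = {}" if "incomp u v" for u v
      using \<open>\<kappa> \<in> ?A\<close> that edge_iff[of u v] unfolding proper_set_colorings_def by blast
    show "card {v \<in> P. k \<in> \<kappa> v} = count m k" for k
      using count_coloring_weight[OF \<kappa>, of k] that by simp
  qed
  have range: "\<kappa> v \<subseteq> {1..n}" if "\<kappa> \<in> ?A" "v \<in> P" for \<kappa> v
  proof
    fix k assume "k \<in> \<kappa> v"
    then have "{v \<in> P. k \<in> \<kappa> v} \<noteq> {}" using that(2) by blast
    moreover have "finite {v \<in> P. k \<in> \<kappa> v}" using finite_P by simp
    ultimately have "card {v \<in> P. k \<in> \<kappa> v} \<noteq> 0" by (simp only: card_eq_0_iff simp_thms)
    then have "count m k \<noteq> 0" using A(3)[OF that(1), of k] by (simp only: simp_thms)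
    then have "k \<in># m" by (simp only: count_eq_zero_iff simp_thms)
    then show "k \<in> {1..n}" using m by blast
  qed
  show "\<forall>\<kappa>\<in>?A. coloring_of_array n (array_of_coloring n \<kappa>) = \<kappa>"
  proof (intro ballI ext)
    fix \<kappa> v assume \<kappa>: "\<kappa> \<in> ?A"
    show "coloring_of_array n (array_of_coloring n \<kappa>) v = \<kappa> v"
    proof (cases "v \<in> P")
      case True
      then show ?thesis using range[OF \<kappa> True] by (auto simp: coloring_of_array_def array_of_coloring_def)
    next
      case False
      then show ?thesis using A(1)[OF \<kappa>] by (simp add: coloring_of_array_def PiE_def extensional_def)
    qed
  qed
  show "\<forall>C\<in>?B. array_of_coloring n (coloring_of_array n C) = C"
  proof (intro ballI ext)
    fix C i assume C: "C \<in> ?B"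
    then have sub: "C i \<subseteq> P" and out: "n \<le> i \<Longrightarrow> C i = {}" by (auto simp: arrays_def chain_def)
    show "array_of_coloring n (coloring_of_array n C) i = C i"
    proof (cases "i < n")
      case True
      then have "n - (n - i) = i" "1 \<le> n - i" "n - i \<le> n" by auto
      then show ?thesis using sub True by (auto simp: array_of_coloring_def coloring_of_array_def)
    next
      case False
      then show ?thesis using out by (simp add: array_of_coloring_def)
    qed
  qed
  show "array_of_coloring n ` ?A \<subseteq> ?B"
  proof
    fix C assume "C \<in> array_of_coloring n ` ?A"
    then obtain \<kappa> where \<kappa>: "\<kappa> \<in> ?A" and C: "C = array_of_coloring n \<kappa>" by blast
    have "chain (C i)" for i
      using A(2)[OF \<kappa>] by (auto simp: chain_def C array_of_coloring_def)
    moreover have "(\<Union>i. C i) = P"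
    proof
      show "(\<Union>i. C i) \<subseteq> P" by (auto simp: C array_of_coloring_def split: if_splits)
      show "P \<subseteq> (\<Union>i. C i)"
      proof
        fix v assume v: "v \<in> P"
        then have "\<kappa> v \<noteq> {}" using A(1)[OF \<kappa>] by (auto simp: PiE_iff SetP_def)
        then obtain k where k: "k \<in> \<kappa> v" by blast
        then have "1 \<le> k" "k \<le> n" using range[OF \<kappa> v] by auto
        then have "v \<in> C (n - k)" using k v by (simp add: C array_of_coloring_def)
        then show "v \<in> (\<Union>i. C i)" by blast
      qed
    qed
    ultimately have "C \<in> arrays n" by (auto simp: arrays_def C array_of_coloring_def)
    moreover have "card (C i) = count m (n - i)" if "i < n" for i
      using A(3)[OF \<kappa>, of "n - i"] that by (simp add: C array_of_coloring_def)
    ultimately show "C \<in> ?B" by simp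
  qed
  show "coloring_of_array n ` ?B \<subseteq> ?A"
  proof
    fix \<kappa> assume "\<kappa> \<in> coloring_of_array n ` ?B"
    then obtain C where C: "C \<in> arrays n" "\<And>i. i < n \<Longrightarrow> card (C i) = count m (n - i)"
      and \<kappa>: "\<kappa> = coloring_of_array n C" by blast
    have \<kappa>v: "\<kappa> v = {k \<in> {1..n}. v \<in> C (n - k)}" if "v \<in> P" for v
      using that by (simp add: \<kappa> coloring_of_array_def)
    have PiE: "\<kappa> \<in> P \<rightarrow>\<^sub>E SetP"
    proof (rule PiE_I)
      fix v assume v: "v \<in> P"
      then obtain i where i: "v \<in> C i" using C(1) by (auto simp: arrays_def)
      then have "i < n" using C(1) by (cases "i < n") (auto simp: arrays_def)
      then have "n - i \<in> \<kappa> v" using i \<kappa>v[OF v] by auto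
      then show "\<kappa> v \<in> SetP" using \<kappa>v[OF v] by (auto simp: SetP_def)
    qed (simp add: \<kappa> coloring_of_array_def)
    have disj: "\<kappa> u \<inter> \<kappa> v = {}" if "incomp u v" for u v
    proof -
      have "u \<in> P" "v \<in> P" using that by (auto simp: incomparable_def)
      moreover have "chain (C i)" for i using C(1) by (simp add: arrays_def)
      ultimately show ?thesis using that \<kappa>v by (auto simp: chain_def)
    qed
    have "(\<Sum>v\<in>P. mset_set (\<kappa> v)) = m"
    proof (rule multiset_eqI)
      fix k
      show "count (\<Sum>v\<in>P. mset_set (\<kappa> v)) k = count m k"
      proof (cases "k \<in> {1..n}")
        case True
        have "C (n - k) \<subseteq> P" using C(1) by (auto simp: arrays_def)
        then have "{v \<in> P. k \<in> \<kappa> v} = C (n - k)" using True \<kappa>v by auto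
        then show ?thesis using count_coloring_weight[OF PiE, of k] C(2)[of "n - k"] True by simp
      next
        case False
        then have "{v \<in> P. k \<in> \<kappa> v} = {}" using \<kappa>v by auto
        moreover have "count m k = 0" using m False by (meson not_in_iff subsetD)
        ultimately show ?thesis using count_coloring_weight[OF PiE, of k] by (simp only: card.empty)
      qed
    qed
    then show "\<kappa> \<in> ?A" using PiE disj edge_iff by (auto simp: proper_set_colorings_def inc_def)
  qed
qed

lemma array_inversions_card:
  assumes "C \<in> arrays n"
  shows "array_inversions n C =
    card {(k, i, x, y). k < n \<and> i < k \<and> x \<in> C i \<and> y \<in> C k \<and> incomp x y \<and> y < x}"
proof -
  have fin: "finite (C k)" for k using assms chain_finite by (auto simp: arrays_def)
  let ?S = "\<lambda>i k. {(x, y). x \<in> C i \<and> y \<in> C k \<and> incomp x y \<and> y < x}"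
  have finS: "finite (?S i k)" for i k
    by (rule finite_subset[of _ "C i \<times> C k"]) (use fin in auto)
  have "{(k, i, x, y). k < n \<and> i < k \<and> x \<in> C i \<and> y \<in> C k \<and> incomp x y \<and> y < x} =
      (SIGMA k:{..<n}. SIGMA i:{..<k}. ?S i k)" by auto
  then show ?thesis using finS by (simp add: array_inversions_def inversions_def)
qed

lemma asc_array_of_coloring:
  assumes \<kappa>: "\<And>v. v \<in> P \<Longrightarrow> \<kappa> v \<subseteq> {1..n}" and C: "array_of_coloring n \<kappa> \<in> arrays n"
  shows "asc (inc P r) \<kappa> = array_inversions n (array_of_coloring n \<kappa>)"
proof -
  let ?C = "array_of_coloring n \<kappa>"
  let ?L = "{(u, v, i, j). {u, v} \<in> snd (inc P r) \<and> u < v \<and> i \<in> \<kappa> u \<and> j \<in> \<kappa> v \<and> i < j}"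
  let ?R = "{(k, i, x, y). k < n \<and> i < k \<and> x \<in> ?C i \<and> y \<in> ?C k \<and> incomp x y \<and> y < x}"
  have "bij_betw (\<lambda>(u, v, i, j). (n - i, n - j, v, u)) ?L ?R"
  proof (rule bij_betw_byWitness[where f' = "\<lambda>(k, i, x, y). (y, x, n - k, n - i)"])
    have L: "1 \<le> i \<and> i < j \<and> j \<le> n \<and> u \<in> P \<and> v \<in> P \<and> incomp u v" if "(u, v, i, j) \<in> ?L" for u v i j
    proof -
      have inc: "incomp u v" using that edge_iff by simp
      then have "u \<in> P" "v \<in> P" by (auto simp: incomparable_def)
      then show ?thesis using \<kappa>[of u] \<kappa>[of v] that inc by auto
    qed
    show "\<forall>x\<in>?L. (\<lambda>(k, i, x, y). (y, x, n - k, n - i)) ((\<lambda>(u, v, i, j). (n - i, n - j, v, u)) x) = x"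
      using L by fastforce
    show "\<forall>x\<in>?R. (\<lambda>(u, v, i, j). (n - i, n - j, v, u)) ((\<lambda>(k, i, x, y). (y, x, n - k, n - i)) x) = x"
      by auto
    show "(\<lambda>(u, v, i, j). (n - i, n - j, v, u)) ` ?L \<subseteq> ?R"
    proof
      fix z assume "z \<in> (\<lambda>(u, v, i, j). (n - i, n - j, v, u)) ` ?L"
      then obtain u v i j where z: "z = (n - i, n - j, v, u)" and uv: "(u, v, i, j) \<in> ?L" by auto
      note l = L[OF uv]
      have "v \<in> ?C (n - j)" "u \<in> ?C (n - i)" using uv l by (auto simp: array_of_coloring_def)
      then show "z \<in> ?R" using l uv incomp_sym z by auto
    qed
    show "(\<lambda>(k, i, x, y). (y, x, n - k, n - i)) ` ?R \<subseteq> ?L"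
      using edge_iff incomp_sym by (auto simp: array_of_coloring_def split: if_splits)
  qed
  then have "card ?L = card ?R" by (rule bij_betw_same_card)
  then show ?thesis unfolding asc_def array_inversions_card[OF C] .
qed

lemma X_bar_eq_array_count:
  assumes m: "set_mset m \<subseteq> {1..n}"
  shows "X_bar (inc P r) m = array_count n (\<lambda>i. int (count m (Suc i)))"
proof -
  let ?A = "{\<kappa> \<in> proper_set_colorings (inc P r). (\<Sum>v\<in>P. mset_set (\<kappa> v)) = m}"
  let ?f = "\<lambda>\<kappa>. single_term (monom 1 (asc (inc P r) \<kappa>)) (\<Sum>v\<in>P. mset_set (\<kappa> v))"
  note bij = coloring_bij[OF m]
  have "{\<kappa> \<in> proper_set_colorings (inc P r). ?f \<kappa> m \<noteq> 0} = ?A" by (auto simp: single_term_def)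
  then have "X_bar (inc P r) m = (\<Sum>\<kappa>\<in>?A. ?f \<kappa> m)" by (simp add: X_bar_def formal_sum_def inc_def)
  also have "\<dots> = (\<Sum>\<kappa>\<in>?A. monom 1 (array_inversions n (array_of_coloring n \<kappa>)))"
  proof (rule sum.cong[OF refl])
    fix \<kappa> assume \<kappa>: "\<kappa> \<in> ?A"
    have C: "array_of_coloring n \<kappa> \<in> arrays n" using bij_betwE[OF bij] \<kappa> by blast
    have w: "(\<Sum>v\<in>P. mset_set (\<kappa> v)) = m" and k: "\<kappa> \<in> P \<rightarrow>\<^sub>E SetP"
      using \<kappa> by (auto simp: proper_set_colorings_def inc_def)
    have "\<kappa> v \<subseteq> {1..n}" if v: "v \<in> P" for v
    proof -
      have "finite (\<kappa> v)" using k v by (auto simp: SetP_def PiE_iff)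
      then have "\<kappa> v = set_mset (mset_set (\<kappa> v))" by simp
      also have "\<dots> \<subseteq> set_mset m" unfolding w[symmetric] using finite_P v by (auto simp: set_mset_sum)
      finally show ?thesis using m by blast
    qed
    then have "asc (inc P r) \<kappa> = array_inversions n (array_of_coloring n \<kappa>)"
      by (rule asc_array_of_coloring[OF _ C])
    then show "?f \<kappa> m = monom 1 (array_inversions n (array_of_coloring n \<kappa>))"
      using w by (simp add: single_term_def)
  qed
  also have "\<dots> = (\<Sum>C\<in>{C \<in> arrays n. \<forall>i<n. card (C i) = count m (n - i)}. monom 1 (array_inversions n C))"
    by (rule sum.reindex_bij_betw[OF bij])
  also have "\<dots> = array_count n (\<lambda>i. int (count m (n - i)))"
    unfolding array_count_def by (simp only: of_nat_eq_iff)
  also have "\<dots> = array_count n (\<lambda>i. int (count m (Suc (n - Suc i))))"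
    by (rule array_count_cong) (simp add: Suc_diff_Suc)
  also have "\<dots> = array_count n (\<lambda>i. int (count m (Suc i)))" by (rule array_count_reverse)
  finally show ?thesis .
qed

section \<open>Tableaux of the poset as arrays\<close>

lemma column_bij:
  assumes "finite D"
  shows "bij_betw (column D) D {1..card D}"
proof -
  have inj: "inj_on (column D) D" using column_inject[OF assms] by (auto simp: inj_on_def)
  have "column D ` D \<subseteq> {1..card D}"
  proof
    fix j assume "j \<in> column D ` D"
    then obtain x where x: "x \<in> D" "j = column D x" by blast
    then have "{z \<in> D. z \<le> x} \<noteq> {}" by blast
    then have "column D x \<noteq> 0" using assms by (auto simp: column_def)
    moreover have "column D x \<le> card D" unfolding column_def using assms by (intro card_mono) auto
    ultimately show "j \<in> {1..card D}" using x by auto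
  qed
  moreover have "card (column D ` D) = card {1..card D}" using card_image[OF inj] by simp
  ultimately have "column D ` D = {1..card D}" by (intro card_subset_eq) auto
  then show ?thesis using inj by (simp add: bij_betw_def)
qed

lemma column_exists:
  "finite D \<Longrightarrow> 1 \<le> j \<Longrightarrow> j \<le> card D \<Longrightarrow> \<exists>x\<in>D. column D x = j"
  using column_bij[of D] by (auto simp: bij_betw_def image_iff) (metis atLeastAtMost_iff imageE)

lemma column_range: "finite D \<Longrightarrow> x \<in> D \<Longrightarrow> 1 \<le> column D x \<and> column D x \<le> card D"
  using column_bij[of D] by (fastforce simp: bij_betw_def)

lemma column_strict_mono: "finite D \<Longrightarrow> x \<in> D \<Longrightarrow> y \<in> D \<Longrightarrow> column D x < column D y \<Longrightarrow> x < y"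
proof (rule ccontr)
  assume "finite D" "column D x < column D y" "\<not> x < y"
  then have "column D y \<le> column D x" unfolding column_def by (intro card_mono) auto
  then show False using \<open>column D x < column D y\<close> by simp
qed

text \<open>
  The elements of a chain that are above \<open>y\<close> form a final segment.
\<close>

lemma not_below_card_iff:
  assumes "chain D" "x \<in> D"
  shows "card {z \<in> D. \<not> below y z} < column D x \<longleftrightarrow> below y x"
proof
  have fin: "finite D" using assms(1) by (rule chain_finite)
  assume b: "below y x"
  have "below y z" if "z \<in> D" "x < z" for z
    using below_trans[OF b chain_below[OF assms that]] .
  then have "{z \<in> D. \<not> below y z} \<subset> {z \<in> D. z \<le> x}"
    using b assms(2) by (auto simp: not_le[symmetric])
  then show "card {z \<in> D. \<not> below y z} < column D x"
    unfolding column_def using fin by (intro psubset_card_mono) auto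
next
  have fin: "finite D" using assms(1) by (rule chain_finite)
  assume c: "card {z \<in> D. \<not> below y z} < column D x"
  show "below y x"
  proof (rule ccontr)
    assume nb: "\<not> below y x"
    have "\<not> below y z" if "z \<in> D" "z \<le> x" for z
    proof
      assume yz: "below y z"
      have "z = x \<or> below z x" using chain_below[OF assms(1) that(1) assms(2)] that(2) by (cases "z = x") auto
      then show False using yz nb below_trans by blast
    qed
    then have "column D x \<le> card {z \<in> D. \<not> below y z}"
      unfolding column_def using fin by (intro card_mono) auto
    then show False using c by simp
  qed
qed

text \<open>
  Row \<open>i\<close> of the array, sorted in increasing order, becomes row \<open>i + 1\<close> of the tableau.
\<close>

definition tableau_of_array :: "(nat \<Rightarrow> nat set) \<Rightarrow> nat filling" where
  "tableau_of_array C = (\<lambda>(a, j). case a of 0 \<Rightarrow> None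
     | Suc i \<Rightarrow> if \<exists>x\<in>C i. column (C i) x = j then Some (THE x. x \<in> C i \<and> column (C i) x = j) else None)"

definition array_of_tableau :: "nat filling \<Rightarrow> nat \<Rightarrow> nat set" where
  "array_of_tableau U i = {x. \<exists>j. U (Suc i, j) = Some x}"

lemma tableau_of_array_eq:
  assumes "finite (C i)"
  shows "tableau_of_array C (Suc i, j) = Some x \<longleftrightarrow> x \<in> C i \<and> column (C i) x = j"
proof -
  have the: "(THE x. x \<in> C i \<and> column (C i) x = j) = y" if "y \<in> C i" "column (C i) y = j" for y
    using that column_inject[OF assms] by (intro the_equality) auto
  show ?thesis using the by (auto simp: tableau_of_array_def)
qed

lemma tableau_of_array_0 [simp]: "tableau_of_array C (0, j) = None"
  by (simp add: tableau_of_array_def)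

lemma tableau_ext:
  fixes U U' :: "nat filling"
  assumes "\<And>j. U (0, j) = None" "\<And>j. U' (0, j) = None"
    "\<And>i j x. U (Suc i, j) = Some x \<longleftrightarrow> U' (Suc i, j) = Some x"
  shows "U = U'"
proof
  fix c :: "nat \<times> nat"
  obtain a j where c: "c = (a, j)" by (cases c)
  show "U c = U' c"
  proof (cases a)
    case 0
    then show ?thesis using c assms(1,2) by simp
  next
    case (Suc i)
    then show ?thesis using c assms(3)[of i j] by (cases "U c"; cases "U' c") auto
  qed
qed

lemma array_of_tableau_of_array:
  assumes "C \<in> arrays n"
  shows "array_of_tableau (tableau_of_array C) = C"
proof
  fix i
  have "finite (C i)" using assms chain_finite by (auto simp: arrays_def)
  then show "array_of_tableau (tableau_of_array C) i = C i"
    by (auto simp: array_of_tableau_def tableau_of_array_eq)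
qed

lemma dom_tableau_of_array:
  assumes "C \<in> arrays n"
  shows "dom (tableau_of_array C) = cells (\<lambda>i. card (C i))"
proof -
  have fin: "finite (C i)" for i using assms chain_finite by (auto simp: arrays_def)
  have "(a, j) \<in> dom (tableau_of_array C) \<longleftrightarrow> (a, j) \<in> cells (\<lambda>i. card (C i))" for a j
  proof (cases a)
    case 0
    then show ?thesis by (auto simp: domIff)
  next
    case (Suc i)
    have "(Suc i, j) \<in> dom (tableau_of_array C) \<longleftrightarrow> (\<exists>x\<in>C i. column (C i) x = j)"
      using tableau_of_array_eq[of C i j, OF fin] by (auto simp: dom_def)
    also have "\<dots> \<longleftrightarrow> 1 \<le> j \<and> j \<le> card (C i)"
      using column_exists[OF fin] column_range[OF fin] by blast
    finally show ?thesis using Suc by simp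
  qed
  then show ?thesis by auto
qed

text \<open>
  Where both cells exist, a violated column condition is the same as a flaw.
\<close>

lemma tableau_of_array_P_tableau:
  assumes C: "C \<in> arrays n" "unflawed C" and mu: "part mu = (\<lambda>i. card (C i))"
  shows "tableau_of_array C \<in> P_tableaux P r mu"
proof -
  let ?U = "tableau_of_array C"
  have chains: "chain (C i)" for i using C by (simp add: arrays_def)
  have fin: "finite (C i)" for i using chains chain_finite by blast
  have dom: "dom ?U = diagram mu" by (simp add: dom_tableau_of_array[OF C(1)] diagram_eq_cells mu)
  have val: "\<exists>a x. i = Suc a \<and> ?U (i, j) = Some x \<and> x \<in> C a \<and> column (C a) x = j"
    if "(i, j) \<in> diagram mu" for i j
  proof -
    have "(i, j) \<in> dom ?U" using dom that by simp
    then obtain x where x: "?U (i, j) = Some x" by blast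
    then obtain a where "i = Suc a" by (cases i) auto
    then show ?thesis using x tableau_of_array_eq[of C a j x, OF fin] by simp
  qed
  have ran: "ran ?U = P"
  proof
    show "ran ?U \<subseteq> P"
    proof
      fix x assume "x \<in> ran ?U"
      then obtain c where c: "?U c = Some x" by (auto simp: ran_def)
      obtain i j where ij: "c = (i, j)" by (cases c)
      then obtain a where "i = Suc a" using c by (cases i) auto
      then have "x \<in> C a" using c ij tableau_of_array_eq[of C a j x, OF fin] by simp
      then show "x \<in> P" using chains by (auto simp: chain_def)
    qed
    show "P \<subseteq> ran ?U"
    proof
      fix x assume "x \<in> P"
      then obtain i where "x \<in> C i" using C(1) by (auto simp: arrays_def)
      then have "?U (Suc i, column (C i) x) = Some x" using tableau_of_array_eq[of C i _ x, OF fin] by simp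
      then show "x \<in> ran ?U" by (rule ranI)
    qed
  qed
  show ?thesis
    unfolding P_tableaux_def fillings_def
  proof (intro CollectI conjI allI impI)
    fix i j assume c: "(i, j) \<in> diagram mu \<and> (i, j + 1) \<in> diagram mu"
    obtain a x where x: "i = Suc a" "?U (i, j) = Some x" "x \<in> C a" "column (C a) x = j"
      using val c by blast
    obtain y where y: "?U (i, j + 1) = Some y" "y \<in> C a" "column (C a) y = j + 1"
      using val[of i "j + 1"] c x(1) by auto
    have "x < y" using column_strict_mono[OF fin x(3) y(2)] x(4) y(3) by simp
    then show "below (entry ?U i j) (entry ?U i (j + 1))"
      using chain_below[OF chains x(3) y(2)] x(2) y(1) by simp
  next
    fix i j assume c: "(i, j) \<in> diagram mu \<and> (i + 1, j) \<in> diagram mu"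
    obtain a x where x: "i = Suc a" "?U (i, j) = Some x" "x \<in> C a" "column (C a) x = j"
      using val c by blast
    obtain y where y: "?U (i + 1, j) = Some y" "y \<in> C (Suc a)" "column (C (Suc a)) y = j"
      using val[of "i + 1" j] c x(1) by auto
    have "\<not> flaw_at (C a) (C (Suc a)) j y" using C(2) by (simp add: unflawed_def)
    then have "\<not> below y x"
      using not_below_card_iff[OF chains x(3), of y] y x(4) by (simp add: flaw_at_def)
    then show "\<not> below (entry ?U (i + 1) j) (entry ?U i j)" using x(2) y(1) by simp
  qed (use dom ran in auto)
qed

text \<open>
  The rows of a tableau are chains, and the integer order on them is the order of the poset, so sorting
  recovers the columns.
\<close>

lemma array_of_P_tableau:
  assumes mu: "is_partition mu" "length mu \<le> n" and U: "U \<in> P_tableaux P r mu"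
  shows "array_of_tableau U \<in> arrays n" "unflawed (array_of_tableau U)"
    "tableau_of_array (array_of_tableau U) = U" "(\<lambda>i. card (array_of_tableau U i)) = part mu"
proof -
  let ?C = "array_of_tableau U"
  have dom: "dom U = cells (part mu)" and ran: "ran U = P"
    using U by (auto simp: P_tableaux_def fillings_def diagram_eq_cells)
  have row: "below (entry U i j) (entry U i (Suc j))" if "(i, j) \<in> cells (part mu)" "(i, Suc j) \<in> cells (part mu)" for i j
    using U that by (auto simp: P_tableaux_def diagram_eq_cells)
  have col: "\<not> below (entry U (Suc i) j) (entry U i j)" if "(i, j) \<in> cells (part mu)" "(Suc i, j) \<in> cells (part mu)" for i j
    using U that by (auto simp: P_tableaux_def diagram_eq_cells)
  have par: "part mu \<in> Par n" by (rule part_Par[OF mu])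
  have cell: "U (Suc i, j) = Some (entry U (Suc i) j)" if "1 \<le> j" "j \<le> part mu i" for i j
  proof -
    have "(Suc i, j) \<in> dom U" using that dom by simp
    then show ?thesis by auto
  qed
  have cellD: "1 \<le> j \<and> j \<le> part mu i" if "U (Suc i, j) = Some x" for i j x
  proof -
    have "(Suc i, j) \<in> dom U" using that by blast
    then show ?thesis using dom by simp
  qed
  define e where "e i j = entry U (Suc i) j" for i j
  have e: "U (Suc i, j) = Some x \<longleftrightarrow> 1 \<le> j \<and> j \<le> part mu i \<and> x = e i j" for i j x
    using cell[of j i] cellD[of i j x] by (auto simp: e_def)
  have mono: "below (e i j) (e i j')" if "1 \<le> j" "j < j'" "j' \<le> part mu i" for i j j'
    using that(2,3)
  proof (induction j')
    case (Suc k)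
    have step: "below (e i k) (e i (Suc k))" if "1 \<le> k" using row[of "Suc i" k] that Suc.prems by (simp add: e_def)
    show ?case
    proof (cases "j = k")
      case True
      then show ?thesis using step \<open>1 \<le> j\<close> by simp
    next
      case False
      then have "below (e i j) (e i k)" using Suc by simp
      moreover have "below (e i k) (e i (Suc k))" using step \<open>1 \<le> j\<close> False Suc.prems by simp
      ultimately show ?thesis by (rule below_trans)
    qed
  qed simp
  have less: "e i j < e i j' \<longleftrightarrow> j < j'"
    if "1 \<le> j" "j \<le> part mu i" "1 \<le> j'" "j' \<le> part mu i" for i j j'
    using below_less[OF mono[of j j' i]] below_less[OF mono[of j' j i]] that
    by (cases j j' rule: linorder_cases) auto
  have C: "?C i = e i ` {1..part mu i}" for i by (auto simp: array_of_tableau_def e)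
  have inj: "inj_on (e i) {1..part mu i}" for i
    using less by (intro inj_onI) (metis atLeastAtMost_iff less_irrefl linorder_neqE_nat)
  show card: "(\<lambda>i. card (?C i)) = part mu" using card_image[OF inj] by (simp add: C fun_eq_iff)
  have e_in: "e i j \<in> P" if "1 \<le> j" "j \<le> part mu i" for i j
    using ranI[of U "(Suc i, j)" "e i j"] e[of i j "e i j"] that ran by simp
  have chains: "chain (?C i)" for i
    unfolding chain_def
  proof (intro conjI ballI)
    show "?C i \<subseteq> P" using e_in by (auto simp: C)
    fix x y assume "x \<in> ?C i" "y \<in> ?C i"
    then obtain j j' where x: "x = e i j" "1 \<le> j" "j \<le> part mu i" and y: "y = e i j'" "1 \<le> j'" "j' \<le> part mu i"
      by (auto simp: C)
    show "\<not> incomp x y"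
      using mono[of j j' i] mono[of j' j i] incomp_not_below[of x y] not_incomp_self x y
      by (cases j j' rule: linorder_cases) auto
  qed
  have "(\<Union>i. ?C i) = P"
  proof
    show "(\<Union>i. ?C i) \<subseteq> P" using chains by (auto simp: chain_def)
    show "P \<subseteq> (\<Union>i. ?C i)"
    proof
      fix x assume "x \<in> P"
      then obtain c where c: "U c = Some x" using ran by (auto simp: ran_def)
      then have "c \<in> cells (part mu)" using dom by blast
      then obtain i j where "c = (Suc i, j)" by (rule cellsE)
      then show "x \<in> (\<Union>i. ?C i)" using c by (auto simp: array_of_tableau_def)
    qed
  qed
  then show arr: "?C \<in> arrays n" using chains Par_zero[OF par] by (auto simp: arrays_def C)
  have column: "column (?C i) (e i j) = j" if "1 \<le> j" "j \<le> part mu i" for i j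
  proof -
    have "{z \<in> ?C i. z \<le> e i j} = e i ` {1..j}"
    proof (intro equalityI subsetI)
      fix z assume "z \<in> {z \<in> ?C i. z \<le> e i j}"
      then obtain j' where j': "z = e i j'" "1 \<le> j'" "j' \<le> part mu i" "e i j' \<le> e i j" by (auto simp: C)
      then have "j' \<le> j" using less[of j i j'] that by (simp add: not_less[symmetric])
      then show "z \<in> e i ` {1..j}" using j' by auto
    next
      fix z assume "z \<in> e i ` {1..j}"
      then obtain j' where j': "z = e i j'" "1 \<le> j'" "j' \<le> j" by auto
      then show "z \<in> {z \<in> ?C i. z \<le> e i j}"
        using less[of j i j'] that by (auto simp: C not_less[symmetric])
    qed
    moreover have "inj_on (e i) {1..j}" by (rule inj_on_subset[OF inj]) (use that in auto)
    ultimately show ?thesis by (simp add: column_def card_image)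
  qed
  have fin: "finite (?C i)" for i using chains chain_finite by blast
  show "tableau_of_array ?C = U"
  proof (rule tableau_ext)
    show "U (0, j) = None" for j using dom by (metis cells_0 domIff)
    show "tableau_of_array ?C (Suc i, j) = Some x \<longleftrightarrow> U (Suc i, j) = Some x" for i j x
      unfolding tableau_of_array_eq[OF fin] e using column by (auto simp: C)
  qed simp
  show "unflawed ?C"
    unfolding unflawed_def
  proof (intro allI notI)
    fix i j y assume "flaw_at (?C i) (?C (Suc i)) j y"
    then have y: "y \<in> ?C (Suc i)" "column (?C (Suc i)) y = j" "card {x \<in> ?C i. \<not> below y x} < j"
      by (auto simp: flaw_at_def)
    then obtain j' where j': "y = e (Suc i) j'" "1 \<le> j'" "j' \<le> part mu (Suc i)" by (auto simp: C)
    then have jj: "j' = j" using y(2) column by simp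
    have le: "j \<le> part mu i" using Par_mono[OF par, of i "Suc i"] j' jj by simp
    then have x: "e i j \<in> ?C i" "column (?C i) (e i j) = j" using j' jj column by (auto simp: C)
    then have "below y (e i j)" using not_below_card_iff[OF chains x(1), of y] y(3) by simp
    moreover have "\<not> below (e (Suc i) j) (e i j)"
      using col[of "Suc i" j] j' jj le by (simp add: e_def)
    ultimately show False using j' jj by simp
  qed
qed

lemma inv_G_tableau_of_array:
  assumes C: "C \<in> arrays n"
  shows "inv_G P r (tableau_of_array C, V) = array_inversions n C"
proof -
  let ?U = "tableau_of_array C"
  have fin: "finite (C i)" for i using C chain_finite by (auto simp: arrays_def)
  have val: "?U (Suc i, j) = Some x \<longleftrightarrow> x \<in> C i \<and> column (C i) x = j" for i j x
    by (rule tableau_of_array_eq[OF fin])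
  have at: "?U (Suc i, column (C i) x) = Some x" if "x \<in> C i" for i x using val that by blast
  have dom: "\<exists>a x. i = Suc a \<and> x \<in> C a \<and> column (C a) x = j \<and> ?U (i, j) = Some x" if c: "(i, j) \<in> dom ?U" for i j
  proof -
    obtain x where x: "?U (i, j) = Some x" using c by blast
    then obtain a where "i = Suc a" by (cases i) auto
    then show ?thesis using x val by blast
  qed
  let ?L = "{((i, j), (k, l)). (i, j) \<in> dom ?U \<and> (k, l) \<in> dom ?U \<and> i < k \<and>
        incomp (entry ?U i j) (entry ?U k l) \<and> entry ?U i j > entry ?U k l}"
  let ?R = "{(k, i, x, y). k < n \<and> i < k \<and> x \<in> C i \<and> y \<in> C k \<and> incomp x y \<and> y < x}"
  let ?g = "\<lambda>(k, i, x, y). ((Suc i, column (C i) x), (Suc k, column (C k) y))"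
  have inj: "inj_on ?g ?R"
    using column_inject[OF fin] by (auto simp: inj_on_def)
  have img: "?g ` ?R = ?L"
  proof (intro equalityI subsetI)
    fix z assume "z \<in> ?g ` ?R"
    then obtain k i x y where z: "z = ((Suc i, column (C i) x), (Suc k, column (C k) y))"
      and *: "i < k" "x \<in> C i" "y \<in> C k" "incomp x y" "y < x" by auto
    show "z \<in> ?L" using * at[OF *(2)] at[OF *(3)] by (auto simp: z)
  next
    fix z assume "z \<in> ?L"
    moreover obtain i j k l where z: "z = ((i, j), (k, l))" by (metis surj_pair)
    ultimately have *: "(i, j) \<in> dom ?U" "(k, l) \<in> dom ?U" "i < k"
      "incomp (entry ?U i j) (entry ?U k l)" "entry ?U i j > entry ?U k l"
      unfolding z mem_Collect_eq prod.case by blast+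
    obtain a x where x: "i = Suc a" "x \<in> C a" "column (C a) x = j" "?U (i, j) = Some x" using dom *(1) by blast
    obtain b y where y: "k = Suc b" "y \<in> C b" "column (C b) y = l" "?U (k, l) = Some y" using dom *(2) by blast
    have "b < n" using y(2) C by (cases "b < n") (auto simp: arrays_def)
    then have "(b, a, x, y) \<in> ?R" using * x y by simp
    then show "z \<in> ?g ` ?R" by (rule image_eqI[rotated]) (simp add: z x(1,3) y(1,3))
  qed
  have "card ?L = card ?R" unfolding img[symmetric] by (rule card_image[OF inj])
  then show ?thesis unfolding inv_G_def array_inversions_card[OF C] by simp
qed

section \<open>The expansion\<close>

lemma skew_tableaux_iff_elegant:
  assumes lam: "is_partition lam" "length lam \<le> n"
  shows "diagram mu \<subseteq> diagram lam \<and> V \<in> skew_tableaux lam mu \<and> (\<forall>i j. (i, j) \<in> dom V \<longrightarrow> entry V i j < i) \<longleftrightarrow>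
    (part lam, V) \<in> elegant n n (part mu)"
proof
  assume *: "diagram mu \<subseteq> diagram lam \<and> V \<in> skew_tableaux lam mu \<and> (\<forall>i j. (i, j) \<in> dom V \<longrightarrow> entry V i j < i)"
  then have dom: "dom V = cells (part lam) - cells (part mu)" and ran: "ran V \<subseteq> {1..}"
    by (auto simp: skew_tableaux_def fillings_def diagram_eq_cells)
  show "(part lam, V) \<in> elegant n n (part mu)"
  proof (rule elegantI[OF part_Par[OF lam] _ dom])
    show "cells (part mu) \<subseteq> cells (part lam)" using * by (simp add: diagram_eq_cells)
    fix i j v assume v: "V (i, j) = Some v"
    then have "(i, j) \<in> cells (part lam)" using dom by blast
    then obtain a where a: "i = Suc a" "1 \<le> part lam a" by (cases i) (auto simp: cells_def)
    then have "a < n" using Par_zero[OF part_Par[OF lam], of a] by (cases "a < n") auto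
    moreover have "(i, j) \<in> dom V" using v by blast
    then have "v < i" using * v by (metis option.sel)
    moreover have "1 \<le> v" using ranI[of V, OF v] ran by auto
    ultimately show "1 \<le> v \<and> v \<le> n \<and> v < i" using a by simp
  next
    fix i j j' v v' assume v: "V (i, j) = Some v" "V (i, j') = Some v'" "j < j'"
    then have "(i, j) \<in> dom V" "(i, j') \<in> dom V" by blast+
    then have "entry V i j \<le> entry V i j'" using * v(3) unfolding skew_tableaux_def by blast
    then show "v \<le> v'" using v by simp
  next
    fix i i' j v v' assume v: "V (i, j) = Some v" "V (i', j) = Some v'" "i < i'"
    then have "(i, j) \<in> dom V" "(i', j) \<in> dom V" by blast+
    then have "entry V i j < entry V i' j" using * v(3) unfolding skew_tableaux_def by blast
    then show "v < v'" using v by simp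
  qed
next
  assume "(part lam, V) \<in> elegant n n (part mu)"
  note D = elegantD[OF this]
  have "diagram mu \<subseteq> diagram lam" using D(2) by (simp add: diagram_eq_cells)
  moreover have "V \<in> skew_tableaux lam mu"
    unfolding skew_tableaux_def fillings_def
  proof (intro CollectI conjI allI impI)
    show "dom V = diagram lam - diagram mu" using D(3) by (simp add: diagram_eq_cells)
    show "ran V \<subseteq> {1..}"
    proof
      fix v assume "v \<in> ran V"
      then obtain c where "V c = Some v" by (auto simp: ran_def)
      then show "v \<in> {1..}" using D(4)[of "fst c" "snd c" v] by simp
    qed
    show "entry V i j \<le> entry V i j'" if "(i, j) \<in> dom V \<and> (i, j') \<in> dom V \<and> j < j'" for i j j'
      using that D(5)[of i j _ j'] by auto
    show "entry V i j < entry V i' j" if "(i, j) \<in> dom V \<and> (i', j) \<in> dom V \<and> i < i'" for i i' j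
      using that D(6)[of i j _ i'] by auto
  qed
  moreover have "entry V i j < i" if "(i, j) \<in> dom V" for i j using that D(4)[of i j] by auto
  ultimately show "diagram mu \<subseteq> diagram lam \<and> V \<in> skew_tableaux lam mu \<and> (\<forall>i j. (i, j) \<in> dom V \<longrightarrow> entry V i j < i)"
    by blast
qed

lemma length_le_iff_Par:
  assumes "is_partition lam"
  shows "length lam \<le> n \<longleftrightarrow> part lam \<in> Par n"
proof
  assume p: "part lam \<in> Par n"
  show "length lam \<le> n"
  proof (rule ccontr)
    assume "\<not> length lam \<le> n"
    then have "lam ! n \<in> set lam" by simp
    then have "lam ! n \<noteq> 0" using assms by (metis is_partition_def)
    then have "part lam n \<noteq> 0" using \<open>\<not> length lam \<le> n\<close> by (simp add: part_def)
    then show False using Par_zero[OF p, of n] by simp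
  qed
qed (rule part_Par[OF assms])

text \<open>
  The tableaux with at most \<open>n\<close> rows. For a monomial in \<open>x\<^sub>1, \<dots>, x\<^sub>n\<close> the other ones contribute nothing.
\<close>

definition short_tableaux :: "nat \<Rightarrow> (nat filling \<times> nat filling) set" where
  "short_tableaux n = {T \<in> grothendieck_tableaux P r. length (shape T) \<le> n}"

lemma short_tableaux_bij:
  "bij_betw (\<lambda>(C, \<kappa>, V). (tableau_of_array C, V))
    (SIGMA C:{C \<in> arrays n. unflawed C}. elegant n n (\<lambda>i. card (C i))) (short_tableaux n)"
  "x \<in> (SIGMA C:{C \<in> arrays n. unflawed C}. elegant n n (\<lambda>i. card (C i))) \<Longrightarrow>
    part (shape (tableau_of_array (fst x), snd (snd x))) = fst (snd x)"
proof -
  let ?H = "SIGMA C:{C \<in> arrays n. unflawed C}. elegant n n (\<lambda>i. card (C i))"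
  have forward: "\<exists>lam. is_partition lam \<and> length lam \<le> n \<and> part lam = \<kappa> \<and>
      (tableau_of_array C, V) \<in> grothendieck_tableaux_of_shape P r lam"
    if "(C, \<kappa>, V) \<in> ?H" for C \<kappa> V
  proof -
    have C: "C \<in> arrays n" "unflawed C" and V: "(\<kappa>, V) \<in> elegant n n (\<lambda>i. card (C i))" using that by auto
    obtain mu where mu: "is_partition mu" "length mu \<le> n" "part mu = (\<lambda>i. card (C i))"
      using part_surj[OF unflawed_antimono[OF C]] by blast
    obtain lam where lam: "is_partition lam" "length lam \<le> n" "part lam = \<kappa>"
      using part_surj[OF elegantD(1)[OF V]] by blast
    have "tableau_of_array C \<in> P_tableaux P r mu" by (rule tableau_of_array_P_tableau[OF C mu(3)])
    moreover have "(part lam, V) \<in> elegant n n (part mu)" using V lam(3) mu(3) by simp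
    then have "diagram mu \<subseteq> diagram lam \<and> V \<in> skew_tableaux lam mu \<and> (\<forall>i j. (i, j) \<in> dom V \<longrightarrow> entry V i j < i)"
      using skew_tableaux_iff_elegant[OF lam(1,2)] by blast
    ultimately have "(tableau_of_array C, V) \<in> grothendieck_tableaux_of_shape P r lam"
      using mu(1) by (auto simp: grothendieck_tableaux_of_shape_def)
    then show ?thesis using lam by blast
  qed
  show shape: "part (shape (tableau_of_array (fst x), snd (snd x))) = fst (snd x)" if "x \<in> ?H" for x
    using forward[of "fst x" "fst (snd x)" "snd (snd x)"] that shape_eq by force
  show "bij_betw (\<lambda>(C, \<kappa>, V). (tableau_of_array C, V)) ?H (short_tableaux n)"
  proof (rule bij_betw_byWitness[where f' = "\<lambda>T. (array_of_tableau (fst T), part (shape T), snd T)"])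
    show "\<forall>x\<in>?H. (\<lambda>T. (array_of_tableau (fst T), part (shape T), snd T))
        ((\<lambda>(C, \<kappa>, V). (tableau_of_array C, V)) x) = x"
    proof
      fix x assume x: "x \<in> ?H"
      obtain C \<kappa> V where xe: "x = (C, \<kappa>, V)" by (cases x)
      have "array_of_tableau (tableau_of_array C) = C" using x xe array_of_tableau_of_array by auto
      then show "(\<lambda>T. (array_of_tableau (fst T), part (shape T), snd T))
        ((\<lambda>(C, \<kappa>, V). (tableau_of_array C, V)) x) = x"
        using shape[OF x] by (simp add: xe)
    qed
    have backward: "(array_of_tableau U, part (shape (U, V)), V) \<in> ?H \<and> tableau_of_array (array_of_tableau U) = U"
      if UV: "(U, V) \<in> short_tableaux n" for U V
    proof -
      obtain lam where lam: "is_partition lam" "(U, V) \<in> grothendieck_tableaux_of_shape P r lam"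
        using UV by (auto simp: short_tableaux_def grothendieck_tableaux_def)
      have sh: "shape (U, V) = lam" by (rule shape_eq[OF lam])
      then have len: "length lam \<le> n" using UV by (simp add: short_tableaux_def)
      obtain mu where mu: "is_partition mu" "diagram mu \<subseteq> diagram lam" "U \<in> P_tableaux P r mu"
        "V \<in> skew_tableaux lam mu" "\<forall>i j. (i, j) \<in> dom V \<longrightarrow> entry V i j < i"
        using lam(2) by (auto simp: grothendieck_tableaux_of_shape_def)
      have "part mu i \<le> part lam i" for i using mu(2) by (simp add: diagram_eq_cells cells_mono)
      then have "part mu i = 0" if "n \<le> i" for i
        using Par_zero[OF part_Par[OF lam(1) len] that] by (metis le_zero_eq)
      then have "part mu \<in> Par n"
        using part_Par[OF mu(1) order_refl] by (auto simp: Par_def)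
      then have lmu: "length mu \<le> n" using length_le_iff_Par[OF mu(1)] by blast
      note array = array_of_P_tableau[OF mu(1) lmu mu(3)]
      have "(part lam, V) \<in> elegant n n (part mu)"
        using skew_tableaux_iff_elegant[OF lam(1) len] mu(2,4,5) by blast
      then show ?thesis using array sh by simp
    qed
    show "\<forall>T\<in>short_tableaux n. (\<lambda>(C, \<kappa>, V). (tableau_of_array C, V))
        (array_of_tableau (fst T), part (shape T), snd T) = T"
      using backward by auto
    show "(\<lambda>T. (array_of_tableau (fst T), part (shape T), snd T)) ` short_tableaux n \<subseteq> ?H"
      using backward by auto
    show "(\<lambda>(C, \<kappa>, V). (tableau_of_array C, V)) ` ?H \<subseteq> short_tableaux n"
    proof
      fix T assume "T \<in> (\<lambda>(C, \<kappa>, V). (tableau_of_array C, V)) ` ?H"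
      then obtain C \<kappa> V where T: "T = (tableau_of_array C, V)" and H: "(C, \<kappa>, V) \<in> ?H" by auto
      obtain lam where lam: "is_partition lam" "length lam \<le> n"
        "(tableau_of_array C, V) \<in> grothendieck_tableaux_of_shape P r lam" using forward[OF H] by blast
      then show "T \<in> short_tableaux n"
        using shape_eq[OF lam(1,3)] by (auto simp: T short_tableaux_def grothendieck_tableaux_def)
    qed
  qed
qed

lemma finite_short_tableaux: "finite (short_tableaux n)"
proof -
  have "finite (SIGMA C:{C \<in> arrays n. unflawed C}. elegant n n (\<lambda>i. card (C i)))"
    using finite_arrays sum_elegant[OF unflawed_antimono] by (intro finite_SigmaI) auto
  then show ?thesis using bij_betw_finite[OF short_tableaux_bij(1)] by blast
qed

lemma shape_partition:
  assumes "T \<in> grothendieck_tableaux P r"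
  shows "is_partition (shape T)"
proof -
  obtain lam where "is_partition lam" "T \<in> grothendieck_tableaux_of_shape P r lam"
    using assms by (auto simp: grothendieck_tableaux_def)
  then show ?thesis using shape_eq by metis
qed

text \<open>
  For fixed \<open>U\<close>, the sum over \<open>V\<close> is a Schur coefficient; the sum over \<open>U\<close> is then the Schur expansion of
  the arrays.
\<close>

lemma sum_short_tableaux:
  assumes m: "set_mset m \<subseteq> {1..n}"
  shows "(\<Sum>T\<in>short_tableaux n. monom 1 (inv_G P r T) * s_bar (shape T) m) = X_bar (inc P r) m"
proof -
  let ?H = "SIGMA C:{C \<in> arrays n. unflawed C}. elegant n n (\<lambda>i. card (C i))"
  let ?\<gamma> = "\<lambda>i. count m (Suc i)"
  let ?q = "\<lambda>C. monom 1 (array_inversions n C) :: int poly"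
  have "(\<Sum>T\<in>short_tableaux n. monom 1 (inv_G P r T) * s_bar (shape T) m) =
      (\<Sum>x\<in>?H. monom 1 (inv_G P r (tableau_of_array (fst x), snd (snd x))) *
        s_bar (shape (tableau_of_array (fst x), snd (snd x))) m)"
    using sum.reindex_bij_betw[OF short_tableaux_bij(1), of "\<lambda>T. monom 1 (inv_G P r T) * s_bar (shape T) m", symmetric]
    by (simp add: case_prod_unfold)
  also have "\<dots> = (\<Sum>x\<in>?H. ?q (fst x) * groth n n (fst (snd x)) ?\<gamma>)"
  proof (rule sum.cong[OF refl])
    fix x assume x: "x \<in> ?H"
    let ?T = "(tableau_of_array (fst x), snd (snd x))"
    have "?T \<in> short_tableaux n"
      using bij_betwE[OF short_tableaux_bij(1)] x by (force simp: case_prod_unfold)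
    then have "is_partition (shape ?T)" "length (shape ?T) \<le> n"
      using shape_partition by (auto simp: short_tableaux_def)
    then have "s_bar (shape ?T) m = groth n n (fst (snd x)) ?\<gamma>"
      using s_bar_eq_groth[OF _ _ m] short_tableaux_bij(2)[OF x] by simp
    moreover have "inv_G P r ?T = array_inversions n (fst x)"
      using x by (intro inv_G_tableau_of_array) auto
    ultimately show "monom 1 (inv_G P r ?T) * s_bar (shape ?T) m = ?q (fst x) * groth n n (fst (snd x)) ?\<gamma>"
      by simp
  qed
  also have "\<dots> = (\<Sum>C\<in>{C \<in> arrays n. unflawed C}. \<Sum>y\<in>elegant n n (\<lambda>i. card (C i)). ?q C * groth n n (fst y) ?\<gamma>)"
    using finite_arrays sum_elegant[OF unflawed_antimono] by (subst sum.Sigma) (auto simp: case_prod_unfold)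
  also have "\<dots> = (\<Sum>C\<in>{C \<in> arrays n. unflawed C}. ?q C * kostka n (\<lambda>i. card (C i)) (\<lambda>i. int (?\<gamma> i)))"
  proof (rule sum.cong[OF refl])
    fix C assume "C \<in> {C \<in> arrays n. unflawed C}"
    then have "(\<lambda>i. card (C i)) \<in> Par n" using unflawed_antimono by blast
    then have "groth 0 n (\<lambda>i. card (C i)) ?\<gamma> = (\<Sum>y\<in>elegant n n (\<lambda>i. card (C i)). groth n n (fst y) ?\<gamma>)"
      using sum_elegant by (simp add: case_prod_unfold)
    then show "(\<Sum>y\<in>elegant n n (\<lambda>i. card (C i)). ?q C * groth n n (fst y) ?\<gamma>) =
        ?q C * kostka n (\<lambda>i. card (C i)) (\<lambda>i. int (?\<gamma> i))"
      by (simp add: sum_distrib_left groth_0_eq_kostka[symmetric])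
  qed
  also have "\<dots> = X_bar (inc P r) m"
    by (simp only: X_bar_eq_array_count[OF m] array_count_eq_kostka_sum)
  finally show ?thesis .
qed

text \<open>
  Monomials are multisets of natural numbers, but letters and colors are positive, so a monomial that contains
  \<open>0\<close> occurs on neither side.
\<close>

lemma s_bar_with_0: "0 \<in># m \<Longrightarrow> s_bar lam m = 0"
proof -
  assume m: "0 \<in># m"
  have "tableau_weight F \<noteq> m" if "F \<in> set_valued_tableaux lam" for F
  proof -
    have F: "dom F = diagram lam" "ran F \<subseteq> SetP"
      using that by (auto simp: set_valued_tableaux_def fillings_def)
    then have "0 \<notin> total_filling F c" for c
      using SetP_entry(3)[of F c] by (auto simp: total_filling_def split: option.splits)
    then have "count (tableau_weight F) 0 = 0"
      using count_tableau_weight[of F 0] F finite_diagram by (simp add: multiplicity_of_def)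
    then show ?thesis using m by (metis count_eq_zero_iff)
  qed
  then have "{T \<in> set_valued_tableaux lam.
      single_term ((- 1) ^ (tableau_size T - sum_list lam)) (tableau_weight T) m \<noteq> 0} = {}"
    by (auto simp: single_term_def)
  then show ?thesis unfolding s_bar_def formal_sum_def by (simp only: sum.empty)
qed

lemma X_bar_with_0: "0 \<in># m \<Longrightarrow> X_bar (inc P r) m = 0"
proof -
  assume m: "0 \<in># m"
  have "(\<Sum>v\<in>fst (inc P r). mset_set (\<kappa> v)) \<noteq> m" if "\<kappa> \<in> proper_set_colorings (inc P r)" for \<kappa>
  proof -
    have \<kappa>: "\<kappa> \<in> P \<rightarrow>\<^sub>E SetP" using that by (simp add: proper_set_colorings_def inc_def)
    then have "{v \<in> P. 0 \<in> \<kappa> v} = {}" by (auto simp: SetP_def PiE_iff)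
    then have "count (\<Sum>v\<in>P. mset_set (\<kappa> v)) 0 = 0"
      using count_coloring_weight[OF \<kappa>, of 0] by (simp only: card.empty)
    moreover have "fst (inc P r) = P" by (simp add: inc_def)
    ultimately show ?thesis using m by (metis count_eq_zero_iff)
  qed
  then have "{\<kappa> \<in> proper_set_colorings (inc P r). single_term (monom 1 (asc (inc P r) \<kappa>))
      (\<Sum>v\<in>fst (inc P r). mset_set (\<kappa> v)) m \<noteq> 0} = {}"
    by (auto simp: single_term_def)
  then show ?thesis unfolding X_bar_def formal_sum_def by (simp only: sum.empty)
qed

lemma nonzero_terms_short:
  assumes m: "set_mset m \<subseteq> {1..n}"
    and T: "T \<in> grothendieck_tableaux P r" "scale (monom 1 (inv_G P r T)) (s_bar (shape T)) m \<noteq> 0"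
  shows "T \<in> short_tableaux n"
proof (rule ccontr)
  assume "T \<notin> short_tableaux n"
  then have "n < length (shape T)" using T(1) by (auto simp: short_tableaux_def)
  then have "s_bar (shape T) m = 0" by (rule s_bar_eq_0[OF shape_partition[OF T(1)] _ m])
  then show False using T(2) by (simp add: scale_def)
qed

end

theorem theorem4p21:
  fixes P :: "nat set" and r :: "nat rel" and G :: "nat graph"
  assumes "natural_unit_interval_order P r"
    and "G = inc P r"
  shows "formally_summable (\<lambda>T. scale (monom 1 (inv_G P r T)) (s_bar (shape T)))
           (grothendieck_tableaux P r) \<and>
         X_bar G =
           formal_sum (\<lambda>T. scale (monom 1 (inv_G P r T)) (s_bar (shape T)))
             (grothendieck_tableaux P r)"
proof -
  interpret unit_interval_poset P r using assms(1) by unfold_locales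
  let ?f = "\<lambda>T. scale (monom 1 (inv_G P r T)) (s_bar (shape T))"
  let ?S = "\<lambda>m. {T \<in> grothendieck_tableaux P r. ?f T m \<noteq> 0}"
  have coefficient: "finite (?S m) \<and> X_bar (inc P r) m = (\<Sum>T\<in>?S m. ?f T m)" for m
  proof (cases "0 \<in># m")
    case True
    then have "?S m = {}" using s_bar_with_0 by (simp add: scale_def)
    then show ?thesis using X_bar_with_0[OF True] by (simp only: sum.empty finite.emptyI simp_thms)
  next
    case False
    obtain n where "\<forall>k\<in>set_mset m. k \<le> n" using finite_nat_set_iff_bounded_le[of "set_mset m"] by auto
    then have m: "set_mset m \<subseteq> {1..n}" using False by (auto simp: Suc_le_eq intro: gr0I)
    have sub: "?S m \<subseteq> short_tableaux n" using nonzero_terms_short[OF m] by blast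
    have "X_bar (inc P r) m = (\<Sum>T\<in>short_tableaux n. ?f T m)"
      unfolding sum_short_tableaux[OF m, symmetric] by (simp only: scale_def)
    also have "\<dots> = (\<Sum>T\<in>?S m. ?f T m)"
      by (rule sum.mono_neutral_right[OF finite_short_tableaux sub]) (auto simp: short_tableaux_def)
    finally show ?thesis using finite_subset[OF sub finite_short_tableaux] by blast
  qed
  have "formally_summable ?f (grothendieck_tableaux P r)"
    unfolding formally_summable_def using coefficient by blast
  moreover have "X_bar G = formal_sum ?f (grothendieck_tableaux P r)"
    unfolding formal_sum_def assms(2) using coefficient by blast
  ultimately show ?thesis by blast
qed

end
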